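(* Let $\theta,\rho\in\mathbb{R}$ with $|\theta|<1$, $|\rho|<1$, let $(V_n)_{n\ge1}$ be a sequence of independent and identically distributed real random variables with zero mean, variance $\sigma^2>0$ and finite moment of order $4$, let the initial values $X_0,\varepsilon_0$ be arbitrary, and for all $n\ge1$ let $X_n=\theta X_{n-1}+\varepsilon_n$ and $\varepsilon_n=\rho\varepsilon_{n-1}+V_n$. Let $\widehat\rho_n$ be the serial correlation estimator defined in the context, and set $$\rho^*=\frac{\theta\rho(\theta+\rho)}{1+\theta\rho},\qquad \sigma_\rho^2=\frac{1-\theta\rho}{(1+\theta\rho)^3}\Big((\theta+\rho)^2(1+\theta\rho)^2+(\theta\rho)^2(1-\theta^2)(1-\rho^2)\Big),$$ with $\sigma_\rho=\sqrt{\sigma_\rho^2}$. Then the quadratic strong law holds: $$\lim_{n\to\infty}\frac{1}{\log n}\sum_{k=1}^n\big(\widehat{\rho}_k-\rho^*\big)^2=\sigma_\rho^2\quad\text{almost surely}.$$ In addition, the law of iterated logarithm holds: $$\limsup_{n\to\infty}\Big(\frac{n}{2\log\log n}\Big)^{1/2}\big(\widehat{\rho}_n-\rho^*\big)=-\liminf_{n\to\infty}\Big(\frac{n}{2\log\log n}\Big)^{1/2}\big(\widehat{\rho}_n-\rho^*\big)=\sigma_\rho\quad\text{almost surely}.$$ Consequently, $$\limsup_{n\to\infty}\Big(\frac{n}{2\log\log n}\Big)\big(\widehat{\rho}_n-\rho^*\big)^2=\sigma_\rho^2\quad\text{almost surely}.$$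
   Context: For $n\ge1$ put $$\widehat{\theta}_n=\frac{\sum_{k=1}^n X_kX_{k-1}}{\sum_{k=1}^n X_{k-1}^2}.$$ At step $n$, the least squares residuals are $\widehat{\varepsilon}_0=X_0$ and $\widehat{\varepsilon}_k=X_k-\widehat{\theta}_nX_{k-1}$ for $1\le k\le n$ (they depend on $n$ through $\widehat\theta_n$). The serial correlation estimator is $$\widehat{\rho}_n=\frac{\sum_{k=1}^n\widehat{\varepsilon}_k\widehat{\varepsilon}_{k-1}}{\sum_{k=1}^n\widehat{\varepsilon}_{k-1}^{\,2}}.$$ Convention: a quotient defining an estimator is read as $0$ if its denominator vanishes. *)

theory Defs
  imports "HOL-Probability.Probability"
begin

text \<open>
  The estimators are functions of a single trajectory \<open>x\<close>; they are applied to
  \<open>\<lambda>k. X k \<omega>\<close>. A quotient with vanishing denominator is 0 because \<open>a / 0 = 0\<close> in HOL,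
  which is the intended convention.
\<close>

definition theta_hat :: "(nat \<Rightarrow> real) \<Rightarrow> nat \<Rightarrow> real" where
  "theta_hat x n = (\<Sum>k=1..n. x k * x (k - 1)) / (\<Sum>k=1..n. (x (k - 1))\<^sup>2)"

text \<open>\<open>residual x n k\<close> is the \<open>k\<close>-th least squares residual at step \<open>n\<close>.\<close>

definition residual :: "(nat \<Rightarrow> real) \<Rightarrow> nat \<Rightarrow> nat \<Rightarrow> real" where
  "residual x n k = (if k = 0 then x 0 else x k - theta_hat x n * x (k - 1))"

definition rho_hat :: "(nat \<Rightarrow> real) \<Rightarrow> nat \<Rightarrow> real" where
  "rho_hat x n =
     (\<Sum>k=1..n. residual x n k * residual x n (k - 1)) / (\<Sum>k=1..n. (residual x n (k - 1))\<^sup>2)"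

definition rho_star :: "real \<Rightarrow> real \<Rightarrow> real" where
  "rho_star \<theta> \<rho> = \<theta> * \<rho> * (\<theta> + \<rho>) / (1 + \<theta> * \<rho>)"

definition sigma_rho_sq :: "real \<Rightarrow> real \<Rightarrow> real" where
  "sigma_rho_sq \<theta> \<rho> =
     (1 - \<theta> * \<rho>) / (1 + \<theta> * \<rho>) ^ 3 *
     ((\<theta> + \<rho>)\<^sup>2 * (1 + \<theta> * \<rho>)\<^sup>2 + (\<theta> * \<rho>)\<^sup>2 * (1 - \<theta>\<^sup>2) * (1 - \<rho>\<^sup>2))"

definition sigma_rho :: "real \<Rightarrow> real \<Rightarrow> real" where
  "sigma_rho \<theta> \<rho> = sqrt (sigma_rho_sq \<theta> \<rho>)"

end

theory Submission
  imports Defs "HOL-Real_Asymp.Real_Asymp"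
begin

text \<open>
Put \<open>a = \<theta> + \<rho>\<close> and \<open>b = - \<theta> \<rho>\<close>. Eliminating the errors shows that the observations satisfy
\<open>X\<^bsub>k+2\<^esub> = a X\<^bsub>k+1\<^esub> + b X\<^sub>k + V\<^bsub>k+2\<^esub>\<close>, an autoregression of order two. Inserting this recursion into the
definition of the estimator gives an exact formula (\<open>rho_hat_expansion\<close>): the deviation from
\<open>\<rho>\<^sup>*\<close> is a combination of the martingales \<open>M = \<Sum> V\<^bsub>k+1\<^esub> X\<^sub>k\<close> and \<open>N = \<Sum> V\<^bsub>k+1\<^esub> X\<^bsub>k-1\<^esub>\<close>, plus boundary terms, divided
by the residual energy. The residual energy is asymptotically a constant times \<open>n\<close>, by linear
relations between the sample moments (\<open>ar2_averages\<close>), and the random coefficients converge. Hence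
\<open>n * (rho_hat - \<rho>\<^sup>*)\<close> is, up to a convergent factor and negligible remainders, a single martingale
\<open>W = \<Sum> V\<^bsub>k+1\<^esub> Y\<^sub>k\<close>, where \<open>Y\<^sub>k = c1 X\<^sub>k + c2 X\<^bsub>k-1\<^esub>\<close> is a linear process with geometrically decaying impulse
response (\<open>rho_hat_linearization\<close>). Arbitrary initial values change \<open>W\<close> only by a bounded sequence. What remains
are the two limit laws for \<open>W\<close>.

Upper bounds rest on \<open>exp (x - x\<^sup>2 / 6) \<le> 1 + x + x\<^sup>2 / 3\<close>, valid for all real \<open>x\<close>. It provides an
exponential supermartingale without truncation of the noise, and a maximal inequality over all
times (\<open>ville_exp\<close>). Since the quadratic variation of \<open>W\<close> divided by \<open>n\<close> converges, this yields the sharp upper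
half of the law of the iterated logarithm (\<open>lil_upper\<close>). The quadratic strong law follows by summation by parts of \<open>W\<^sup>2 / n\<close>;
its cross term is again a martingale and is controlled by the same inequality
(\<open>quadratic_strong_law\<close>).

For the lower half, \<open>Y\<close> is restarted from 0 at all multiples of a large \<open>L\<close>. Then \<open>W\<close> becomes a sum of
i.i.d. blocks, and the error is a martingale whose quadratic variation is of order \<open>n / L\<close>, hence negligible
by the upper half as \<open>L\<close> grows (\<open>lil_lin_lower\<close>). For i.i.d. sums the required moderate
deviation bound is obtained from the central limit theorem, applied at a fixed level to
logarithmically many blocks (\<open>iid_increments_lower\<close>).

Strong laws of large numbers are all derived from second moments (\<open>strong_law_of_variance_bound\<close>);
this and the control of the boundary terms are where the fourth moment of the noise is used.
\<close>

section \<open>Cesaro and logarithmic averages\<close>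

lemma cesaro_mean:
  fixes a :: "nat \<Rightarrow> real"
  assumes "a \<longlonglongrightarrow> l"
  shows "(\<lambda>n. (\<Sum>k<n. a k) / real n) \<longlonglongrightarrow> l"
proof (rule LIMSEQ_I)
  fix e :: real assume e: "0 < e"
  from LIMSEQ_D[OF assms, of "e/2"] e obtain N where N: "\<And>n. n \<ge> N \<Longrightarrow> \<bar>a n - l\<bar> < e / 2" by auto
  define K where "K = (\<Sum>k<N. \<bar>a k - l\<bar>)"
  have "(\<lambda>n. K / real n) \<longlonglongrightarrow> 0" by real_asymp
  then have "\<forall>\<^sub>F n in sequentially. K / real n < e / 2" by (rule order_tendstoD) (use e in simp)
  then have "\<forall>\<^sub>F n in sequentially. norm ((\<Sum>k<n. a k) / real n - l) < e"
    using eventually_gt_at_top[of N]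
  proof eventually_elim
    case (elim n)
    have "\<bar>\<Sum>k<n. a k - l\<bar> \<le> (\<Sum>k<n. \<bar>a k - l\<bar>)" by (rule sum_abs)
    also have "\<dots> \<le> (\<Sum>k<n. (if k < N then \<bar>a k - l\<bar> else 0) + e / 2)"
      by (intro sum_mono) (use N e in \<open>auto simp: not_less intro: less_imp_le\<close>)
    also have "\<dots> = K + e / 2 * real n"
    proof -
      have "(\<Sum>k<n. if k < N then \<bar>a k - l\<bar> else 0) = K"
        unfolding K_def using elim by (intro sum.mono_neutral_cong_right) auto
      then show ?thesis by (simp add: sum.distrib)
    qed
    finally have "\<bar>\<Sum>k<n. a k - l\<bar> / real n \<le> (K + e / 2 * real n) / real n" by (rule divide_right_mono) simp
    also have "\<dots> = K / real n + e / 2" using elim by (simp add: field_simps)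
    also have "\<dots> < e" using elim by linarith
    finally have "\<bar>(\<Sum>k<n. a k - l) / real n\<bar> < e" by simp
    moreover have "(\<Sum>k<n. a k - l) / real n = (\<Sum>k<n. a k) / real n - l"
      using elim by (simp add: sum_subtractf field_simps)
    ultimately show ?case by simp
  qed
  then show "\<exists>no. \<forall>n\<ge>no. norm ((\<Sum>k<n. a k) / real n - l) < e" by (simp add: eventually_sequentially)
qed

lemma harmonic_sum_over_ln: "(\<lambda>n. (\<Sum>k=1..n. 1 / real k) / ln (real n)) \<longlonglongrightarrow> 1"
proof -
  have "(\<lambda>n. (harm n - ln (real n)) * (1 / ln (real n)) + 1) \<longlonglongrightarrow> euler_mascheroni * 0 + 1"
    by (intro tendsto_intros euler_mascheroni_LIMSEQ) real_asymp
  moreover have "\<forall>\<^sub>F n in sequentially. (harm n - ln (real n)) * (1 / ln (real n)) + 1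
      = (\<Sum>k=1..n. 1 / real k) / ln (real n)"
    using eventually_gt_at_top[of 1]
    by eventually_elim (auto simp: harm_def field_simps)
  ultimately show ?thesis by (auto intro: Lim_transform_eventually)
qed

lemma log_average_null_weights:
  fixes b c :: "nat \<Rightarrow> real"
  assumes c: "\<And>k. 0 \<le> c k" and L: "(\<lambda>n. (\<Sum>k=1..n. c k) / ln (real n)) \<longlonglongrightarrow> \<gamma>"
    and b: "b \<longlonglongrightarrow> 0"
  shows "(\<lambda>n. (\<Sum>k=1..n. b k * c k) / ln (real n)) \<longlonglongrightarrow> 0"
proof (rule LIMSEQ_I)
  fix r :: real assume r: "0 < r"
  have g0: "0 \<le> \<gamma>"
    by (rule tendsto_lowerbound[OF L]) (auto intro!: eventually_at_top_linorderI[of 1] divide_nonneg_nonneg sum_nonneg c)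
  define e where "e = r / (4 * (\<gamma> + 1))"
  have e: "0 < e" using r g0 by (simp add: e_def)
  obtain N where N: "\<And>k. k \<ge> N \<Longrightarrow> \<bar>b k\<bar> < e"
    using LIMSEQ_D[OF b e] by auto
  define K where "K = (\<Sum>k=1..N. \<bar>b k\<bar> * c k)"
  have "(\<lambda>n. K / ln (real n)) \<longlonglongrightarrow> 0" by real_asymp
  then have ev1: "\<forall>\<^sub>F n in sequentially. K / ln (real n) < r / 2"
    by (rule order_tendstoD) (use r in simp)
  have ev2: "\<forall>\<^sub>F n in sequentially. (\<Sum>k=1..n. c k) / ln (real n) < \<gamma> + 1"
    by (rule order_tendstoD(2)[OF L]) simp
  have "\<forall>\<^sub>F n in sequentially. norm ((\<Sum>k=1..n. b k * c k) / ln (real n) - 0) < r"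
    using ev1 ev2 eventually_gt_at_top[of "max N 2"]
  proof eventually_elim
    case (elim n)
    have ln: "ln (real n) > 0" using elim by simp
    have "\<bar>\<Sum>k=1..n. b k * c k\<bar> \<le> (\<Sum>k=1..n. \<bar>b k\<bar> * c k)"
      by (rule order_trans[OF sum_abs]) (simp add: abs_mult c)
    also have "\<dots> \<le> (\<Sum>k=1..n. (if k \<le> N then \<bar>b k\<bar> * c k else 0) + e * c k)"
    proof (rule sum_mono)
      fix k
      show "\<bar>b k\<bar> * c k \<le> (if k \<le> N then \<bar>b k\<bar> * c k else 0) + e * c k"
        using e c[of k] mult_right_mono[OF less_imp_le[OF N[of k]] c[of k]] by auto
    qed
    also have "\<dots> = (\<Sum>k=1..n. (if k \<le> N then \<bar>b k\<bar> * c k else 0)) + e * (\<Sum>k=1..n. c k)"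
      by (simp add: sum.distrib sum_distrib_left)
    also have "(\<Sum>k=1..n. (if k \<le> N then \<bar>b k\<bar> * c k else 0)) = K"
      unfolding K_def using elim by (intro sum.mono_neutral_cong_right) auto
    finally have "\<bar>\<Sum>k=1..n. b k * c k\<bar> / ln (real n) \<le> K / ln (real n) + e * ((\<Sum>k=1..n. c k) / ln (real n))"
      using ln by (simp add: divide_right_mono add_divide_distrib[symmetric])
    also have "\<dots> < r / 2 + e * (\<gamma> + 1)"
      using elim e by (intro add_strict_mono mult_strict_left_mono) auto
    also have "\<dots> \<le> r" using g0 r by (simp add: e_def field_simps)
    finally show ?case using ln by simp
  qed
  then show "\<exists>no. \<forall>n\<ge>no. norm ((\<Sum>k=1..n. b k * c k) / ln (real n) - 0) < r"
    by (simp add: eventually_sequentially)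
qed

text \<open>
Comparing with the constant sequence \<open>\<beta>\<close> leaves weights that tend to 0: beyond some
index they are below any \<open>\<epsilon>\<close>, and the finitely many earlier terms are killed by \<open>ln n\<close>.
\<close>

lemma log_average_weights:
  fixes b c :: "nat \<Rightarrow> real"
  assumes c: "\<And>k. 0 \<le> c k" and L: "(\<lambda>n. (\<Sum>k=1..n. c k) / ln (real n)) \<longlonglongrightarrow> \<gamma>"
    and b: "b \<longlonglongrightarrow> \<beta>"
  shows "(\<lambda>n. (\<Sum>k=1..n. b k * c k) / ln (real n)) \<longlonglongrightarrow> \<beta> * \<gamma>"
proof -
  have "(\<lambda>n. (\<Sum>k=1..n. (b k - \<beta>) * c k) / ln (real n) + \<beta> * ((\<Sum>k=1..n. c k) / ln (real n))) \<longlonglongrightarrow> 0 + \<beta> * \<gamma>"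
    using b by (intro tendsto_intros log_average_null_weights[OF c L] L) (simp add: LIM_zero)
  then show ?thesis
    by (simp add: left_diff_distrib sum_subtractf sum_distrib_left diff_divide_distrib)
qed

lemma log_average:
  fixes b :: "nat \<Rightarrow> real"
  assumes "b \<longlonglongrightarrow> \<beta>"
  shows "(\<lambda>n. (\<Sum>k=1..n. b k / real k) / ln (real n)) \<longlonglongrightarrow> \<beta>"
  using log_average_weights[of "\<lambda>k. 1 / real k" 1 b \<beta>] harmonic_sum_over_ln assms by simp

text \<open>
The same identity serves twice: with \<open>A\<close> a partial sum it turns ordinary averages into
logarithmic ones, and with \<open>A\<close> the square of a martingale it produces the quadratic strong law.
\<close>

lemma summation_by_parts_average:
  fixes A :: "nat \<Rightarrow> real"
  shows "(\<Sum>k=1..n. (A (Suc k) - A k) / real (Suc k))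
    = A (Suc n) / real (Suc n) - A 1 + (\<Sum>k=1..n. A k / (real k * real (Suc k)))"
proof (induction n)
  case (Suc n)
  have "A (Suc n) / (real (Suc n) * real (Suc (Suc n))) = A (Suc n) / real (Suc n) - A (Suc n) / real (Suc (Suc n))"
    by (simp add: divide_simps) (simp add: algebra_simps)
  with Suc show ?case by (simp add: diff_divide_distrib del: of_nat_Suc)
qed simp

lemma log_average_of_average:
  fixes a :: "nat \<Rightarrow> real"
  assumes A: "(\<lambda>n. (\<Sum>k<n. a k) / real n) \<longlonglongrightarrow> \<alpha>"
  shows "(\<lambda>n. (\<Sum>k=1..n. a k / real (Suc k)) / ln (real n)) \<longlonglongrightarrow> \<alpha>"
proof -
  define B where "B = (\<lambda>n. (\<Sum>k<n. a k) / real n)"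
  have id: "(\<Sum>k=1..n. a k / real (Suc k)) = B (Suc n) - a 0 + (\<Sum>k=1..n. (B k * (real k / real (Suc k))) / real k)" for n
    using summation_by_parts_average[of "\<lambda>n. (\<Sum>k<n. a k)" n] by (simp add: B_def)
       (intro sum.cong; simp)
  have B: "B \<longlonglongrightarrow> \<alpha>" using A by (simp add: B_def)
  have "(\<lambda>n. real n / real (Suc n)) \<longlonglongrightarrow> 1" by real_asymp
  from tendsto_mult[OF B this] have "(\<lambda>k. B k * (real k / real (Suc k))) \<longlonglongrightarrow> \<alpha>" by simp
  note 1 = log_average[OF this]
  have "(\<lambda>n. 1 / ln (real n)) \<longlonglongrightarrow> 0" by real_asymp
  then have "(\<lambda>n. (B (Suc n) - a 0) * (1 / ln (real n)) + (\<Sum>k=1..n. (B k * (real k / real (Suc k))) / real k) / ln (real n)) \<longlonglongrightarrow> (\<alpha> - a 0) * 0 + \<alpha>"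
    by (intro tendsto_intros 1 LIMSEQ_Suc[OF B])
  then show ?thesis by (subst id) (simp add: add_divide_distrib)
qed

text \<open>
Logarithmic averages of squares behave like a squared norm, so a perturbation of vanishing norm
does not change the limit (Cauchy--Schwarz for the cross term).
\<close>

lemma log_average_square_perturb:
  fixes p r :: "nat \<Rightarrow> real"
  assumes p: "(\<lambda>n. (\<Sum>k=1..n. (p k)\<^sup>2) / ln (real n)) \<longlonglongrightarrow> c"
    and r: "(\<lambda>n. (\<Sum>k=1..n. (r k)\<^sup>2) / ln (real n)) \<longlonglongrightarrow> 0"
  shows "(\<lambda>n. (\<Sum>k=1..n. (p k + r k)\<^sup>2) / ln (real n)) \<longlonglongrightarrow> c"
proof -
  have cross: "(\<lambda>n. (\<Sum>k=1..n. p k * r k) / ln (real n)) \<longlonglongrightarrow> 0"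
  proof (rule Lim_null_comparison)
    show "(\<lambda>n. sqrt (((\<Sum>k=1..n. (p k)\<^sup>2) / ln (real n)) * ((\<Sum>k=1..n. (r k)\<^sup>2) / ln (real n)))) \<longlonglongrightarrow> 0"
      using tendsto_real_sqrt[OF tendsto_mult[OF p r]] by simp
    show "\<forall>\<^sub>F n in sequentially. norm ((\<Sum>k=1..n. p k * r k) / ln (real n))
       \<le> sqrt (((\<Sum>k=1..n. (p k)\<^sup>2) / ln (real n)) * ((\<Sum>k=1..n. (r k)\<^sup>2) / ln (real n)))"
      using eventually_gt_at_top[of 1]
    proof eventually_elim
      case (elim n)
      have "\<bar>\<Sum>k=1..n. p k * r k\<bar> \<le> sqrt (\<Sum>k=1..n. (p k)\<^sup>2) * sqrt (\<Sum>k=1..n. (r k)\<^sup>2)"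
        using L2_set_mult_ineq[of p r "{1..n}"] sum_abs[of "\<lambda>k. p k * r k" "{1..n}"]
        by (simp add: L2_set_def abs_mult)
      then have "\<bar>\<Sum>k=1..n. p k * r k\<bar> / ln (real n)
          \<le> sqrt (\<Sum>k=1..n. (p k)\<^sup>2) * sqrt (\<Sum>k=1..n. (r k)\<^sup>2) / ln (real n)"
        using elim by (intro divide_right_mono) auto
      also have "\<dots> = sqrt ((\<Sum>k=1..n. (p k)\<^sup>2) * (\<Sum>k=1..n. (r k)\<^sup>2) / (ln (real n) * ln (real n)))"
        using elim by (subst real_sqrt_divide) (simp add: real_sqrt_mult)
      finally show ?case using elim by simp
    qed
  qed
  have "(\<lambda>n. (\<Sum>k=1..n. (p k)\<^sup>2) / ln (real n) + 2 * ((\<Sum>k=1..n. p k * r k) / ln (real n))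
      + (\<Sum>k=1..n. (r k)\<^sup>2) / ln (real n)) \<longlonglongrightarrow> c + 2 * 0 + 0"
    by (intro tendsto_intros p r cross)
  then show ?thesis
    by (simp add: power2_sum sum.distrib add_divide_distrib sum_distrib_left mult.assoc add.commute add.left_commute)
qed

section \<open>A strong law from a bound on block variances\<close>

lemma AE_summable_of_nn_integral:
  fixes f :: "nat \<Rightarrow> 'a \<Rightarrow> real"
  assumes [measurable]: "\<And>j. f j \<in> borel_measurable M" and nonneg: "\<And>j \<omega>. 0 \<le> f j \<omega>"
    and bd: "\<And>j. (\<integral>\<^sup>+\<omega>. ennreal (f j \<omega>) \<partial>M) \<le> ennreal (c j)" and c: "summable c" "\<And>j. 0 \<le> c j"
  shows "AE \<omega> in M. summable (\<lambda>j. f j \<omega>)"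
proof -
  have "(\<integral>\<^sup>+\<omega>. (\<Sum>j. ennreal (f j \<omega>)) \<partial>M) = (\<Sum>j. \<integral>\<^sup>+\<omega>. ennreal (f j \<omega>) \<partial>M)"
    by (rule nn_integral_suminf) auto
  also have "\<dots> \<le> (\<Sum>j. ennreal (c j))" by (intro suminf_le bd) auto
  also have "\<dots> = ennreal (\<Sum>j. c j)" using c by (intro suminf_ennreal2) auto
  also have "\<dots> < \<infinity>" by simp
  finally have "AE \<omega> in M. (\<Sum>j. ennreal (f j \<omega>)) \<noteq> \<infinity>"
    by (intro nn_integral_PInf_AE) auto
  then show ?thesis
    by eventually_elim (auto intro!: summable_suminf_not_top nonneg)
qed

text \<open>
Along the squares \<open>j\<^sup>2\<close> the second moments of \<open>S (j\<^sup>2) / j\<^sup>2\<close> are summable.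
Between \<open>j\<^sup>2\<close> and \<open>(j + 1)\<^sup>2\<close> there are only about \<open>2 j\<close> indices, so the crude bound of the
maximal increment by the sum over all increments still gives a summable series.
\<close>

lemma strong_law_of_variance_bound:
  fixes D :: "nat \<Rightarrow> 'a \<Rightarrow> real"
  assumes D[measurable]: "\<And>k. D k \<in> borel_measurable M"
    and bd: "\<And>a b. a \<le> b \<Longrightarrow>
      (\<integral>\<^sup>+\<omega>. ennreal ((\<Sum>k\<in>{a..<b}. D k \<omega>)\<^sup>2) \<partial>M) \<le> ennreal (C * real (b - a))"
    and C: "0 \<le> C"
  shows "AE \<omega> in M. (\<lambda>n. (\<Sum>k<n. D k \<omega>) / real n) \<longlonglongrightarrow> 0"
proof -
  (* Dominates both (S_n / n)^2 at n = j^2 and the squared increments up to the next square. *)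
  define Q where "Q j \<omega> = ((\<Sum>k\<in>{0..<j^2}. D k \<omega>)\<^sup>2 +
      (\<Sum>i\<le>2*j. (\<Sum>k\<in>{j^2..<j^2+i}. D k \<omega>)\<^sup>2)) / real j ^ 4" for j \<omega>
  have [measurable]: "Q j \<in> borel_measurable M" for j unfolding Q_def by measurable
  have Q0: "0 \<le> Q j \<omega>" for j \<omega> unfolding Q_def by (intro divide_nonneg_nonneg add_nonneg_nonneg sum_nonneg) auto
  have "AE \<omega> in M. summable (\<lambda>j. Q j \<omega>)"
  proof (rule AE_summable_of_nn_integral[where c = "\<lambda>j. 7 * C / real j ^ 2"])
    fix j
    show "(\<integral>\<^sup>+\<omega>. ennreal (Q j \<omega>) \<partial>M) \<le> ennreal (7 * C / real j ^ 2)"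
    proof (cases "j = 0")
      case True then show ?thesis by (simp add: Q_def)
    next
      case False
      have "(\<integral>\<^sup>+\<omega>. ennreal (Q j \<omega>) \<partial>M) =
         (\<integral>\<^sup>+\<omega>. (ennreal ((\<Sum>k\<in>{0..<j^2}. D k \<omega>)\<^sup>2) + (\<Sum>i\<le>2*j. ennreal ((\<Sum>k\<in>{j^2..<j^2+i}. D k \<omega>)\<^sup>2))) * ennreal (1 / real j ^ 4) \<partial>M)"
        unfolding Q_def
        by (intro nn_integral_cong) (simp add: ennreal_plus[symmetric] ennreal_mult[symmetric] sum_nonneg del: ennreal_plus)
      also have "\<dots> = ((\<integral>\<^sup>+\<omega>. ennreal ((\<Sum>k\<in>{0..<j^2}. D k \<omega>)\<^sup>2) \<partial>M)
          + (\<Sum>i\<le>2*j. (\<integral>\<^sup>+\<omega>. ennreal ((\<Sum>k\<in>{j^2..<j^2+i}. D k \<omega>)\<^sup>2) \<partial>M))) * ennreal (1 / real j ^ 4)"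
        by (subst nn_integral_multc, simp, subst nn_integral_add, simp, simp, subst nn_integral_sum) simp_all
      also have "\<dots> \<le> (ennreal (C * real (j^2)) + (\<Sum>i\<le>2*j. ennreal (C * real (2 * j)))) * ennreal (1 / real j ^ 4)"
      proof (intro mult_right_mono add_mono sum_mono)
        fix i assume "i \<in> {..2*j}"
        then show "(\<integral>\<^sup>+\<omega>. ennreal ((\<Sum>k\<in>{j^2..<j^2+i}. D k \<omega>)\<^sup>2) \<partial>M) \<le> ennreal (C * real (2 * j))"
          using C by (intro order_trans[OF bd]) (auto intro!: ennreal_leI mult_left_mono)
      qed (use bd[of 0 "j^2"] in auto)
      also have "\<dots> = ennreal ((C * real (j^2) + real (2*j+1) * (C * real (2 * j))) * (1 / real j ^ 4))"
        using C by (simp add: ennreal_plus[symmetric] ennreal_mult[symmetric] sum_nonneg ennreal_of_nat_eq_real_of_nat del: ennreal_plus sum_constant)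
           (simp add: ennreal_plus[symmetric] ennreal_mult[symmetric] ennreal_of_nat_eq_real_of_nat del: ennreal_plus of_nat_Suc)
      also have "\<dots> \<le> ennreal (7 * C / real j ^ 2)"
      proof (rule ennreal_leI)
        have j: "real j \<le> real j ^ 2" using False by (simp add: power2_eq_square)
        have "C * real (j^2) + real (2*j+1) * (C * real (2 * j)) = C * (5 * real j ^ 2 + 2 * real j)"
          by (simp add: algebra_simps power2_eq_square)
        also have "\<dots> \<le> C * (7 * real j ^ 2)" using j C by (intro mult_left_mono) auto
        finally have "(C * real (j^2) + real (2*j+1) * (C * real (2 * j))) * (1 / real j ^ 4) \<le> C * (7 * real j ^ 2) * (1 / real j ^ 4)"
          by (intro mult_right_mono) auto
        also have "\<dots> = 7 * C / real j ^ 2" using False by (simp add: field_simps power2_eq_square power4_eq_xxxx)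
        finally show "(C * real (j^2) + real (2*j+1) * (C * real (2 * j))) * (1 / real j ^ 4) \<le> 7 * C / real j ^ 2" .
      qed
      finally show ?thesis .
    qed
  next
    have "summable (\<lambda>j. 7 * C * (1 / real j ^ 2))"
      by (intro summable_mult) (use inverse_power_summable[of 2, where 'a=real] in \<open>simp add: field_simps\<close>)
    then show "summable (\<lambda>j. 7 * C / real j ^ 2)" by simp
  qed (use C Q0 in auto)
  then show ?thesis
  proof eventually_elim
    case (elim \<omega>)
    define q where "q = (\<lambda>n::nat. nat \<lfloor>sqrt (real n)\<rfloor>)"
    have "(\<lambda>j. Q j \<omega>) \<longlonglongrightarrow> 0" by (rule summable_LIMSEQ_zero[OF elim])
    moreover have "filterlim q at_top sequentially" unfolding q_def by real_asymp
    ultimately have "(\<lambda>n. Q (q n) \<omega>) \<longlonglongrightarrow> 0" by (rule filterlim_compose)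
    then have lim: "(\<lambda>n. 2 * sqrt (Q (q n) \<omega>)) \<longlonglongrightarrow> 0"
      using tendsto_mult_right[OF tendsto_real_sqrt, of "\<lambda>n. Q (q n) \<omega>" 0 sequentially 2] by simp
    show ?case
    proof (rule Lim_null_comparison[OF _ lim])
      show "\<forall>\<^sub>F n in sequentially. norm ((\<Sum>k<n. D k \<omega>) / real n) \<le> 2 * sqrt (Q (q n) \<omega>)"
        using eventually_gt_at_top[of 0]
      proof eventually_elim
        case (elim n)
        define j where "j = q n"
        have fl: "real j \<le> sqrt (real n)" "sqrt (real n) < real j + 1"
          unfolding j_def q_def by (auto simp: of_nat_nat)
        have j0: "0 < j"
        proof -
          have "1 \<le> sqrt (real n)" using elim by simp
          then show ?thesis unfolding j_def q_def by (simp add: le_floor_iff)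
        qed
        have "real j ^ 2 \<le> real n" using power_mono[OF fl(1), of 2] by simp
        then have jn: "j\<^sup>2 \<le> n" by (simp only: of_nat_power[symmetric] of_nat_le_iff)
        have "real n < (real j + 1) ^ 2" using power_strict_mono[OF fl(2), of 2] by simp
        also have "\<dots> = real ((j+1)^2)" by simp
        finally have nj: "n < (j + 1)\<^sup>2" by (simp only: of_nat_less_iff)
        define i where "i = n - j\<^sup>2"
        have ni: "n = j\<^sup>2 + i" and i: "i \<le> 2 * j" using jn nj by (auto simp: i_def power2_eq_square)
        define A where "A = (\<Sum>k\<in>{0..<j^2}. D k \<omega>)"
        define B where "B = (\<Sum>k\<in>{j^2..<j^2+i}. D k \<omega>)"
        have S: "(\<Sum>k<n. D k \<omega>) = A + B"
          unfolding A_def B_def ni by (subst sum.atLeastLessThan_concat) (auto simp: lessThan_atLeast0)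
        have "B\<^sup>2 \<le> (\<Sum>i\<le>2*j. (\<Sum>k\<in>{j^2..<j^2+i}. D k \<omega>)\<^sup>2)"
          unfolding B_def using i by (intro member_le_sum) auto
        then have "A\<^sup>2 + B\<^sup>2 \<le> Q j \<omega> * real j ^ 4" using j0 by (simp add: Q_def A_def)
        moreover have "A\<^sup>2 \<le> A\<^sup>2 + B\<^sup>2" "B\<^sup>2 \<le> A\<^sup>2 + B\<^sup>2" by auto
        ultimately have "A\<^sup>2 \<le> Q j \<omega> * real j ^ 4" "B\<^sup>2 \<le> Q j \<omega> * real j ^ 4" by linarith+
        moreover have "sqrt (Q j \<omega> * real j ^ 4) = sqrt (Q j \<omega>) * real j ^ 2"
          using real_sqrt_abs[of "real j ^ 2"] by (simp add: real_sqrt_mult flip: power_mult)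
        ultimately have "\<bar>A\<bar> \<le> sqrt (Q j \<omega>) * real j ^ 2" "\<bar>B\<bar> \<le> sqrt (Q j \<omega>) * real j ^ 2"
          using real_le_rsqrt[of "\<bar>A\<bar>" "Q j \<omega> * real j ^ 4"] real_le_rsqrt[of "\<bar>B\<bar>" "Q j \<omega> * real j ^ 4"] by auto
        then have "\<bar>A + B\<bar> \<le> 2 * sqrt (Q j \<omega>) * real j ^ 2" by linarith
        also have "\<dots> \<le> 2 * sqrt (Q j \<omega>) * real n" using \<open>real j ^ 2 \<le> real n\<close> Q0 by (intro mult_left_mono) auto
        finally show ?case using elim unfolding S j_def[symmetric] by (simp add: divide_le_eq)
      qed
    qed
  qed
qed

section \<open>Noise with predictable weights: exponential bound and strong law\<close>

lemma abs_mult_le_sum_squares: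
  fixes x y :: real
  shows "\<bar>x * y\<bar> \<le> x\<^sup>2 + y\<^sup>2"
  using sum_squares_bound[of "\<bar>x\<bar>" "\<bar>y\<bar>"] mult_nonneg_nonneg[of "\<bar>x\<bar>" "\<bar>y\<bar>"]
  unfolding abs_mult power2_abs by linarith

lemma integrable_mult_of_squares:
  fixes f g :: "'a \<Rightarrow> real"
  assumes [measurable]: "f \<in> borel_measurable M" "g \<in> borel_measurable M"
    and "integrable M (\<lambda>x. (f x)\<^sup>2)" "integrable M (\<lambda>x. (g x)\<^sup>2)"
  shows "integrable M (\<lambda>x. f x * g x)"
proof (rule Bochner_Integration.integrable_bound)
  show "integrable M (\<lambda>x. (f x)\<^sup>2 + (g x)\<^sup>2)" using assms by simp
  have "\<bar>f x * g x\<bar> \<le> (f x)\<^sup>2 + (g x)\<^sup>2" for x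
    by (rule abs_mult_le_sum_squares)
  then show "AE x in M. norm (f x * g x) \<le> norm ((f x)\<^sup>2 + (g x)\<^sup>2)" by simp
qed simp

text \<open>
This inequality has no restriction on \<open>x\<close>: the term \<open>- x\<^sup>2 / 6\<close> tames large values. It is what makes
an exponential supermartingale available for unbounded increments, without truncation. The
logarithm of the right-hand side minus the exponent on the left has derivative of the sign of
\<open>x\<close>, hence a minimum at 0.
\<close>

lemma exp_quadratic_le:
  fixes x :: real
  shows "exp (x - x\<^sup>2 / 6) \<le> 1 + x + x\<^sup>2 / 3"
proof -
  define f where "f = (\<lambda>x::real. ln (1 + x + x\<^sup>2 / 3) - x + x\<^sup>2 / 6)"
  have pos: "0 < 1 + x + x\<^sup>2 / 3" for x :: real
  proof -
    have "1 + x + x\<^sup>2 / 3 = (x / 2 + 1)\<^sup>2 + x\<^sup>2 / 12"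
      by (simp add: field_simps power2_eq_square)
    also have "\<dots> > 0"
      by (cases "x = 0") (auto intro!: add_nonneg_pos)
    finally show ?thesis .
  qed
  have der: "(f has_real_derivative (x ^ 3 / 9) / (1 + x + x\<^sup>2 / 3)) (at x)" for x
    unfolding f_def using pos[of x]
    by (auto intro!: derivative_eq_intros simp: divide_simps) (simp add: algebra_simps power2_eq_square power3_eq_cube)
  have "f 0 \<le> f x"
  proof (cases "0 \<le> x")
    case True
    show ?thesis
      by (rule DERIV_nonneg_imp_nondecreasing[OF True]) (auto intro!: exI der simp: pos less_imp_le)
  next
    case False
    then have "x \<le> 0" by simp
    show ?thesis
    proof (rule DERIV_nonpos_imp_nonincreasing[OF \<open>x \<le> 0\<close>])
      fix y assume "x \<le> y" "y \<le> 0"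
      then have "y ^ 3 \<le> 0" by (simp add: power3_eq_cube mult_nonpos_nonpos mult_nonneg_nonpos)
      then have "(y ^ 3 / 9) / (1 + y + y\<^sup>2 / 3) \<le> 0"
        using pos[of y] by (simp add: divide_nonpos_pos)
      then show "\<exists>z. (f has_real_derivative z) (at y) \<and> z \<le> 0" using der by blast
    qed
  qed
  then have "x - x\<^sup>2 / 6 \<le> ln (1 + x + x\<^sup>2 / 3)" by (simp add: f_def)
  then have "exp (x - x\<^sup>2 / 6) \<le> exp (ln (1 + x + x\<^sup>2 / 3))" by (simp only: exp_le_cancel_iff)
  then show ?thesis by (simp only: exp_ln[OF pos])
qed

text \<open>
The noise is indexed from 0, so that \<open>past n\<close>, the information carried by \<open>U 0, \<dots>, U (n - 1)\<close>,
is independent of \<open>U n\<close>. A weight \<open>Y n\<close> measurable with respect to \<open>past n\<close> is thus predictable for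
the increment \<open>U n * Y n\<close>.
\<close>

locale iid_noise = prob_space M for M :: "'a measure" +
  fixes U :: "nat \<Rightarrow> 'a \<Rightarrow> real" and s2 :: real
  assumes indep: "indep_vars (\<lambda>_. borel) U UNIV"
    and same_distr: "\<And>n. distr M borel (U n) = distr M borel (U 0)"
    and mean: "\<And>n. expectation (U n) = 0"
    and fourth: "\<And>n. integrable M (\<lambda>\<omega>. U n \<omega> ^ 4)"
    and second: "\<And>n. expectation (\<lambda>\<omega>. (U n \<omega>)\<^sup>2) = s2"
begin

lemma U_measurable[measurable]: "U n \<in> borel_measurable M"
  using indep by (auto simp: indep_vars_def)

lemma integrable_square[simp]: "integrable M (\<lambda>\<omega>. (U n \<omega>)\<^sup>2)"
proof (rule square_integrable_imp_integrable)
  show "integrable M (\<lambda>\<omega>. ((U n \<omega>)\<^sup>2)\<^sup>2)" using fourth[of n] by (simp only: power_mult[symmetric]) simp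
qed simp

lemma integrable_U[simp]: "integrable M (U n)"
  by (rule square_integrable_imp_integrable) auto

lemma s2_nonneg: "0 \<le> s2"
  unfolding second[of 0, symmetric] by simp

definition past :: "nat \<Rightarrow> 'a measure" where
  "past n = vimage_algebra (space M) (\<lambda>\<omega>. \<lambda>i\<in>{..<n}. U i \<omega>) (PiM {..<n} (\<lambda>_. borel))"

lemma space_past[simp]: "space (past n) = space M" by (simp add: past_def)

lemma history_measurable: "(\<lambda>\<omega>. \<lambda>i\<in>{..<n}. U i \<omega>) \<in> measurable (past n) (PiM {..<n} (\<lambda>_. borel))"
  unfolding past_def by (rule measurable_vimage_algebra1) (auto simp: space_PiM)

lemma U_past: "i < n \<Longrightarrow> U i \<in> borel_measurable (past n)"
proof -
  assume i: "i < n"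
  have "(\<lambda>\<omega>. (\<lambda>i\<in>{..<n}. U i \<omega>) i) \<in> borel_measurable (past n)"
    by (rule measurable_compose[OF history_measurable measurable_component_singleton]) (use i in simp)
  then show ?thesis using i by simp
qed

lemma measurable_of_past: "f \<in> measurable (past n) N \<Longrightarrow> f \<in> measurable M N"
proof -
  assume f: "f \<in> measurable (past n) N"
  have "(\<lambda>x. x) \<in> measurable M (past n)"
    unfolding past_def by (rule measurable_vimage_algebra2) auto
  from measurable_compose[OF this f] show ?thesis .
qed

lemma past_mono: "f \<in> measurable (past m) N \<Longrightarrow> m \<le> n \<Longrightarrow> f \<in> measurable (past n) N"
proof -
  assume f: "f \<in> measurable (past m) N" and mn: "m \<le> n"
  have "(\<lambda>x. x) \<in> measurable (past n) (past m)"
    unfolding past_def[of m]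
    by (rule measurable_vimage_algebra2) (use mn in \<open>auto intro!: measurable_restrict U_past\<close>)
  from measurable_compose[OF this f] show ?thesis .
qed

lemma prob_past_inter:
  assumes A: "A \<in> sets (past n)" and B: "B \<in> sets borel"
  shows "prob (A \<inter> (U n -` B \<inter> space M)) = prob A * prob (U n -` B \<inter> space M)"
proof -
  let ?h = "\<lambda>\<omega>. \<lambda>i\<in>{..<n}. U i \<omega>" and ?P = "PiM {..<n} (\<lambda>_::nat. borel :: real measure)"
  let ?u = "\<lambda>\<omega>. \<lambda>i\<in>{n}. U i \<omega>" and ?Q = "PiM {n} (\<lambda>_::nat. borel :: real measure)"
  have ind: "indep_var ?P ?h ?Q ?u"
    by (rule indep_var_restrict[OF indep]) auto
  have "sets (past n) = {?h -` A \<inter> space M |A. A \<in> sets ?P}"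
    unfolding past_def by (rule sets_vimage_algebra2) (auto simp: space_PiM)
  with A obtain A' where A': "A' \<in> sets ?P" "A = ?h -` A' \<inter> space M" by auto
  define B' where "B' = (\<lambda>f. f n) -` B \<inter> space ?Q"
  have B': "B' \<in> sets ?Q" unfolding B'_def using B by measurable
  have "?u -` B' \<inter> space M = U n -` B \<inter> space M" by (auto simp: B'_def space_PiM)
  moreover have "(\<lambda>x. (?h x, ?u x)) -` (A' \<times> B') \<inter> space M = A \<inter> (?u -` B' \<inter> space M)" using A' by auto
  ultimately show ?thesis using indep_varD[OF ind A'(1) B'] A' by simp
qed

lemma distr_past:
  assumes H: "H \<in> measurable (past n) N"
  shows "distr M N H \<Otimes>\<^sub>M distr M borel (U n) = distr M (N \<Otimes>\<^sub>M borel) (\<lambda>\<omega>. (H \<omega>, U n \<omega>))"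
proof -
  have [measurable]: "H \<in> measurable M N" by (rule measurable_of_past[OF H])
  interpret A: prob_space "distr M N H" by (rule prob_space_distr) measurable
  interpret B: prob_space "distr M borel (U n)" by (rule prob_space_distr) measurable
  show ?thesis
  proof (rule pair_measure_eqI[OF A.sigma_finite_measure_axioms B.sigma_finite_measure_axioms])
    show "sets (distr M N H \<Otimes>\<^sub>M distr M borel (U n)) = sets (distr M (N \<Otimes>\<^sub>M borel) (\<lambda>\<omega>. (H \<omega>, U n \<omega>)))"
      by (simp cong: sets_pair_measure_cong)
    fix A B assume "A \<in> sets (distr M N H)" "B \<in> sets (distr M borel (U n))"
    then have [measurable]: "A \<in> sets N" "B \<in> sets borel" by auto
    have "H -` A \<inter> space (past n) \<in> sets (past n)" by (rule measurable_sets[OF H]) simp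
    then have "prob ((H -` A \<inter> space M) \<inter> (U n -` B \<inter> space M)) = prob (H -` A \<inter> space M) * prob (U n -` B \<inter> space M)"
      by (intro prob_past_inter) auto
    moreover have "(\<lambda>\<omega>. (H \<omega>, U n \<omega>)) -` (A \<times> B) \<inter> space M = (H -` A \<inter> space M) \<inter> (U n -` B \<inter> space M)" by auto
    ultimately show "emeasure (distr M N H) A * emeasure (distr M borel (U n)) B
        = emeasure (distr M (N \<Otimes>\<^sub>M borel) (\<lambda>\<omega>. (H \<omega>, U n \<omega>))) (A \<times> B)"
      by (simp add: emeasure_distr emeasure_eq_measure ennreal_mult)
  qed
qed

lemma indep_var_past:
  fixes H :: "'a \<Rightarrow> real"
  assumes H: "H \<in> borel_measurable (past n)"
  shows "indep_var borel H borel (U n)"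
  using distr_past[OF H] measurable_of_past[OF H] by (simp add: indep_var_distribution_eq)

text \<open>
Conditioning on the past takes this form throughout: freeze whatever is determined by the past
and integrate over the fresh innovation.
\<close>

lemma nn_integral_past:
  assumes H: "H \<in> measurable (past n) N" and f: "f \<in> borel_measurable (N \<Otimes>\<^sub>M borel)"
  shows "(\<integral>\<^sup>+\<omega>. f (H \<omega>, U n \<omega>) \<partial>M) = (\<integral>\<^sup>+\<omega>. (\<integral>\<^sup>+\<omega>'. f (H \<omega>, U n \<omega>') \<partial>M) \<partial>M)"
proof -
  have [measurable]: "H \<in> measurable M N" by (rule measurable_of_past[OF H])
  note [measurable] = f
  interpret B: prob_space "distr M borel (U n)" by (rule prob_space_distr) measurable
  have "(\<integral>\<^sup>+\<omega>. f (H \<omega>, U n \<omega>) \<partial>M) = (\<integral>\<^sup>+z. f z \<partial>distr M (N \<Otimes>\<^sub>M borel) (\<lambda>x. (H x, U n x)))"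
    by (simp add: nn_integral_distr)
  also have "\<dots> = (\<integral>\<^sup>+z. f z \<partial>(distr M N H \<Otimes>\<^sub>M distr M borel (U n)))"
    by (simp add: distr_past[OF H])
  also have "\<dots> = (\<integral>\<^sup>+x. (\<integral>\<^sup>+y. f (x, y) \<partial>distr M borel (U n)) \<partial>distr M N H)"
    by (rule B.nn_integral_fst[symmetric]) simp
  also have "\<dots> = (\<integral>\<^sup>+\<omega>. (\<integral>\<^sup>+y. f (H \<omega>, y) \<partial>distr M borel (U n)) \<partial>M)"
    by (rule nn_integral_distr) measurable
  also have "\<dots> = (\<integral>\<^sup>+\<omega>. (\<integral>\<^sup>+\<omega>'. f (H \<omega>, U n \<omega>') \<partial>M) \<partial>M)"
    by (intro nn_integral_cong nn_integral_distr) measurable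
  finally show ?thesis .
qed

definition adapted :: "(nat \<Rightarrow> 'a \<Rightarrow> real) \<Rightarrow> bool" where
  "adapted Y \<longleftrightarrow> (\<forall>n. Y n \<in> borel_measurable (past n))"

definition mart :: "(nat \<Rightarrow> 'a \<Rightarrow> real) \<Rightarrow> nat \<Rightarrow> 'a \<Rightarrow> real" where
  "mart Y n \<omega> = (\<Sum>k<n. U k \<omega> * Y k \<omega>)"

text \<open>
One third of the quadratic variation plus two thirds of its predictable counterpart. With this
mixture \<open>exp (mart Y n - brkt Y n / 2)\<close> has mean at most 1 for every adapted \<open>Y\<close>. For linear processes
both parts have the same limit after division by \<open>n\<close>, so the mixture costs nothing.
\<close>

definition brkt :: "(nat \<Rightarrow> 'a \<Rightarrow> real) \<Rightarrow> nat \<Rightarrow> 'a \<Rightarrow> real" where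
  "brkt Y n \<omega> = (\<Sum>k<n. (Y k \<omega>)\<^sup>2 * ((U k \<omega>)\<^sup>2 + 2 * s2) / 3)"

lemma adaptedD: "adapted Y \<Longrightarrow> k \<le> n \<Longrightarrow> Y k \<in> borel_measurable (past n)"
  unfolding adapted_def by (rule past_mono) auto

lemma adapted_measurable: "adapted Y \<Longrightarrow> Y k \<in> borel_measurable M"
  unfolding adapted_def by (rule measurable_of_past) auto

lemma mart_past: "adapted Y \<Longrightarrow> j \<le> n \<Longrightarrow> mart Y j \<in> borel_measurable (past n)"
  unfolding mart_def
  by (intro borel_measurable_sum borel_measurable_times U_past adaptedD[of Y]) auto

lemma brkt_past: "adapted Y \<Longrightarrow> j \<le> n \<Longrightarrow> brkt Y j \<in> borel_measurable (past n)"
  unfolding brkt_def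
  by (intro borel_measurable_sum borel_measurable_times borel_measurable_divide borel_measurable_add
      borel_measurable_power borel_measurable_const U_past adaptedD[of Y]) auto

text \<open>
By the exponential inequality at \<open>y * U n\<close> the mean of the quadratic-corrected exponential is at
most \<open>1 + y\<^sup>2 s2 / 3\<close>, which the deterministic part \<open>exp (- y\<^sup>2 s2 / 3)\<close> compensates.
\<close>

lemma nn_integral_exp_increment_le:
  fixes y :: real
  shows "(\<integral>\<^sup>+\<omega>. ennreal (exp (U n \<omega> * y - y\<^sup>2 * ((U n \<omega>)\<^sup>2 + 2 * s2) / 6)) \<partial>M) \<le> 1"
proof -
  have "(\<integral>\<^sup>+\<omega>. ennreal (exp (U n \<omega> * y - y\<^sup>2 * ((U n \<omega>)\<^sup>2 + 2 * s2) / 6)) \<partial>M)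
     \<le> (\<integral>\<^sup>+\<omega>. ennreal (exp (- (y\<^sup>2 * s2 / 3)) * (1 + y * U n \<omega> + y\<^sup>2 / 3 * (U n \<omega>)\<^sup>2)) \<partial>M)"
  proof (intro nn_integral_mono ennreal_leI)
    fix \<omega>
    have "exp (U n \<omega> * y - y\<^sup>2 * ((U n \<omega>)\<^sup>2 + 2 * s2) / 6)
      = exp (- (y\<^sup>2 * s2 / 3)) * exp ((y * U n \<omega>) - (y * U n \<omega>)\<^sup>2 / 6)"
      by (simp add: exp_add[symmetric] field_simps power_mult_distrib)
    also have "\<dots> \<le> exp (- (y\<^sup>2 * s2 / 3)) * (1 + (y * U n \<omega>) + (y * U n \<omega>)\<^sup>2 / 3)"
      by (intro mult_left_mono exp_quadratic_le) simp
    finally show "exp (U n \<omega> * y - y\<^sup>2 * ((U n \<omega>)\<^sup>2 + 2 * s2) / 6) \<le> exp (- (y\<^sup>2 * s2 / 3)) * (1 + y * U n \<omega> + y\<^sup>2 / 3 * (U n \<omega>)\<^sup>2)"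
      by (simp add: power_mult_distrib)
  qed
  also have "\<dots> = ennreal (expectation (\<lambda>\<omega>. exp (- (y\<^sup>2 * s2 / 3)) * (1 + y * U n \<omega> + y\<^sup>2 / 3 * (U n \<omega>)\<^sup>2)))"
  proof (rule nn_integral_eq_integral)
    have "0 \<le> 1 + y * u + y\<^sup>2 / 3 * u\<^sup>2" for u
      using order_trans[OF exp_ge_zero exp_quadratic_le[of "y * u"]] by (simp add: power_mult_distrib)
    then show "AE \<omega> in M. 0 \<le> exp (- (y\<^sup>2 * s2 / 3)) * (1 + y * U n \<omega> + y\<^sup>2 / 3 * (U n \<omega>)\<^sup>2)"
      by simp
  qed simp
  also have "\<dots> = ennreal (exp (- (y\<^sup>2 * s2 / 3)) * (1 + y\<^sup>2 * s2 / 3))"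
    by (simp add: prob_space mean second)
  also have "\<dots> \<le> ennreal (exp (- (y\<^sup>2 * s2 / 3)) * exp (y\<^sup>2 * s2 / 3))"
    by (intro ennreal_leI mult_left_mono exp_ge_add_one_self) auto
  also have "\<dots> = 1" by (simp flip: exp_add)
  finally show ?thesis .
qed

lemma nn_integral_exp_mart_le:
  assumes "adapted Y"
  shows "(\<integral>\<^sup>+\<omega>. ennreal (exp (mart Y n \<omega> - brkt Y n \<omega> / 2)) \<partial>M) \<le> 1"
proof (induction n)
  case 0
  show ?case by (simp add: mart_def brkt_def emeasure_space_1)
next
  case (Suc n)
  define H where "H \<omega> = (mart Y n \<omega> - brkt Y n \<omega> / 2, Y n \<omega>)" for \<omega>
  define f where "f = (\<lambda>((z, y), u). ennreal (exp z) * ennreal (exp (u * y - y\<^sup>2 * (u\<^sup>2 + 2 * s2) / 6)))"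
  have H: "H \<in> measurable (past n) (borel \<Otimes>\<^sub>M borel)"
    unfolding H_def using assms
    by (intro measurable_Pair borel_measurable_diff borel_measurable_divide borel_measurable_const
        mart_past brkt_past adaptedD[of Y]) auto
  have f: "f \<in> borel_measurable ((borel \<Otimes>\<^sub>M borel) \<Otimes>\<^sub>M borel)"
    unfolding f_def split_beta' by measurable
  have "(\<integral>\<^sup>+\<omega>. ennreal (exp (mart Y (Suc n) \<omega> - brkt Y (Suc n) \<omega> / 2)) \<partial>M) = (\<integral>\<^sup>+\<omega>. f (H \<omega>, U n \<omega>) \<partial>M)"
    by (intro nn_integral_cong) (simp add: f_def H_def mart_def brkt_def ennreal_mult[symmetric] exp_add[symmetric] field_simps)
  also have "\<dots> = (\<integral>\<^sup>+\<omega>. (\<integral>\<^sup>+\<omega>'. f (H \<omega>, U n \<omega>') \<partial>M) \<partial>M)"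
    by (rule nn_integral_past[OF H f])
  also have "\<dots> \<le> (\<integral>\<^sup>+\<omega>. ennreal (exp (mart Y n \<omega> - brkt Y n \<omega> / 2)) * 1 \<partial>M)"
  proof (intro nn_integral_mono)
    fix \<omega>
    have "(\<integral>\<^sup>+\<omega>'. f (H \<omega>, U n \<omega>') \<partial>M) = ennreal (exp (mart Y n \<omega> - brkt Y n \<omega> / 2)) *
       (\<integral>\<^sup>+\<omega>'. ennreal (exp (U n \<omega>' * Y n \<omega> - (Y n \<omega>)\<^sup>2 * ((U n \<omega>')\<^sup>2 + 2 * s2) / 6)) \<partial>M)"
      by (simp add: f_def H_def nn_integral_cmult)
    also have "\<dots> \<le> ennreal (exp (mart Y n \<omega> - brkt Y n \<omega> / 2)) * 1"
      by (intro mult_left_mono nn_integral_exp_increment_le) simp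
    finally show "(\<integral>\<^sup>+\<omega>'. f (H \<omega>, U n \<omega>') \<partial>M) \<le> ennreal (exp (mart Y n \<omega> - brkt Y n \<omega> / 2)) * 1" .
  qed
  also have "\<dots> \<le> 1" using Suc by simp
  finally show ?case .
qed

text \<open>
A maximal inequality over all times at once. Setting the weights to 0 from the first time on at
which the level \<open>c\<close> is reached gives again an adapted process, and its exponential has mean at
most 1; after a crossing it is frozen at a value above \<open>exp c\<close>, so Markov's inequality applies
at each finite horizon.
\<close>

lemma ville_exp:
  assumes Y: "adapted Y"
  shows "emeasure M {\<omega>\<in>space M. \<exists>n. c \<le> mart Y n \<omega> - brkt Y n \<omega> / 2} \<le> ennreal (exp (- c))"
proof -
  define Z where "Z n \<omega> = mart Y n \<omega> - brkt Y n \<omega> / 2" for n \<omega>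
  have Zp: "Z j \<in> borel_measurable (past n)" if "j \<le> n" for j n
    unfolding Z_def using Y that by (intro borel_measurable_diff borel_measurable_divide borel_measurable_const mart_past brkt_past) auto
  have [measurable]: "Z n \<in> borel_measurable M" for n by (rule measurable_of_past[OF Zp[OF order_refl]])
  (* Stopping: the condition at time k involves only Z 0, ..., Z k, which are known from the past of k. *)
  define Y' where "Y' k \<omega> = (if \<forall>j\<le>k. Z j \<omega> < c then Y k \<omega> else 0)" for k \<omega>
  have Y': "adapted Y'"
    unfolding adapted_def
  proof
    fix n
    have [measurable]: "\<And>j. j \<in> {..n} \<Longrightarrow> Z j \<in> borel_measurable (past n)" "Y n \<in> borel_measurable (past n)"
      using Zp Y by (auto simp: adapted_def)
    have "Measurable.pred (past n) (\<lambda>\<omega>. \<forall>j\<in>{..n}. Z j \<omega> < c)"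
      by (intro pred_intros_finite) auto
    then have [measurable]: "Measurable.pred (past n) (\<lambda>\<omega>. \<forall>j\<le>n. Z j \<omega> < c)" by (simp add: Ball_def)
    show "Y' n \<in> borel_measurable (past n)" unfolding Y'_def by measurable
  qed
  define Z' where "Z' n \<omega> = mart Y' n \<omega> - brkt Y' n \<omega> / 2" for n \<omega>
  have stop: "if \<exists>j\<le>n. c \<le> Z j \<omega> then c \<le> Z' n \<omega> else Z' n \<omega> = Z n \<omega>" for n \<omega>
  proof (induction n)
    case 0 show ?case by (simp add: Z_def Z'_def mart_def brkt_def)
  next
    case (Suc n)
    have inc: "Z' (Suc n) \<omega> = Z' n \<omega> + (U n \<omega> * Y' n \<omega> - (Y' n \<omega>)\<^sup>2 * ((U n \<omega>)\<^sup>2 + 2 * s2) / 6)"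
       "Z (Suc n) \<omega> = Z n \<omega> + (U n \<omega> * Y n \<omega> - (Y n \<omega>)\<^sup>2 * ((U n \<omega>)\<^sup>2 + 2 * s2) / 6)"
      by (simp_all add: Z_def Z'_def mart_def brkt_def add_divide_distrib)
    show ?case
    proof (cases "\<exists>j\<le>n. c \<le> Z j \<omega>")
      case True
      then have "Y' n \<omega> = 0" by (auto simp: Y'_def not_less)
      then show ?thesis using True Suc inc by (auto intro: le_SucI)
    next
      case False
      then have "Y' n \<omega> = Y n \<omega>" by (auto simp: Y'_def not_less)
      then have "Z' (Suc n) \<omega> = Z (Suc n) \<omega>" using False Suc inc by auto
      then show ?thesis using False by (auto simp: le_Suc_eq)
    qed
  qed
  define A where "A n = {\<omega>\<in>space M. \<exists>j\<in>{..n}. c \<le> Z j \<omega>}" for n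
  have [measurable]: "A n \<in> sets M" for n unfolding A_def by measurable
  have An: "emeasure M (A n) \<le> ennreal (exp (- c))" for n
  proof -
    have [measurable]: "Z' n \<in> borel_measurable M"
      unfolding Z'_def using Y' measurable_of_past[OF mart_past[OF Y' order_refl]] measurable_of_past[OF brkt_past[OF Y' order_refl]]
      by measurable
    have "ennreal (exp c) * emeasure M (A n) = (\<integral>\<^sup>+\<omega>. ennreal (exp c) * indicator (A n) \<omega> \<partial>M)"
      by (simp add: nn_integral_cmult_indicator)
    also have "\<dots> \<le> (\<integral>\<^sup>+\<omega>. ennreal (exp (Z' n \<omega>)) \<partial>M)"
    proof (rule nn_integral_mono)
      fix \<omega>
      show "ennreal (exp c) * indicator (A n) \<omega> \<le> ennreal (exp (Z' n \<omega>))"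
        using stop[of n \<omega>] by (auto simp: A_def indicator_def intro!: ennreal_leI split: if_splits)
    qed
    also have "\<dots> \<le> 1" using nn_integral_exp_mart_le[OF Y', of n] by (simp add: Z'_def)
    finally have le: "ennreal (exp c) * emeasure M (A n) \<le> 1" .
    have "emeasure M (A n) = ennreal (exp (- c)) * (ennreal (exp c) * emeasure M (A n))"
      by (simp add: mult.assoc[symmetric] ennreal_mult[symmetric] exp_add[symmetric])
    also have "\<dots> \<le> ennreal (exp (- c)) * 1" by (intro mult_left_mono le) simp
    finally show ?thesis by simp
  qed
  have "{\<omega>\<in>space M. \<exists>n. c \<le> mart Y n \<omega> - brkt Y n \<omega> / 2} = (\<Union>n. A n)"
    by (auto simp: A_def Z_def)
  moreover have "incseq A" by (fastforce simp: incseq_def A_def)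
  ultimately have "emeasure M {\<omega>\<in>space M. \<exists>n. c \<le> mart Y n \<omega> - brkt Y n \<omega> / 2} = (SUP n. emeasure M (A n))"
    by (simp add: SUP_emeasure_incseq image_subset_iff)
  also have "\<dots> \<le> ennreal (exp (- c))" by (intro SUP_least An)
  finally show ?thesis .
qed

text \<open>
Rescaling the weights by \<open>t j\<close> and Borel--Cantelli over \<open>j\<close>: the parameters may be tuned to the
time at which the bound is used, since each bound is uniform in \<open>n\<close>.
\<close>

lemma AE_mart_le_brkt:
  fixes t c :: "nat \<Rightarrow> real"
  assumes Y: "adapted Y" and t: "\<And>j. 0 < t j" and c: "summable (\<lambda>j. exp (- c j))"
  shows "AE \<omega> in M. \<forall>\<^sub>F j in sequentially. \<forall>n. mart Y n \<omega> < t j / 2 * brkt Y n \<omega> + c j / t j"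
proof -
  define Yt where "Yt j k \<omega> = t j * Y k \<omega>" for j k \<omega>
  have Yt: "adapted (Yt j)" for j
    unfolding adapted_def Yt_def using adaptedD[OF Y order_refl] by (auto intro: borel_measurable_times)
  have m: "mart (Yt j) n \<omega> = t j * mart Y n \<omega>" for j n \<omega>
    by (simp add: mart_def Yt_def sum_distrib_left mult_ac)
  have b: "brkt (Yt j) n \<omega> = (t j)\<^sup>2 * brkt Y n \<omega>" for j n \<omega>
    by (simp add: brkt_def Yt_def sum_distrib_left mult_ac power_mult_distrib)
  define A where "A j = {\<omega>\<in>space M. \<exists>n. c j \<le> mart (Yt j) n \<omega> - brkt (Yt j) n \<omega> / 2}" for j
  have A[measurable]: "A j \<in> sets M" for j
  proof -
    have [measurable]: "mart (Yt j) n \<in> borel_measurable M" "brkt (Yt j) n \<in> borel_measurable M" for n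
      using measurable_of_past[OF mart_past[OF Yt order_refl]] measurable_of_past[OF brkt_past[OF Yt order_refl]] by auto
    show ?thesis unfolding A_def by measurable
  qed
  have "AE \<omega> in M. \<forall>\<^sub>F j in sequentially. \<omega> \<in> space M - A j"
  proof (rule borel_cantelli_AE1)
    show "emeasure M (A j) < \<infinity>" for j by (simp add: emeasure_eq_measure)
    have "measure M (A j) \<le> exp (- c j)" for j
      using ville_exp[OF Yt, of "c j" j] unfolding A_def[symmetric] by (simp add: emeasure_eq_measure)
    then show "summable (\<lambda>j. measure M (A j))" by (intro summable_comparison_test'[OF c]) auto
  qed simp
  then show ?thesis
  proof (rule AE_mp, intro AE_I2 impI)
    fix \<omega> assume "\<omega> \<in> space M" and ev: "\<forall>\<^sub>F j in sequentially. \<omega> \<in> space M - A j"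
    from ev show "\<forall>\<^sub>F j in sequentially. \<forall>n. mart Y n \<omega> < t j / 2 * brkt Y n \<omega> + c j / t j"
    proof eventually_elim
      case (elim j)
      show ?case
      proof
        fix n
        have "t j * mart Y n \<omega> - (t j)\<^sup>2 * brkt Y n \<omega> / 2 < c j"
          using elim by (auto simp: A_def m b not_le)
        then have "t j * mart Y n \<omega> < t j * (t j / 2 * brkt Y n \<omega> + c j / t j)"
          using t[of j] by (simp add: distrib_left power2_eq_square)
        then show "mart Y n \<omega> < t j / 2 * brkt Y n \<omega> + c j / t j"
          using t[of j] by (simp only: mult_less_cancel_left_pos)
      qed
    qed
  qed
qed

text \<open>
The increments are orthogonal, because \<open>g (U k)\<close> is centred and independent of everything before
it; hence variances of block sums add up.
\<close>

lemma strong_law_martingale: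
  assumes H: "adapted H" and g[measurable]: "g \<in> borel_measurable borel"
    and g0: "\<And>k. expectation (\<lambda>\<omega>. g (U k \<omega>)) = 0"
    and g2: "\<And>k. integrable M (\<lambda>\<omega>. (g (U k \<omega>))\<^sup>2)" "\<And>k. expectation (\<lambda>\<omega>. (g (U k \<omega>))\<^sup>2) \<le> G"
    and H2: "\<And>k. integrable M (\<lambda>\<omega>. (H k \<omega>)\<^sup>2)" "\<And>k. expectation (\<lambda>\<omega>. (H k \<omega>)\<^sup>2) \<le> C"
  shows "AE \<omega> in M. (\<lambda>n. (\<Sum>k<n. H k \<omega> * g (U k \<omega>)) / real n) \<longlonglongrightarrow> 0"
proof (rule strong_law_of_variance_bound)
  note [measurable] = adapted_measurable[OF H]
  show "(\<lambda>\<omega>. H k \<omega> * g (U k \<omega>)) \<in> borel_measurable M" for k by measurable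
  have G: "0 \<le> G" using g2(2)[of 0] by (rule order_trans[rotated]) simp
  have C: "0 \<le> C" using H2(2)[of 0] by (rule order_trans[rotated]) simp
  then show "0 \<le> C * G" using G by simp
  fix a b :: nat assume "a \<le> b"
  define S where "S b \<omega> = (\<Sum>k\<in>{a..<b}. H k \<omega> * g (U k \<omega>))" for b \<omega>
  have [measurable]: "S b \<in> borel_measurable M" for b unfolding S_def by measurable
  from \<open>a \<le> b\<close> have "integrable M (\<lambda>\<omega>. (S b \<omega>)\<^sup>2) \<and> expectation (\<lambda>\<omega>. (S b \<omega>)\<^sup>2) \<le> C * G * real (b - a)"
  proof (induction b rule: dec_induct)
    case base show ?case by (simp add: S_def)
  next
    case (step b)
    have Sb: "integrable M (\<lambda>\<omega>. (S b \<omega>)\<^sup>2)" using step by simp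
    have gi: "integrable M (\<lambda>\<omega>. g (U b \<omega>))"
      by (rule square_integrable_imp_integrable) (use g2 in auto)
    have SH: "integrable M (\<lambda>\<omega>. S b \<omega> * H b \<omega>)"
      by (rule integrable_mult_of_squares) (use Sb H2 in auto)
    have Sp: "S b \<in> borel_measurable (past b)"
      unfolding S_def using H by (intro borel_measurable_sum borel_measurable_times adaptedD[of H] measurable_compose[OF U_past g]) auto
    have "indep_var borel (\<lambda>\<omega>. S b \<omega> * H b \<omega>) borel (U b)"
      using H Sp by (intro indep_var_past borel_measurable_times) (auto simp: adapted_def)
    from indep_var_compose[OF this measurable_ident g]
    have i1: "indep_var borel (\<lambda>\<omega>. S b \<omega> * H b \<omega>) borel (\<lambda>\<omega>. g (U b \<omega>))" by (simp add: comp_def)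
    have cross: "expectation (\<lambda>\<omega>. S b \<omega> * H b \<omega> * g (U b \<omega>)) = 0"
      and crossi: "integrable M (\<lambda>\<omega>. S b \<omega> * H b \<omega> * g (U b \<omega>))"
      using indep_var_lebesgue_integral[OF i1 SH gi] indep_var_integrable[OF i1 SH gi] g0 by simp_all
    have "indep_var borel (H b) borel (U b)"
      using H by (intro indep_var_past) (auto simp: adapted_def)
    from indep_var_compose[OF this, of "\<lambda>x. x\<^sup>2" borel "\<lambda>x. (g x)\<^sup>2" borel]
    have i2: "indep_var borel (\<lambda>\<omega>. (H b \<omega>)\<^sup>2) borel (\<lambda>\<omega>. (g (U b \<omega>))\<^sup>2)" by (simp add: comp_def)
    have sq: "expectation (\<lambda>\<omega>. (H b \<omega>)\<^sup>2 * (g (U b \<omega>))\<^sup>2) \<le> C * G"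
      unfolding indep_var_lebesgue_integral[OF i2 H2(1) g2(1)] using H2(2) g2(2) C
      by (intro mult_mono) auto
    have sqi: "integrable M (\<lambda>\<omega>. (H b \<omega>)\<^sup>2 * (g (U b \<omega>))\<^sup>2)"
      by (rule indep_var_integrable[OF i2 H2(1) g2(1)])
    have eq: "(S (Suc b) \<omega>)\<^sup>2 = (S b \<omega>)\<^sup>2 + 2 * (S b \<omega> * H b \<omega> * g (U b \<omega>)) + (H b \<omega>)\<^sup>2 * (g (U b \<omega>))\<^sup>2" for \<omega>
      unfolding S_def using step.hyps by (simp add: power2_sum power_mult_distrib algebra_simps)
    have "integrable M (\<lambda>\<omega>. (S (Suc b) \<omega>)\<^sup>2)" unfolding eq using Sb crossi sqi by simp
    moreover have "expectation (\<lambda>\<omega>. (S (Suc b) \<omega>)\<^sup>2) = expectation (\<lambda>\<omega>. (S b \<omega>)\<^sup>2) + expectation (\<lambda>\<omega>. (H b \<omega>)\<^sup>2 * (g (U b \<omega>))\<^sup>2)"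
      unfolding eq using Sb crossi sqi cross by simp
    moreover have "C * G * real (Suc b - a) = C * G * real (b - a) + C * G"
      using step.hyps by (simp add: Suc_diff_le algebra_simps)
    ultimately show ?case using step.IH sq by simp
  qed
  then have "integrable M (\<lambda>\<omega>. (S b \<omega>)\<^sup>2)" "expectation (\<lambda>\<omega>. (S b \<omega>)\<^sup>2) \<le> C * G * real (b - a)" by auto
  then show "(\<integral>\<^sup>+\<omega>. ennreal ((\<Sum>k\<in>{a..<b}. H k \<omega> * g (U k \<omega>))\<^sup>2) \<partial>M) \<le> ennreal (C * G * real (b - a))"
    unfolding S_def[symmetric] by (subst nn_integral_eq_integral) (auto intro!: ennreal_leI)
qed

end

section \<open>Upper law of the iterated logarithm and quadratic strong law\<close>

lemma weighted_sum_square_le: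
  fixes w u :: "'b \<Rightarrow> real"
  assumes "\<And>i. i \<in> A \<Longrightarrow> 0 \<le> w i"
  shows "(\<Sum>i\<in>A. w i * u i)\<^sup>2 \<le> (\<Sum>i\<in>A. w i) * (\<Sum>i\<in>A. w i * (u i)\<^sup>2)"
proof -
  have "(\<Sum>i\<in>A. w i * u i)\<^sup>2 = (\<Sum>i\<in>A. sqrt (w i) * (sqrt (w i) * u i))\<^sup>2"
    using assms by (intro arg_cong[where f = "\<lambda>x. x\<^sup>2"] sum.cong) (auto simp flip: mult.assoc)
  also have "\<dots> \<le> (\<Sum>i\<in>A. (sqrt (w i))\<^sup>2) * (\<Sum>i\<in>A. (sqrt (w i) * u i)\<^sup>2)"
    by (rule Cauchy_Schwarz_ineq_sum)
  also have "\<dots> = (\<Sum>i\<in>A. w i) * (\<Sum>i\<in>A. w i * (u i)\<^sup>2)"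
    using assms by (simp add: power_mult_distrib)
  finally show ?thesis .
qed

text \<open>
Jensen's inequality for the fourth power and the measure \<open>\<bar>h\<bar>\<close>, as two applications of
Cauchy--Schwarz.
\<close>

lemma sum_fourth_power_le:
  fixes h u :: "'b \<Rightarrow> real"
  assumes H: "(\<Sum>i\<in>A. \<bar>h i\<bar>) \<le> H"
  shows "(\<Sum>i\<in>A. h i * u i) ^ 4 \<le> H ^ 3 * (\<Sum>i\<in>A. \<bar>h i\<bar> * u i ^ 4)"
proof -
  define S where "S = (\<Sum>i\<in>A. \<bar>h i\<bar>)"
  define Q where "Q = (\<Sum>i\<in>A. \<bar>h i\<bar> * u i ^ 4)"
  have S: "0 \<le> S" and Q: "0 \<le> Q" unfolding S_def Q_def by (auto intro!: sum_nonneg)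
  have "\<bar>\<Sum>i\<in>A. h i * u i\<bar> \<le> (\<Sum>i\<in>A. \<bar>h i\<bar> * \<bar>u i\<bar>)"
    by (rule order_trans[OF sum_abs]) (simp add: abs_mult)
  then have "(\<Sum>i\<in>A. h i * u i)\<^sup>2 \<le> (\<Sum>i\<in>A. \<bar>h i\<bar> * \<bar>u i\<bar>)\<^sup>2"
    by (metis abs_ge_zero power2_abs power_mono)
  also have "\<dots> \<le> S * (\<Sum>i\<in>A. \<bar>h i\<bar> * (u i)\<^sup>2)"
    using weighted_sum_square_le[of A "\<lambda>i. \<bar>h i\<bar>" "\<lambda>i. \<bar>u i\<bar>"] by (simp add: S_def)
  finally have "((\<Sum>i\<in>A. h i * u i)\<^sup>2)\<^sup>2 \<le> (S * (\<Sum>i\<in>A. \<bar>h i\<bar> * (u i)\<^sup>2))\<^sup>2"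
    by (intro power_mono) auto
  also have "\<dots> = S\<^sup>2 * (\<Sum>i\<in>A. \<bar>h i\<bar> * (u i)\<^sup>2)\<^sup>2" by (rule power_mult_distrib)
  also have "\<dots> \<le> S\<^sup>2 * (S * Q)"
    using weighted_sum_square_le[of A "\<lambda>i. \<bar>h i\<bar>" "\<lambda>i. (u i)\<^sup>2"]
    by (intro mult_left_mono) (auto simp: S_def Q_def simp flip: power_mult)
  also have "\<dots> = S ^ 3 * Q" by (simp add: power2_eq_square power3_eq_cube)
  also have "\<dots> \<le> H ^ 3 * Q" using S Q H by (intro mult_right_mono power_mono) (auto simp: S_def)
  finally show ?thesis by (simp add: Q_def flip: power_mult)
qed

context iid_noise begin

lemma
  fixes f :: "real \<Rightarrow> real"
  assumes [measurable]: "f \<in> borel_measurable borel"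
  shows expectation_U: "expectation (\<lambda>\<omega>. f (U n \<omega>)) = expectation (\<lambda>\<omega>. f (U 0 \<omega>))"
    and prob_U: "prob {\<omega>\<in>space M. c < f (U n \<omega>)} = prob {\<omega>\<in>space M. c < f (U 0 \<omega>)}"
proof -
  show "expectation (\<lambda>\<omega>. f (U n \<omega>)) = expectation (\<lambda>\<omega>. f (U 0 \<omega>))"
    using same_distr[of n] by (simp flip: integral_distr[OF U_measurable])
  have "prob {\<omega>\<in>space M. c < f (U m \<omega>)} = measure (distr M borel (U m)) {x. c < f x}" for m
    by (subst measure_distr) (auto intro!: arg_cong[where f = "measure M"])
  then show "prob {\<omega>\<in>space M. c < f (U n \<omega>)} = prob {\<omega>\<in>space M. c < f (U 0 \<omega>)}"
    using same_distr[of n] by simp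
qed

lemma integrable_centered_square_sq: "integrable M (\<lambda>\<omega>. ((U k \<omega>)\<^sup>2 - s2)\<^sup>2)"
proof -
  have eq: "((U k \<omega>)\<^sup>2 - s2)\<^sup>2 = U k \<omega> ^ 4 - 2 * s2 * (U k \<omega>)\<^sup>2 + s2\<^sup>2" for \<omega>
    by (simp add: power2_diff flip: power_mult)
  show ?thesis unfolding eq using fourth[of k] by simp
qed

text \<open>
This replaces quadratic variation by its predictable counterpart; four moments of the noise and
of the weights make the increments square integrable.
\<close>

lemma strong_law_squares:
  assumes Y: "adapted Y" and Y4: "\<And>k. integrable M (\<lambda>\<omega>. Y k \<omega> ^ 4)" "\<And>k. expectation (\<lambda>\<omega>. Y k \<omega> ^ 4) \<le> C"
  shows "AE \<omega> in M. (\<lambda>n. (\<Sum>k<n. (Y k \<omega>)\<^sup>2 * ((U k \<omega>)\<^sup>2 - s2)) / real n) \<longlonglongrightarrow> 0"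
proof (rule strong_law_martingale[where H = "\<lambda>k \<omega>. (Y k \<omega>)\<^sup>2" and g = "\<lambda>u. u\<^sup>2 - s2"
      and G = "expectation (\<lambda>\<omega>. ((U 0 \<omega>)\<^sup>2 - s2)\<^sup>2)" and C = C])
  show "adapted (\<lambda>k \<omega>. (Y k \<omega>)\<^sup>2)"
    unfolding adapted_def using adaptedD[OF Y order_refl] by (auto intro: borel_measurable_power)
  show "expectation (\<lambda>\<omega>. (U k \<omega>)\<^sup>2 - s2) = 0" for k
    by (simp add: second prob_space)
  show "expectation (\<lambda>\<omega>. ((U k \<omega>)\<^sup>2 - s2)\<^sup>2) \<le> expectation (\<lambda>\<omega>. ((U 0 \<omega>)\<^sup>2 - s2)\<^sup>2)" for k
    by (rule eq_refl) (rule expectation_U[of "\<lambda>u. (u\<^sup>2 - s2)\<^sup>2"], simp)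
  show "integrable M (\<lambda>\<omega>. ((Y k \<omega>)\<^sup>2)\<^sup>2)" "expectation (\<lambda>\<omega>. ((Y k \<omega>)\<^sup>2)\<^sup>2) \<le> C" for k
    using Y4[of k] by (simp_all flip: power_mult)
qed (use integrable_centered_square_sq in auto)

lemma strong_law_mart:
  assumes Y: "adapted Y" and Y4: "\<And>k. integrable M (\<lambda>\<omega>. Y k \<omega> ^ 4)" "\<And>k. expectation (\<lambda>\<omega>. Y k \<omega> ^ 4) \<le> C"
  shows "AE \<omega> in M. (\<lambda>n. mart Y n \<omega> / real n) \<longlonglongrightarrow> 0"
proof -
  note [measurable] = adapted_measurable[OF Y]
  have int: "integrable M (\<lambda>\<omega>. (Y k \<omega>)\<^sup>2)" for k
    by (rule square_integrable_imp_integrable) (use Y4(1)[of k] in \<open>simp_all flip: power_mult\<close>)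
  have "expectation (\<lambda>\<omega>. (Y k \<omega>)\<^sup>2) \<le> 1 + C" for k
  proof -
    have "expectation (\<lambda>\<omega>. (Y k \<omega>)\<^sup>2) \<le> expectation (\<lambda>\<omega>. 1 + Y k \<omega> ^ 4)"
    proof (rule integral_mono)
      show "(Y k \<omega>)\<^sup>2 \<le> 1 + Y k \<omega> ^ 4" for \<omega>
      proof -
        have "2 * (Y k \<omega>)\<^sup>2 \<le> 1 + Y k \<omega> ^ 4"
          using zero_le_power2[of "(Y k \<omega>)\<^sup>2 - 1"] by (simp add: power2_diff flip: power_mult)
        then show ?thesis using zero_le_power2[of "Y k \<omega>"] by linarith
      qed
    qed (use int Y4 in auto)
    also have "\<dots> = 1 + expectation (\<lambda>\<omega>. Y k \<omega> ^ 4)" using Y4 by (simp add: prob_space)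
    finally show ?thesis using Y4(2)[of k] by simp
  qed
  then have "AE \<omega> in M. (\<lambda>n. (\<Sum>k<n. Y k \<omega> * U k \<omega>) / real n) \<longlonglongrightarrow> 0"
    using strong_law_martingale[of Y "\<lambda>u. u" s2 "1 + C"] Y int by (simp add: mean second)
  then show ?thesis by (simp add: mart_def mult.commute)
qed

text \<open>
For fixed \<open>\<epsilon>\<close> the probabilities of \<open>U n ^ 4 > \<epsilon> n\<close> sum up to at most the mean of
\<open>1 + U 0 ^ 4 / \<epsilon>\<close>, because the noise is identically distributed; Borel--Cantelli concludes. This
controls every boundary term at the rate \<open>sqrt n\<close>.
\<close>

lemma AE_fourth_power_sublinear: "AE \<omega> in M. (\<lambda>n. U n \<omega> ^ 4 / real n) \<longlonglongrightarrow> 0"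
proof -
  define Z where "Z \<omega> = U 0 \<omega> ^ 4" for \<omega>
  have [measurable]: "Z \<in> borel_measurable M" unfolding Z_def by measurable
  have Z: "integrable M Z" "\<And>\<omega>. 0 \<le> Z \<omega>" using fourth[of 0] unfolding Z_def by auto
  have [simp]: "integrable M (indicator {\<omega>\<in>space M. c < Z \<omega>} :: 'a \<Rightarrow> real)" for c
    by (simp add: emeasure_eq_measure)
  have one: "AE \<omega> in M. \<forall>\<^sub>F n in sequentially. U n \<omega> ^ 4 \<le> e * real n" if e: "0 < e" for e
  proof -
    define A where "A n = {\<omega>\<in>space M. e * real n < U n \<omega> ^ 4}" for n
    have [measurable]: "A n \<in> sets M" for n unfolding A_def by measurable
    have "(\<Sum>n<N. measure M (A n)) \<le> 1 + expectation Z / e" for N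
    proof -
      have "measure M (A n) = expectation (indicator {\<omega>\<in>space M. e * real n < Z \<omega>})" for n
        unfolding A_def Z_def by (subst prob_U) auto
      then have "(\<Sum>n<N. measure M (A n)) = expectation (\<lambda>\<omega>. \<Sum>n<N. indicator {\<omega>\<in>space M. e * real n < Z \<omega>} \<omega>)"
        by simp
      also have "\<dots> \<le> expectation (\<lambda>\<omega>. 1 + Z \<omega> / e)"
      proof (rule integral_mono)
        fix \<omega> assume "\<omega> \<in> space M"
        (* Counting: the n with e * n < Z are exactly those below the ceiling m of Z / e. *)
        define m where "m = nat \<lceil>Z \<omega> / e\<rceil>"
        have "(\<Sum>n<N. indicator {\<omega>\<in>space M. e * real n < Z \<omega>} \<omega>) \<le> (\<Sum>n<N. (if n < m then 1 else 0::real))"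
        proof (rule sum_mono)
          fix n
          show "indicator {\<omega>\<in>space M. e * real n < Z \<omega>} \<omega> \<le> (if n < m then 1 else (0::real))"
          proof (cases "e * real n < Z \<omega>")
            case True
            then have "real n < Z \<omega> / e" using e by (simp add: field_simps)
            then have "n < m" unfolding m_def by linarith
            then show ?thesis by (simp add: indicator_def)
          qed (simp add: indicator_def)
        qed
        also have "\<dots> = real (card ({..<N} \<inter> {..<m}))"
          by (simp add: sum.If_cases lessThan_def)
        also have "\<dots> \<le> real m" by (simp add: card_mono[of "{..<m}", simplified])
        also have "\<dots> \<le> 1 + Z \<omega> / e"
        proof -
          have "0 \<le> Z \<omega> / e" using Z e by simp
          then show ?thesis unfolding m_def by linarith
        qed
        finally show "(\<Sum>n<N. indicator {\<omega>\<in>space M. e * real n < Z \<omega>} \<omega>) \<le> 1 + Z \<omega> / e" .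
      qed (use Z in auto)
      also have "\<dots> = 1 + expectation Z / e" using Z by (simp add: prob_space)
      finally show ?thesis .
    qed
    then have "summable (\<lambda>n. measure M (A n))" by (intro summableI_nonneg_bounded) auto
    then have "AE \<omega> in M. \<forall>\<^sub>F n in sequentially. \<omega> \<in> space M - A n"
      by (intro borel_cantelli_AE1) (auto simp: emeasure_eq_measure)
    then show ?thesis
      by eventually_elim (auto simp: A_def not_less elim!: eventually_mono)
  qed
  have "AE \<omega> in M. \<forall>i. \<forall>\<^sub>F n in sequentially. U n \<omega> ^ 4 \<le> (1 / real (Suc i)) * real n"
    unfolding AE_all_countable by (intro allI one) simp
  then show ?thesis
  proof eventually_elim
    case (elim \<omega>)
    show ?case
    proof (rule LIMSEQ_I)
      fix r :: real assume "0 < r"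
      then obtain i where i: "1 / real (Suc i) < r" using nat_approx_posE by blast
      have "\<forall>\<^sub>F n in sequentially. norm (U n \<omega> ^ 4 / real n - 0) < r"
        using elim[rule_format, of i] eventually_gt_at_top[of 0]
      proof eventually_elim
        case (elim n)
        then have "U n \<omega> ^ 4 / real n \<le> 1 / real (Suc i)" by (simp add: divide_le_eq)
        then show ?case using i by simp
      qed
      then show "\<exists>no. \<forall>n\<ge>no. norm (U n \<omega> ^ 4 / real n - 0) < r" by (simp add: eventually_sequentially)
    qed
  qed
qed

text \<open>
On the window \<open>q ^ j \<le> n \<le> q ^ (j + 1)\<close> the uniform exponential bound is used with the optimal
parameter for \<open>n = q ^ j\<close>.
\<close>

lemma lil_upper:
  assumes Y: "adapted Y" and v: "0 < v" and r: "1 < r"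
    and B: "AE \<omega> in M. \<forall>\<^sub>F n in sequentially. brkt Y n \<omega> \<le> v * real n"
  shows "AE \<omega> in M. \<forall>\<^sub>F n in sequentially. mart Y n \<omega> \<le> r * sqrt (2 * v * real n * ln (ln (real n)))"
proof -
  (* The bound loses a factor (3 q - 1) / 2 <= q^2 on a window of ratio q, and sqrt q from ln j against
     ln (ln n); so q^3 = r is enough. *)
  define q where "q = root 3 r"
  have q: "1 < q" "q ^ 3 = r" using r by (auto simp: q_def)
  define l where "l j = ln (real j + 2)" for j :: nat
  have l: "0 < l j" for j by (simp add: l_def)
  define t where "t j = sqrt (2 * l j / (v * q ^ j))" for j
  (* exp (- c j) is the power 1 - 2 q < -1 of j + 2; the shift by 2 keeps all logarithms positive. *)
  define c where "c j = (2 * q - 1) * l j" for j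
  have t: "0 < t j" for j unfolding t_def using l[of j] v q by simp
  have "summable (\<lambda>j. real j powr (- (2 * q - 1)))" using q by (simp add: summable_real_powr_iff)
  from summable_ignore_initial_segment[OF this, of 2]
  have sum: "summable (\<lambda>j. exp (- c j))" by (simp add: c_def l_def powr_def add.commute minus_mult_left del: minus_mult_left[symmetric])
  from AE_mart_le_brkt[where t=t and c=c, OF Y t sum] B show ?thesis
  proof eventually_elim
    case (elim \<omega>)
    define J where "J n = nat \<lfloor>ln (real n) / ln q\<rfloor>" for n :: nat
    have lq: "0 < ln q" using q by simp
    have "filterlim J at_top sequentially" unfolding J_def using lq by real_asymp
    with elim(1) have ev1: "\<forall>\<^sub>F n in sequentially. \<forall>m. mart Y m \<omega> < t (J n) / 2 * brkt Y m \<omega> + c (J n) / t (J n)"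
      by (auto simp: filterlim_iff)
    have "((\<lambda>n. ln (ln (real n) / ln q + 2) / ln (ln (real n))) \<longlongrightarrow> 1) sequentially"
      using lq by real_asymp
    then have ev2: "\<forall>\<^sub>F n in sequentially. ln (ln (real n) / ln q + 2) / ln (ln (real n)) < q"
      using q(1) by (rule order_tendstoD)
    have ev3: "\<forall>\<^sub>F n in sequentially. 0 < ln (ln (real n))" by real_asymp
    from ev1 ev2 ev3 elim(2) eventually_gt_at_top[of 2] show ?case
    proof eventually_elim
      case (elim n)
      define j where "j = J n"
      have n: "2 < real n" using elim by simp
      have ln0: "0 \<le> ln (real n) / ln q" using n lq by simp
      have j1: "real j \<le> ln (real n) / ln q" and j2: "ln (real n) / ln q < real j + 1"
        using ln0 unfolding j_def J_def by linarith+
      have "q ^ j = exp (real j * ln q)" using q by (simp add: exp_of_nat_mult)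
      also have "\<dots> \<le> exp (ln (real n))" using j1 lq by (simp add: field_simps)
      finally have qn: "q ^ j \<le> real n" using n by simp
      have "real n = exp (ln (real n))" using n by simp
      also have "\<dots> \<le> exp (real (Suc j) * ln q)" using j2 lq by (simp add: field_simps)
      also have "\<dots> = q ^ Suc j" using q by (subst exp_of_nat_mult) simp
      finally have nq: "real n \<le> q * q ^ j" by simp
      have "l j \<le> ln (ln (real n) / ln q + 2)" unfolding l_def using j1 ln0 by (subst ln_le_cancel_iff) auto
      also have "\<dots> \<le> q * ln (ln (real n))" using elim by (simp add: field_simps)
      finally have lj: "l j \<le> q * ln (ln (real n))" .
      define s where "s = sqrt (2 * l j * v * q ^ j)"
      have s: "0 \<le> s" unfolding s_def using l[of j] v q by simp
      have tv: "t j * (v * q ^ j) = s"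
      proof -
        have "t j * (v * q ^ j) = sqrt (2 * l j / (v * q ^ j)) * sqrt ((v * q ^ j)\<^sup>2)"
          unfolding t_def using v q by simp
        also have "\<dots> = s" unfolding real_sqrt_mult[symmetric] s_def
          using v q by (intro arg_cong[where f=sqrt]) (simp add: field_simps power2_eq_square)
        finally show ?thesis .
      qed
      have lt: "l j / t j = s / 2"
      proof -
        have "t j * s = sqrt ((2 * l j)\<^sup>2)"
          unfolding t_def s_def real_sqrt_mult[symmetric] using v q
          by (intro arg_cong[where f=sqrt]) (simp add: field_simps power2_eq_square)
        also have "\<dots> = 2 * l j" using l[of j] by (simp only: real_sqrt_abs)
        finally show ?thesis using t[of j] by (simp add: field_simps)
      qed
      have "mart Y n \<omega> \<le> t j / 2 * brkt Y n \<omega> + c j / t j"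
        using elim(1) by (auto simp: j_def intro: less_imp_le)
      also have "\<dots> \<le> t j / 2 * (v * (q * q ^ j)) + c j / t j"
      proof -
        have "brkt Y n \<omega> \<le> v * (q * q ^ j)"
          using elim(4) nq v by (meson mult_left_mono less_imp_le order_trans)
        then show ?thesis using t[of j] by (intro add_right_mono mult_left_mono) auto
      qed
      also have "\<dots> = q / 2 * (t j * (v * q ^ j)) + (2 * q - 1) * (l j / t j)" by (simp add: c_def)
      also have "\<dots> = (3 * q - 1) / 2 * s" unfolding tv lt by (simp add: field_simps)
      also have "\<dots> \<le> (3 * q - 1) / 2 * sqrt (q * (2 * v * real n * ln (ln (real n))))"
      proof -
        have "2 * l j * v * q ^ j \<le> 2 * (q * ln (ln (real n))) * v * real n"
          using lj qn v q l[of j] elim(3) by (intro mult_mono) auto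
        then have "s \<le> sqrt (q * (2 * v * real n * ln (ln (real n))))"
          unfolding s_def by (intro real_sqrt_le_mono) (simp add: mult_ac)
        then show ?thesis using q by (intro mult_left_mono) auto
      qed
      finally have fin: "mart Y n \<omega> \<le> (3 * q - 1) / 2 * sqrt q * sqrt (2 * v * real n * ln (ln (real n)))"
        by (simp add: real_sqrt_mult)
      have "0 \<le> (q - 1) * (q - 1 / 2)" using q(1) by (intro mult_nonneg_nonneg) auto
      moreover have "(q - 1) * (q - 1 / 2) = q\<^sup>2 - (3 * q - 1) / 2" by (simp add: power2_eq_square field_simps)
      ultimately have "(3 * q - 1) / 2 \<le> q\<^sup>2" by simp
      moreover have "sqrt q \<le> q" using q(1) by (intro real_le_lsqrt) (auto simp: power2_eq_square)
      ultimately have "(3 * q - 1) / 2 * sqrt q \<le> q\<^sup>2 * q" using q(1) by (intro mult_mono) auto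
      also have "\<dots> = r" using q(2) by (simp add: power2_eq_square power3_eq_cube)
      finally show ?case
        using elim(3) v by (intro order_trans[OF fin] mult_right_mono) auto
    qed
  qed
qed

lemma adapted_uminus: "adapted Y \<Longrightarrow> adapted (\<lambda>k \<omega>. - Y k \<omega>)"
  unfolding adapted_def by (auto intro: borel_measurable_uminus)

lemma mart_uminus: "mart (\<lambda>k \<omega>. - Y k \<omega>) n \<omega> = - mart Y n \<omega>"
  by (simp add: mart_def sum_negf)

lemma brkt_uminus: "brkt (\<lambda>k \<omega>. - Y k \<omega>) n \<omega> = brkt Y n \<omega>"
  by (simp add: brkt_def)

lemma lil_upper_abs:
  assumes Y: "adapted Y" and v: "0 < v" and r: "1 < r"
    and B: "AE \<omega> in M. \<forall>\<^sub>F n in sequentially. brkt Y n \<omega> \<le> v * real n"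
  shows "AE \<omega> in M. \<forall>\<^sub>F n in sequentially. \<bar>mart Y n \<omega>\<bar> \<le> r * sqrt (2 * v * real n * ln (ln (real n)))"
  using lil_upper[OF Y v r B] lil_upper[OF adapted_uminus[OF Y] v r, unfolded mart_uminus brkt_uminus, OF B]
proof eventually_elim
  case (elim \<omega>)
  then show ?case by eventually_elim auto
qed

text \<open>
A bracket of order \<open>ln n * ln (ln n)\<close> forces the martingale below every multiple of \<open>ln n\<close>. This is
the shape of the cross term in the quadratic strong law, whose bracket is known only up to the
factor \<open>ln (ln n)\<close> that comes from the law of the iterated logarithm.
\<close>

lemma AE_mart_le_small_ln:
  assumes Y: "adapted Y"
    and B: "AE \<omega> in M. \<exists>C. \<forall>\<^sub>F n in sequentially. brkt Y n \<omega> \<le> C * (ln (real n) * ln (ln (real n)))"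
  shows "AE \<omega> in M. \<forall>e>0. \<forall>\<^sub>F n in sequentially. mart Y n \<omega> \<le> e * ln (real n)"
proof -
  define t where "t j = 1 / real (Suc j)" for j
  define c where "c j = 2 * ln (real j + 2)" for j :: nat
  have t: "0 < t j" for j by (simp add: t_def)
  have "summable (\<lambda>j. real j powr (- 2))" by (simp add: summable_real_powr_iff)
  from summable_ignore_initial_segment[OF this, of 2]
  have sum: "summable (\<lambda>j. exp (- c j))" by (simp add: c_def powr_def add.commute)
  from AE_mart_le_brkt[where t=t and c=c, OF Y t sum] B show ?thesis
  proof eventually_elim
    case (elim \<omega>)
    then obtain C where C: "\<forall>\<^sub>F n in sequentially. brkt Y n \<omega> \<le> C * (ln (real n) * ln (ln (real n)))" by auto
    (* With t = 1 / (j + 1) the bound is bracket / (2 (j + 1)) + 2 (j + 1) ln (j + 2); this j makes both parts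
       of smaller order than ln n. *)
    define J where "J n = nat \<lfloor>(ln (ln (real n)))\<^sup>2\<rfloor>" for n :: nat
    have "filterlim J at_top sequentially" unfolding J_def by real_asymp
    with elim(1) have ev1: "\<forall>\<^sub>F n in sequentially. \<forall>m. mart Y m \<omega> < t (J n) / 2 * brkt Y m \<omega> + c (J n) / t (J n)"
      by (auto simp: filterlim_iff)
    show ?case
    proof (intro allI impI)
      fix e :: real assume e: "0 < e"
      have ev3: "\<forall>\<^sub>F n in sequentially. 0 < ln (ln (real n))" by real_asymp
      have "(\<lambda>n. 1 / (2 * (ln (ln (real n)))\<^sup>2) * (C * (ln (real n) * ln (ln (real n)))) / ln (real n)
          + 2 * ln ((ln (ln (real n)))\<^sup>2 + 2) * ((ln (ln (real n)))\<^sup>2 + 1) / ln (real n)) \<longlonglongrightarrow> 0"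
        by real_asymp
      then have ev2: "\<forall>\<^sub>F n in sequentially. 1 / (2 * (ln (ln (real n)))\<^sup>2) * (C * (ln (real n) * ln (ln (real n)))) / ln (real n)
          + 2 * ln ((ln (ln (real n)))\<^sup>2 + 2) * ((ln (ln (real n)))\<^sup>2 + 1) / ln (real n) < e"
        using e by (rule order_tendstoD)
      from ev1 ev2 ev3 C eventually_gt_at_top[of 2] show "\<forall>\<^sub>F n in sequentially. mart Y n \<omega> \<le> e * ln (real n)"
      proof eventually_elim
        case (elim n)
        define j where "j = J n"
        define x where "x = (ln (ln (real n)))\<^sup>2"
        have x: "0 < x" using elim(3) by (simp add: x_def)
        have ln: "0 < ln (real n)" using elim by simp
        have j: "real j \<le> x" "x < real j + 1"
          using x unfolding j_def J_def x_def by linarith+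
        have B0: "0 \<le> brkt Y n \<omega>" unfolding brkt_def using s2_nonneg by (intro sum_nonneg) auto
        have "mart Y n \<omega> \<le> t j / 2 * brkt Y n \<omega> + c j / t j"
          using elim(1) by (auto simp: j_def intro: less_imp_le)
        also have "t j / 2 * brkt Y n \<omega> \<le> 1 / (2 * x) * (C * (ln (real n) * ln (ln (real n))))"
          using j x B0 elim(4) by (intro mult_mono) (auto simp: t_def field_simps)
        also have "c j / t j \<le> 2 * ln (x + 2) * (x + 1)"
          unfolding c_def t_def using j x by (auto intro!: mult_mono)
        finally have "mart Y n \<omega> / ln (real n) \<le> (1 / (2 * x) * (C * (ln (real n) * ln (ln (real n)))) + 2 * ln (x + 2) * (x + 1)) / ln (real n)"
          using ln by (intro divide_right_mono) auto
        also have "\<dots> \<le> e" using elim(2) unfolding x_def by (simp add: add_divide_distrib)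
        finally show ?case using ln by (simp add: divide_le_eq)
      qed
    qed
  qed
qed

lemma brkt_average:
  assumes "(\<lambda>n. (\<Sum>k<n. (U k \<omega> * Y k \<omega>)\<^sup>2) / real n) \<longlonglongrightarrow> v"
    and "(\<lambda>n. (\<Sum>k<n. (Y k \<omega>)\<^sup>2) / real n) \<longlonglongrightarrow> y"
  shows "(\<lambda>n. brkt Y n \<omega> / real n) \<longlonglongrightarrow> v / 3 + 2 * s2 / 3 * y"
proof -
  have "brkt Y n \<omega> / real n = (\<Sum>k<n. (U k \<omega> * Y k \<omega>)\<^sup>2) / real n / 3 + 2 * s2 / 3 * ((\<Sum>k<n. (Y k \<omega>)\<^sup>2) / real n)" for n
  proof -
    have "brkt Y n \<omega> = (\<Sum>k<n. (U k \<omega> * Y k \<omega>)\<^sup>2 / 3 + 2 * s2 / 3 * (Y k \<omega>)\<^sup>2)"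
      unfolding brkt_def by (intro sum.cong) (auto simp: field_simps power_mult_distrib)
    also have "\<dots> = (\<Sum>k<n. (U k \<omega> * Y k \<omega>)\<^sup>2) / 3 + 2 * s2 / 3 * (\<Sum>k<n. (Y k \<omega>)\<^sup>2)"
      by (simp add: sum.distrib sum_distrib_left sum_divide_distrib)
    finally show ?thesis by (simp add: add_divide_distrib)
  qed
  moreover have "(\<lambda>n. (\<Sum>k<n. (U k \<omega> * Y k \<omega>)\<^sup>2) / real n / 3 + 2 * s2 / 3 * ((\<Sum>k<n. (Y k \<omega>)\<^sup>2) / real n))
      \<longlonglongrightarrow> v / 3 + 2 * s2 / 3 * y"
    by (intro tendsto_intros assms) auto
  ultimately show ?thesis by simp
qed

text \<open>
The upper law of the iterated logarithm, in the form of the hypothesis on \<open>mart Y\<close>, bounds the weights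
of the cross term; the remaining sum \<open>\<Sum> b\<^sub>k / (k + 1)\<close> over the increments \<open>b\<^sub>k\<close> of the bracket is of order \<open>ln n\<close>.
\<close>

lemma brkt_cross_term_bound:
  assumes B: "(\<lambda>n. brkt Y n \<omega> / real n) \<longlonglongrightarrow> l" and c: "0 \<le> c"
    and W: "\<forall>\<^sub>F n in sequentially. (mart Y n \<omega>)\<^sup>2 \<le> c * (real n * ln (ln (real n)))"
  shows "\<exists>C. \<forall>\<^sub>F n in sequentially.
    brkt (\<lambda>k \<omega>. mart Y k \<omega> * Y k \<omega> / real (Suc k)) n \<omega> \<le> C * (ln (real n) * ln (ln (real n)))"
proof -
  define b where "b = max 0 l + 1"
  define a where "a k = (Y k \<omega>)\<^sup>2 * ((U k \<omega>)\<^sup>2 + 2 * s2) / 3" for k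
  have a0: "0 \<le> a k" for k unfolding a_def using s2_nonneg by simp
  from B have "(\<lambda>n. (\<Sum>k<n. a k) / real n) \<longlonglongrightarrow> l"
    by (simp add: brkt_def a_def)
  from log_average_of_average[OF this] have "\<forall>\<^sub>F n in sequentially. (\<Sum>k=1..n. a k / real (Suc k)) / ln (real n) < b"
    by (rule order_tendstoD) (simp add: b_def)
  then have ev1: "\<forall>\<^sub>F n in sequentially. (\<Sum>k=1..n. a k / real (Suc k)) \<le> b * ln (real n)"
    using eventually_gt_at_top[of 1] by eventually_elim (simp add: divide_less_eq)
  from W obtain K0 where K0: "\<And>n. n \<ge> K0 \<Longrightarrow> (mart Y n \<omega>)\<^sup>2 \<le> c * (real n * ln (ln (real n)))"
    by (auto simp: eventually_sequentially)
  have "\<forall>\<^sub>F n in sequentially. 1 \<le> ln (ln (real n)) \<and> 1 \<le> ln (real n)" by (intro eventually_conj; real_asymp)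
  then obtain K1 where lnln_pos: "\<And>n. n \<ge> K1 \<Longrightarrow> 1 \<le> ln (ln (real n))" "\<And>n. n \<ge> K1 \<Longrightarrow> 1 \<le> ln (real n)"
    by (auto simp: eventually_sequentially)
  define K where "K = max K0 (max 2 K1)"
  define P where "P k = (mart Y k \<omega>)\<^sup>2 / (real (Suc k))\<^sup>2 * a k" for k
  have P0: "0 \<le> P k" for k unfolding P_def using a0 by simp
  have PB: "brkt (\<lambda>k \<omega>. mart Y k \<omega> * Y k \<omega> / real (Suc k)) n \<omega> = (\<Sum>k<n. P k)" for n
    unfolding brkt_def P_def a_def
    by (intro sum.cong) (auto simp: power_divide power_mult_distrib)
  define C0 where "C0 = (\<Sum>k<K. P k)"
  have C0: "0 \<le> C0" unfolding C0_def by (intro sum_nonneg P0)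
  show ?thesis
  proof (intro exI)
    from ev1 eventually_ge_at_top[of K]
    show "\<forall>\<^sub>F n in sequentially. brkt (\<lambda>k \<omega>. mart Y k \<omega> * Y k \<omega> / real (Suc k)) n \<omega> \<le> (C0 + c * b) * (ln (real n) * ln (ln (real n)))"
    proof eventually_elim
      case (elim n)
      have n: "n \<ge> K1" using elim by (simp add: K_def)
      note ll = lnln_pos[OF n]
      have "brkt (\<lambda>k \<omega>. mart Y k \<omega> * Y k \<omega> / real (Suc k)) n \<omega> \<le> C0 + (\<Sum>k=1..n. c * ln (ln (real n)) * (a k / real (Suc k)))"
      proof -
        have "brkt (\<lambda>k \<omega>. mart Y k \<omega> * Y k \<omega> / real (Suc k)) n \<omega> = C0 + (\<Sum>k\<in>{K..<n}. P k)"
          unfolding PB C0_def using elim(2) by (simp add: sum.atLeastLessThan_concat lessThan_atLeast0)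
        also have "(\<Sum>k\<in>{K..<n}. P k) \<le> (\<Sum>k\<in>{K..<n}. c * ln (ln (real n)) * (a k / real (Suc k)))"
        proof (rule sum_mono)
          fix k assume k: "k \<in> {K..<n}"
          then have k16: "k \<ge> K1" "k \<ge> K0" "k < n" "1 < k" by (auto simp: K_def)
          note lk = lnln_pos[OF k16(1)]
          have "ln (ln (real k)) \<le> ln (ln (real n))" using k16 lk by (subst ln_le_cancel_iff) (auto simp: ll)
          then have "real k * ln (ln (real k)) \<le> real (Suc k) * ln (ln (real n))"
            using lk by (intro mult_mono) auto
          then have "(mart Y k \<omega>)\<^sup>2 \<le> c * (real (Suc k) * ln (ln (real n)))"
            using K0[OF k16(2)] c by (intro order_trans[OF K0[OF k16(2)]] mult_left_mono) auto
          then have "P k \<le> c * (real (Suc k) * ln (ln (real n))) / (real (Suc k))\<^sup>2 * a k"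
            unfolding P_def using a0 by (intro mult_right_mono divide_right_mono) auto
          also have "\<dots> = c * ln (ln (real n)) * (a k / real (Suc k))"
            by (simp add: power2_eq_square field_simps del: of_nat_Suc)
          finally show "P k \<le> c * ln (ln (real n)) * (a k / real (Suc k))" .
        qed
        also have "\<dots> \<le> (\<Sum>k=1..n. c * ln (ln (real n)) * (a k / real (Suc k)))"
          using a0 c ll by (intro sum_mono2) (auto simp: K_def)
        finally show ?thesis by simp
      qed
      also have "\<dots> = C0 + c * ln (ln (real n)) * (\<Sum>k=1..n. a k / real (Suc k))"
        by (simp add: sum_distrib_left)
      also have "\<dots> \<le> C0 * (ln (real n) * ln (ln (real n))) + c * ln (ln (real n)) * (b * ln (real n))"
      proof (rule add_mono)
        have "1 * 1 \<le> ln (real n) * ln (ln (real n))" using ll by (intro mult_mono) auto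
        then show "C0 \<le> C0 * (ln (real n) * ln (ln (real n)))" using C0 by (simp add: mult_le_cancel_left1)
      qed (use elim c ll in \<open>intro mult_left_mono, auto\<close>)
      finally show ?case by (simp add: algebra_simps)
    qed
  qed
qed

text \<open>
With \<open>W = mart Y\<close> and increments \<open>D\<close>, summation by parts of \<open>W\<^sup>2 / n\<close> expresses
\<open>\<Sum> W\<^sub>k\<^sup>2 / (k (k + 1))\<close> through \<open>\<Sum> D\<^sub>k\<^sup>2 / (k + 1)\<close>, which is asymptotic to \<open>v * ln n\<close>, the boundary
term \<open>W\<^sup>2 / n = O(ln (ln n))\<close>, and the martingale \<open>\<Sum> W\<^sub>k D\<^sub>k / (k + 1)\<close>, which is \<open>o(ln n)\<close>.
\<close>

lemma quadratic_strong_law: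
  assumes Y: "adapted Y"
    and UY: "AE \<omega> in M. (\<lambda>n. (\<Sum>k<n. (U k \<omega> * Y k \<omega>)\<^sup>2) / real n) \<longlonglongrightarrow> v"
    and YY: "AE \<omega> in M. (\<lambda>n. (\<Sum>k<n. (Y k \<omega>)\<^sup>2) / real n) \<longlonglongrightarrow> y"
  shows "AE \<omega> in M. (\<lambda>n. (\<Sum>k=1..n. (mart Y k \<omega> / real k)\<^sup>2) / ln (real n)) \<longlonglongrightarrow> v"
proof -
  define b where "b = max 0 (v / 3 + 2 * s2 / 3 * y) + 1"
  have b: "0 < b" by (simp add: b_def)
  have B: "AE \<omega> in M. (\<lambda>n. brkt Y n \<omega> / real n) \<longlonglongrightarrow> v / 3 + 2 * s2 / 3 * y"
    using UY YY by eventually_elim (rule brkt_average)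
  have "AE \<omega> in M. \<forall>\<^sub>F n in sequentially. brkt Y n \<omega> \<le> b * real n"
    using B
  proof eventually_elim
    case (elim \<omega>)
    have "v / 3 + 2 * s2 / 3 * y < b" by (simp add: b_def)
    from order_tendstoD(2)[OF elim this] eventually_gt_at_top[of 0] show ?case
      by eventually_elim (simp add: divide_less_eq)
  qed
  from lil_upper_abs[OF Y b _ this, of 2]
  have L: "AE \<omega> in M. \<forall>\<^sub>F n in sequentially. \<bar>mart Y n \<omega>\<bar> \<le> 2 * sqrt (2 * b * real n * ln (ln (real n)))" by simp
  have L2: "AE \<omega> in M. \<forall>\<^sub>F n in sequentially. (mart Y n \<omega>)\<^sup>2 \<le> 8 * b * (real n * ln (ln (real n)))"
    using L
  proof eventually_elim
    case (elim \<omega>)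
    have ev3: "\<forall>\<^sub>F n in sequentially. 0 < ln (ln (real n))" by real_asymp
    from elim ev3 show ?case
    proof eventually_elim
      case (elim n)
      have "(mart Y n \<omega>)\<^sup>2 \<le> (2 * sqrt (2 * b * real n * ln (ln (real n))))\<^sup>2"
        using elim(1) by (metis abs_ge_zero power2_abs power_mono)
      also have "\<dots> = 8 * b * (real n * ln (ln (real n)))"
        using b elim(2) by (simp add: power_mult_distrib)
      finally show ?case .
    qed
  qed
  (* Weights of the cross-term martingale of the summation by parts. *)
  define YT where "YT = (\<lambda>k \<omega>. mart Y k \<omega> * Y k \<omega> / real (Suc k))"
  have YT: "adapted YT"
    unfolding adapted_def YT_def using adaptedD[OF Y order_refl] mart_past[OF Y order_refl]
    by (auto intro!: borel_measurable_times borel_measurable_divide)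
  have BT: "AE \<omega> in M. \<exists>C. \<forall>\<^sub>F n in sequentially. brkt YT n \<omega> \<le> C * (ln (real n) * ln (ln (real n)))"
    using B L2 unfolding YT_def by eventually_elim (rule brkt_cross_term_bound, use b in auto)
  from AE_mart_le_small_ln[OF YT BT] AE_mart_le_small_ln[OF adapted_uminus[OF YT], unfolded mart_uminus brkt_uminus, OF BT] UY L2
  show ?thesis
  proof eventually_elim
    case (elim \<omega>)
    define W where "W k = mart Y k \<omega>" for k
    define D where "D k = U k \<omega> * Y k \<omega>" for k
    have WS: "W (Suc k) = W k + D k" for k by (simp add: W_def D_def mart_def)
    have T: "mart YT (Suc n) \<omega> = (\<Sum>k=1..n. W k * D k / real (Suc k))" for n
    proof -
      have "mart YT (Suc n) \<omega> = (\<Sum>k\<in>{0..n}. W k * D k / real (Suc k))"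
        unfolding mart_def YT_def W_def D_def lessThan_Suc_atMost atMost_atLeast0 by (intro sum.cong) (auto simp: mult_ac)
      also have "\<dots> = (\<Sum>k=1..n. W k * D k / real (Suc k))"
        by (intro sum.mono_neutral_right) (auto simp: W_def mart_def Suc_le_eq)
      finally show ?thesis .
    qed
    have cross: "(\<lambda>n. mart YT (Suc n) \<omega> / ln (real n)) \<longlonglongrightarrow> 0"
    proof (rule LIMSEQ_I)
      fix r :: real assume r: "0 < r"
      have "\<forall>\<^sub>F n in sequentially. mart YT n \<omega> \<le> r / 4 * ln (real n)" "\<forall>\<^sub>F n in sequentially. - mart YT n \<omega> \<le> r / 4 * ln (real n)"
        by (rule elim(1)[rule_format] elim(2)[rule_format], use r in simp)+
      then have "\<forall>\<^sub>F n in sequentially. mart YT (Suc n) \<omega> \<le> r / 4 * ln (real (Suc n))"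
         "\<forall>\<^sub>F n in sequentially. - mart YT (Suc n) \<omega> \<le> r / 4 * ln (real (Suc n))"
        using eventually_sequentially_Suc[of "\<lambda>n. mart YT n \<omega> \<le> r / 4 * ln (real n)"]
          eventually_sequentially_Suc[of "\<lambda>n. - mart YT n \<omega> \<le> r / 4 * ln (real n)"] by blast+
      moreover have "\<forall>\<^sub>F n in sequentially. ln (real (Suc n)) < 2 * ln (real n)" by real_asymp
      ultimately have "\<forall>\<^sub>F n in sequentially. norm (mart YT (Suc n) \<omega> / ln (real n) - 0) < r"
        using eventually_gt_at_top[of 1]
      proof eventually_elim
        case (elim n)
        have ln: "0 < ln (real n)" using elim by simp
        have "r / 4 * ln (real (Suc n)) \<le> r / 4 * (2 * ln (real n))" using elim r by (intro mult_left_mono) auto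
        moreover have "r * ln (real n) > 0" using r ln by simp
        ultimately have "\<bar>mart YT (Suc n) \<omega>\<bar> < r * ln (real n)" using elim by linarith
        then show ?case using ln by (simp add: divide_less_eq)
      qed
      then show "\<exists>no. \<forall>n\<ge>no. norm (mart YT (Suc n) \<omega> / ln (real n) - 0) < r" by (simp add: eventually_sequentially)
    qed
    have bdry: "(\<lambda>n. (W (Suc n))\<^sup>2 / real (Suc n) / ln (real n)) \<longlonglongrightarrow> 0"
    proof (rule Lim_null_comparison)
      show "(\<lambda>n. 8 * b * ln (ln (real (Suc n))) / ln (real n)) \<longlonglongrightarrow> 0" by real_asymp
      from elim(4) have "\<forall>\<^sub>F n in sequentially. (W (Suc n))\<^sup>2 \<le> 8 * b * (real (Suc n) * ln (ln (real (Suc n))))"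
        unfolding W_def
        using eventually_sequentially_Suc[of "\<lambda>n. (mart Y n \<omega>)\<^sup>2 \<le> 8 * b * (real n * ln (ln (real n)))"] by blast
      then show "\<forall>\<^sub>F n in sequentially. norm ((W (Suc n))\<^sup>2 / real (Suc n) / ln (real n)) \<le> 8 * b * ln (ln (real (Suc n))) / ln (real n)"
        using eventually_gt_at_top[of 1]
      proof eventually_elim
        case (elim n)
        have "(W (Suc n))\<^sup>2 / real (Suc n) \<le> 8 * b * ln (ln (real (Suc n)))"
          using elim by (simp add: divide_le_eq mult_ac del: of_nat_Suc)
        then have "(W (Suc n))\<^sup>2 / real (Suc n) / ln (real n) \<le> 8 * b * ln (ln (real (Suc n))) / ln (real n)"
          using elim by (intro divide_right_mono) auto
        then show ?case using elim by (simp del: of_nat_Suc)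
      qed
    qed
    have id: "(\<Sum>k=1..n. (W k)\<^sup>2 / (real k * real (Suc k)))
        = (\<Sum>k=1..n. (D k)\<^sup>2 / real (Suc k)) + 2 * mart YT (Suc n) \<omega> - (W (Suc n))\<^sup>2 / real (Suc n) + (W 1)\<^sup>2" for n
    proof -
      have "(\<Sum>k=1..n. ((W (Suc k))\<^sup>2 - (W k)\<^sup>2) / real (Suc k))
        = (\<Sum>k=1..n. (D k)\<^sup>2 / real (Suc k) + 2 * (W k * D k / real (Suc k)))"
        by (intro sum.cong) (auto simp: WS power2_sum add_divide_distrib)
      also have "\<dots> = (\<Sum>k=1..n. (D k)\<^sup>2 / real (Suc k)) + 2 * mart YT (Suc n) \<omega>"
        by (simp add: sum.distrib T sum_distrib_left)
      finally show ?thesis using summation_by_parts_average[of "\<lambda>k. (W k)\<^sup>2" n] by simp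
    qed
    have "(\<lambda>n. (\<Sum>k=1..n. (D k)\<^sup>2 / real (Suc k)) / ln (real n) + 2 * (mart YT (Suc n) \<omega> / ln (real n))
       - (W (Suc n))\<^sup>2 / real (Suc n) / ln (real n) + (W 1)\<^sup>2 / ln (real n)) \<longlonglongrightarrow> v + 2 * 0 - 0 + 0"
    proof (intro tendsto_intros cross bdry)
      show "(\<lambda>n. (\<Sum>k=1..n. (D k)\<^sup>2 / real (Suc k)) / ln (real n)) \<longlonglongrightarrow> v"
        by (rule log_average_of_average) (use elim(3) in \<open>simp add: D_def\<close>)
      show "(\<lambda>n. (W 1)\<^sup>2 / ln (real n)) \<longlonglongrightarrow> 0" by real_asymp
    qed
    then have "(\<lambda>n. (\<Sum>k=1..n. (W k)\<^sup>2 / (real k * real (Suc k))) / ln (real n)) \<longlonglongrightarrow> v"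
      unfolding id by (simp add: add_divide_distrib diff_divide_distrib)
    then have "(\<lambda>n. (\<Sum>k=1..n. real (Suc k) / real k * ((W k)\<^sup>2 / (real k * real (Suc k)))) / ln (real n)) \<longlonglongrightarrow> 1 * v"
      by (rule log_average_weights[rotated]) (real_asymp, simp del: of_nat_Suc)
    also have "(\<lambda>n. (\<Sum>k=1..n. real (Suc k) / real k * ((W k)\<^sup>2 / (real k * real (Suc k)))) / ln (real n))
       = (\<lambda>n. (\<Sum>k=1..n. (W k / real k)\<^sup>2) / ln (real n))"
    proof (intro ext arg_cong2[where f="(/)"] sum.cong refl)
      fix n k :: nat assume "k \<in> {1..n}"
      then have "real k \<noteq> 0" by auto
      then show "real (Suc k) / real k * ((W k)\<^sup>2 / (real k * real (Suc k))) = (W k / real k)\<^sup>2"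
        by (simp add: power_divide power2_eq_square del: of_nat_Suc)
    qed
    finally show ?case by (simp add: W_def)
  qed
qed

end

section \<open>Lower law of the iterated logarithm for i.i.d. sums\<close>

text \<open>
Integrate the density over \<open>{y<..y + 1}\<close> only. What matters later is that the exponent is
asymptotic to \<open>y\<^sup>2 / 2\<close> for large \<open>y\<close>.
\<close>

lemma std_normal_tail_lower:
  fixes y :: real
  assumes y: "0 < y"
  shows "exp (- ((y + 1)\<^sup>2 / 2 + 2)) < measure std_normal_distribution {y<..}"
proof -
  interpret real_distribution std_normal_distribution by (rule real_dist_normal_dist)
  (* The additive constant 2 in the exponent absorbs the normalization of the density. *)
  have "sqrt (2 * pi) < exp 2"
  proof (rule real_less_lsqrt)
    have "2 * pi < (3 * 3)" using pi_less_4 by simp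
    also have "\<dots> \<le> exp 2 * exp 2" using exp_ge_add_one_self[of 2] by (intro mult_mono) auto
    finally show "2 * pi < (exp 2)\<^sup>2" by (simp add: power2_eq_square)
  qed auto
  then have "exp (- 2) < 1 / sqrt (2 * pi)" by (simp add: exp_minus field_simps)
  then have "exp (- 2) * exp (- ((y + 1)\<^sup>2 / 2)) < 1 / sqrt (2 * pi) * exp (- ((y + 1)\<^sup>2 / 2))"
    by (intro mult_strict_right_mono) auto
  also have "exp (- 2) * exp (- ((y + 1)\<^sup>2 / 2)) = exp (- ((y + 1)\<^sup>2 / 2 + 2))"
    unfolding exp_add[symmetric] by simp
  finally have 1: "exp (- ((y + 1)\<^sup>2 / 2 + 2)) < std_normal_density (y + 1)"
    by (simp add: std_normal_density_def)
  have "ennreal (std_normal_density (y + 1)) = (\<integral>\<^sup>+x. ennreal (std_normal_density (y + 1)) * indicator {y<..y+1} x \<partial>lborel)"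
    by (simp add: nn_integral_cmult_indicator)
  also have "\<dots> \<le> (\<integral>\<^sup>+x. ennreal (std_normal_density x) * indicator {y<..} x \<partial>lborel)"
  proof (rule nn_integral_mono)
    fix x
    have "x \<in> {y<..y+1} \<Longrightarrow> std_normal_density (y + 1) \<le> std_normal_density x"
      unfolding std_normal_density_def using y
      by (intro mult_left_mono) (auto intro!: power_mono)
    then show "ennreal (std_normal_density (y + 1)) * indicator {y<..y+1} x \<le> ennreal (std_normal_density x) * indicator {y<..} x"
      by (auto simp: indicator_def intro: ennreal_leI)
  qed
  also have "\<dots> = emeasure std_normal_distribution {y<..}"
    by (subst emeasure_density) auto
  finally have "std_normal_density (y + 1) \<le> measure std_normal_distribution {y<..}"
    by (simp add: emeasure_eq_measure)
  with 1 show ?thesis by simp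
qed

context prob_space begin

text \<open>
The second Borel--Cantelli lemma, for events of the form \<open>0 < T k\<close> with independent \<open>T k\<close>: the
probability that none of \<open>N\<close> consecutive events happens is at most \<open>exp\<close> of minus the sum of
their probabilities.
\<close>

lemma AE_frequently_of_indep:
  fixes T :: "nat \<Rightarrow> 'a \<Rightarrow> real"
  assumes T: "indep_vars (\<lambda>_. borel) T UNIV"
    and div: "\<not> summable (\<lambda>k. prob {\<omega>\<in>space M. 0 < T k \<omega>})"
  shows "AE \<omega> in M. \<exists>\<^sub>F k in sequentially. 0 < T k \<omega>"
proof -
  have [measurable]: "T k \<in> borel_measurable M" for k using T by (auto simp: indep_vars_def)
  define p where "p k = prob {\<omega>\<in>space M. 0 < T k \<omega>}" for k
  define I where "I k \<omega> = (indicator {..0} (T k \<omega>) :: real)" for k \<omega>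
  have indI: "indep_vars (\<lambda>_. borel) I UNIV"
    unfolding I_def by (rule indep_vars_compose2[OF T]) simp
  have intI: "integrable M (I k)" for k
    unfolding I_def by (intro integrable_const_bound[where B=1]) (auto simp: indicator_def)
  have EI: "expectation (I k) = 1 - p k" for k
  proof -
    have "expectation (I k) = expectation (indicator {\<omega>\<in>space M. \<not> 0 < T k \<omega>})"
      by (intro Bochner_Integration.integral_cong) (auto simp: I_def indicator_def)
    also have "\<dots> = prob {\<omega>\<in>space M. \<not> 0 < T k \<omega>}" by simp
    also have "\<dots> = 1 - p k" unfolding p_def by (subst prob_neg) auto
    finally show ?thesis .
  qed
  have "AE \<omega> in M. \<exists>k\<ge>m. 0 < T k \<omega>" for m
  proof -
    define A where "A = {\<omega>\<in>space M. \<forall>k\<ge>m. T k \<omega> \<le> 0}"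
    have [measurable]: "A \<in> sets M" unfolding A_def by measurable
    have le: "prob A \<le> exp (- (\<Sum>k\<in>{m..<m+N}. p k))" for N
    proof -
      have "prob A = expectation (indicator A)" by simp
      also have "\<dots> \<le> expectation (\<lambda>\<omega>. \<Prod>k\<in>{m..<m+N}. I k \<omega>)"
      proof (rule integral_mono)
        show "integrable M (\<lambda>\<omega>. \<Prod>k\<in>{m..<m+N}. I k \<omega>)"
          by (rule indep_vars_integrable[OF _ indep_vars_subset[OF indI] intI]) auto
        fix \<omega>
        show "indicator A \<omega> \<le> (\<Prod>k\<in>{m..<m+N}. I k \<omega>)"
        proof (cases "\<omega> \<in> A")
          case True
          then have "(\<Prod>k\<in>{m..<m+N}. I k \<omega>) = 1" by (intro prod.neutral) (auto simp: A_def I_def)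
          then show ?thesis using True by simp
        next
          case False
          then show ?thesis by (auto simp: I_def intro!: prod_nonneg)
        qed
      qed (simp add: emeasure_eq_measure)
      also have "\<dots> = (\<Prod>k\<in>{m..<m+N}. 1 - p k)"
        by (subst indep_vars_lebesgue_integral[OF _ indep_vars_subset[OF indI] intI]) (auto simp: EI)
      also have "\<dots> \<le> (\<Prod>k\<in>{m..<m+N}. exp (- p k))"
        by (intro prod_mono) (use exp_ge_add_one_self[of "- p _"] in \<open>auto simp: p_def\<close>)
      also have "\<dots> = exp (- (\<Sum>k\<in>{m..<m+N}. p k))" by (simp add: exp_sum sum_negf[symmetric])
      finally show ?thesis .
    qed
    have "prob A \<le> e" if "0 < e" for e
    proof -
      have "\<not> summable (\<lambda>k. p (k + m))" using div by (simp add: p_def summable_iff_shift[of "\<lambda>k. prob {\<omega>\<in>space M. 0 < T k \<omega>}"])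
      then have "\<not> (\<forall>N. (\<Sum>k<N. p (k + m)) \<le> - ln e)"
        by (metis p_def measure_nonneg summableI_nonneg_bounded)
      then obtain N where N: "- ln e < (\<Sum>k<N. p (k + m))" by (auto simp: not_le)
      have "(\<Sum>k<N. p (k + m)) = (\<Sum>k\<in>{m..<m+N}. p k)"
        using sum.shift_bounds_nat_ivl[of p 0 m N] by (simp add: lessThan_atLeast0 add.commute)
      then have "exp (- (\<Sum>k\<in>{m..<m+N}. p k)) \<le> exp (ln e)" using N by simp
      then show ?thesis using le[of N] that by simp
    qed
    then have "prob A \<le> 0" by (rule field_le_epsilon[of _ 0, simplified])
    then have "prob A = 0" by (simp add: measure_le_0_iff)
    then have "AE \<omega> in M. \<omega> \<notin> A" by (simp add: prob_eq_0)
    then show ?thesis by (rule AE_mp) (auto intro!: AE_I2 simp: A_def not_le)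
  qed
  then have "AE \<omega> in M. \<forall>m. \<exists>k\<ge>m. 0 < T k \<omega>" unfolding AE_all_countable by blast
  then show ?thesis by (simp add: frequently_sequentially)
qed

text \<open>
Statistics of consecutive disjoint stretches of an independent sequence are independent; each
stretch is presented with indices starting from 0.
\<close>

lemma indep_vars_blocks:
  fixes B :: "nat \<Rightarrow> 'a \<Rightarrow> real" and s :: "nat \<Rightarrow> nat" and f :: "nat \<Rightarrow> (nat \<Rightarrow> real) \<Rightarrow> real"
  assumes B: "indep_vars (\<lambda>_. borel) B UNIV"
    and s: "\<And>j. s j + N j \<le> s (Suc j)"
    and f: "\<And>j. f j \<in> borel_measurable (PiM {..<N j} (\<lambda>_. borel))"
  shows "indep_vars (\<lambda>_. borel) (\<lambda>j \<omega>. f j (\<lambda>i\<in>{..<N j}. B (s j + i) \<omega>)) UNIV"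
proof -
  have mono: "s i + N i \<le> s j" if "i < j" for i j
    using that
  proof (induction j)
    case (Suc j)
    then show ?case using s[of j] s[of i] by (cases "i = j") auto
  qed simp
  define K where "K j = {s j..<s j + N j}" for j
  have "disjoint_family_on K UNIV"
  proof (unfold disjoint_family_on_def, safe)
    fix i j x assume "i \<noteq> j" "x \<in> K i" "x \<in> K j"
    then show "x \<in> {}"
      using mono[of i j] mono[of j i] by (cases "i < j") (auto simp: K_def)
  qed
  then have ind: "indep_vars (\<lambda>j. PiM (K j) (\<lambda>_. borel)) (\<lambda>j \<omega>. restrict (\<lambda>i. B i \<omega>) (K j)) UNIV"
    by (intro indep_vars_restrict[OF B]) auto
  have "indep_vars (\<lambda>_. borel) (\<lambda>j \<omega>. f j (\<lambda>i\<in>{..<N j}. (restrict (\<lambda>i. B i \<omega>) (K j)) (s j + i))) UNIV"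
  proof (rule indep_vars_compose2[OF ind, of "\<lambda>j h. f j (\<lambda>i\<in>{..<N j}. h (s j + i))"])
    fix j
    have "(\<lambda>h. \<lambda>i\<in>{..<N j}. h (s j + i)) \<in> measurable (PiM (K j) (\<lambda>_. borel)) (PiM {..<N j} (\<lambda>_. borel :: real measure))"
      by (intro measurable_restrict measurable_component_singleton) (auto simp: K_def)
    from measurable_compose[OF this f]
    show "(\<lambda>h. f j (\<lambda>i\<in>{..<N j}. h (s j + i))) \<in> borel_measurable (PiM (K j) (\<lambda>_. borel))" .
  qed
  moreover have "(\<lambda>i\<in>{..<N j}. (restrict (\<lambda>i. B i \<omega>) (K j)) (s j + i)) = (\<lambda>i\<in>{..<N j}. B (s j + i) \<omega>)" for j \<omega>
    by (auto simp: K_def fun_eq_iff)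
  ultimately show ?thesis by simp
qed

lemma distr_block:
  fixes B :: "nat \<Rightarrow> 'a \<Rightarrow> real"
  assumes B: "indep_vars (\<lambda>_. borel) B UNIV"
    and same: "\<And>n. distr M borel (B n) = distr M borel (B 0)"
    and f: "f \<in> borel_measurable (PiM {..<N} (\<lambda>_. borel))"
  shows "distr M borel (\<lambda>\<omega>. f (\<lambda>i\<in>{..<N}. B (a + i) \<omega>)) = distr M borel (\<lambda>\<omega>. f (\<lambda>i\<in>{..<N}. B i \<omega>))"
proof (cases "N = 0")
  case True then show ?thesis by (simp add: restrict_def)
next
  case False
  have [measurable]: "B n \<in> borel_measurable M" for n using B by (auto simp: indep_vars_def)
  have vec: "distr M (PiM {..<N} (\<lambda>_. borel)) (\<lambda>\<omega>. \<lambda>i\<in>{..<N}. B (a + i) \<omega>) = PiM {..<N} (\<lambda>_. distr M borel (B 0))" for a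
  proof -
    have "indep_vars (\<lambda>_. borel) (\<lambda>j \<omega>. (\<lambda>h. h 0) (\<lambda>i\<in>{..<1::nat}. B ((a + j) + i) \<omega>)) UNIV"
      by (rule indep_vars_blocks[OF B]) (auto intro!: measurable_component_singleton)
    then have "indep_vars (\<lambda>_. borel) (\<lambda>j. B (a + j)) UNIV" by simp
    then have "indep_vars (\<lambda>_. borel) (\<lambda>j. B (a + j)) {..<N}" by (rule indep_vars_subset) simp
    then have "distr M (PiM {..<N} (\<lambda>_. borel)) (\<lambda>\<omega>. \<lambda>i\<in>{..<N}. B (a + i) \<omega>) = PiM {..<N} (\<lambda>i. distr M borel (B (a + i)))"
      using False by (subst (asm) indep_vars_iff_distr_eq_PiM') auto
    also have "(\<lambda>i. distr M borel (B (a + i))) = (\<lambda>_. distr M borel (B 0))" using same by auto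
    finally show ?thesis .
  qed
  have "distr M borel (\<lambda>\<omega>. f (\<lambda>i\<in>{..<N}. B (a + i) \<omega>)) = distr (distr M (PiM {..<N} (\<lambda>_. borel)) (\<lambda>\<omega>. \<lambda>i\<in>{..<N}. B (a + i) \<omega>)) borel f" for a
    using f by (subst distr_distr) (auto simp: comp_def intro!: measurable_restrict)
  from this[of a] this[of 0] show ?thesis using vec[of a] vec[of 0] by simp
qed

lemma clt_tail_lower:
  fixes B :: "nat \<Rightarrow> 'a \<Rightarrow> real"
  assumes B: "indep_vars (\<lambda>_. borel) B UNIV"
    and same: "\<And>n. distr M borel (B n) = distr M borel (B 0)"
    and m0: "\<And>n. expectation (B n) = 0" and i2: "\<And>n. integrable M (\<lambda>\<omega>. (B n \<omega>)\<^sup>2)"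
    and v: "\<And>n. expectation (\<lambda>\<omega>. (B n \<omega>)\<^sup>2) = v" "0 < v" and y: "0 < y"
  shows "\<forall>\<^sub>F N in sequentially.
     exp (- ((y + 1)\<^sup>2 / 2 + 2)) < prob {\<omega>\<in>space M. y * sqrt (real N * v) < (\<Sum>i<N. B i \<omega>)}"
proof -
  have [measurable]: "B n \<in> borel_measurable M" for n using B by (auto simp: indep_vars_def)
  define \<mu> where "\<mu> n = distr M borel (\<lambda>x. (\<Sum>i<n. B i x) / sqrt (real n * (sqrt v)\<^sup>2))" for n
  have "weak_conv_m (\<lambda>n. distr M borel (\<lambda>x. (\<Sum>i<n. B i x - 0) / sqrt (real n * (sqrt v)\<^sup>2))) std_normal_distribution"
    by (rule central_limit_theorem[where \<mu> = "distr M borel (B 0)"]) (use B same m0 i2 v in auto)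
  then have "weak_conv_m \<mu> std_normal_distribution" unfolding \<mu>_def diff_zero .
  moreover have rd: "real_distribution (\<mu> n)" for n unfolding \<mu>_def by (intro real_distribution_distr) measurable
  ultimately have "(\<lambda>n. measure (\<mu> n) {y<..}) \<longlonglongrightarrow> measure std_normal_distribution {y<..}"
  proof (intro weak_conv_imp_continuity_set_conv)
    show "emeasure std_normal_distribution (frontier {y<..}) = 0"
    proof -
      have "emeasure std_normal_distribution {y} = (\<integral>\<^sup>+x. ennreal (std_normal_density x) * indicator {y} x \<partial>lborel)"
        by (subst emeasure_density) auto
      also have "\<dots> = 0" by (subst nn_integral_0_iff_AE) (auto intro!: AE_I[of _ _ "{y}"] simp: indicator_def)
      moreover have "frontier {y<..} = {y}" by (auto simp: frontier_def interior_open)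
      ultimately show ?thesis by simp
    qed
  qed (auto intro: real_dist_normal_dist)
  from order_tendstoD(1)[OF this std_normal_tail_lower[OF y]] eventually_gt_at_top[of 0]
  show ?thesis
  proof eventually_elim
    case (elim N)
    have "measure (\<mu> N) {y<..} = prob {\<omega>\<in>space M. y * sqrt (real N * v) < (\<Sum>i<N. B i \<omega>)}"
      unfolding \<mu>_def using elim v(2)
      by (subst measure_distr) (auto intro!: arg_cong[where f=prob] simp: pos_less_divide_eq)
    then show ?case using elim by simp
  qed
qed

lemma prob_all_blocks:
  fixes B :: "nat \<Rightarrow> 'a \<Rightarrow> real"
  assumes B: "indep_vars (\<lambda>_. borel) B UNIV"
    and same: "\<And>n. distr M borel (B n) = distr M borel (B 0)"
  shows "prob {\<omega>\<in>space M. \<forall>j<p. c < (\<Sum>i<N. B (a + j * N + i) \<omega>)} = prob {\<omega>\<in>space M. c < (\<Sum>i<N. B i \<omega>)} ^ p"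
proof -
  have [measurable]: "B n \<in> borel_measurable M" for n using B by (auto simp: indep_vars_def)
  define G where "G h = (indicator {c<..} (\<Sum>i<N. h i) :: real)" for h :: "nat \<Rightarrow> real"
  have Gm: "G \<in> borel_measurable (PiM {..<N} (\<lambda>_. borel))"
  proof -
    have "(\<lambda>h. \<Sum>i<N. h i) \<in> borel_measurable (PiM {..<N} (\<lambda>_. borel :: real measure))"
      by (intro borel_measurable_sum measurable_component_singleton) auto
    then show ?thesis unfolding G_def by measurable
  qed
  define I where "I j \<omega> = G (\<lambda>i\<in>{..<N}. B (a + j * N + i) \<omega>)" for j \<omega>
  have indI: "indep_vars (\<lambda>_. borel) I UNIV"
    unfolding I_def by (rule indep_vars_blocks[OF B]) (auto simp: Gm)
  have Ieq: "I j \<omega> = indicator {c<..} (\<Sum>i<N. B (a + j * N + i) \<omega>)" for j \<omega>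
    unfolding I_def G_def by simp
  have [measurable]: "I j \<in> borel_measurable M" for j using indI by (auto simp: indep_vars_def)
  have intI: "integrable M (I j)" for j
    by (intro integrable_const_bound[where B=1]) (auto simp: Ieq indicator_def)
  have EI: "expectation (I j) = prob {\<omega>\<in>space M. c < (\<Sum>i<N. B i \<omega>)}" for j
  proof -
    have [measurable]: "(\<lambda>\<omega>. G (\<lambda>i\<in>{..<N}. B i \<omega>)) \<in> borel_measurable M"
      by (rule measurable_compose[OF _ Gm]) (auto intro!: measurable_restrict)
    have "expectation (I j) = (\<integral>x. x \<partial>distr M borel (I j))" by (subst integral_distr) auto
    also have "distr M borel (I j) = distr M borel (\<lambda>\<omega>. G (\<lambda>i\<in>{..<N}. B i \<omega>))"
      unfolding I_def by (rule distr_block[OF B same Gm])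
    also have "(\<integral>x. x \<partial>\<dots>) = expectation (\<lambda>\<omega>. G (\<lambda>i\<in>{..<N}. B i \<omega>))" by (subst integral_distr) auto
    also have "\<dots> = expectation (indicator {\<omega>\<in>space M. c < (\<Sum>i<N. B i \<omega>)})"
      by (intro Bochner_Integration.integral_cong) (auto simp: G_def indicator_def)
    finally show ?thesis by simp
  qed
  have "prob {\<omega>\<in>space M. \<forall>j<p. c < (\<Sum>i<N. B (a + j * N + i) \<omega>)}
      = expectation (indicator {\<omega>\<in>space M. \<forall>j<p. c < (\<Sum>i<N. B (a + j * N + i) \<omega>)})"
    by simp
  also have "\<dots> = expectation (\<lambda>\<omega>. \<Prod>j\<in>{..<p}. I j \<omega>)"
  proof (intro Bochner_Integration.integral_cong refl)
    fix \<omega> assume w: "\<omega> \<in> space M"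
    show "indicator {\<omega>\<in>space M. \<forall>j<p. c < (\<Sum>i<N. B (a + j * N + i) \<omega>)} \<omega> = (\<Prod>j\<in>{..<p}. I j \<omega>)"
    proof (cases "\<forall>j<p. c < (\<Sum>i<N. B (a + j * N + i) \<omega>)")
      case True
      then have "(\<Prod>j\<in>{..<p}. I j \<omega>) = 1" by (intro prod.neutral) (auto simp: Ieq)
      then show ?thesis using True w by simp
    next
      case False
      then obtain j where "j < p" "I j \<omega> = 0" by (auto simp: Ieq)
      then have "\<exists>j\<in>{..<p}. I j \<omega> = 0" by blast
      then have "(\<Prod>j\<in>{..<p}. I j \<omega>) = 0" by (simp add: prod_zero_iff)
      then show ?thesis using False by (auto simp: indicator_def)
    qed
  qed
  also have "\<dots> = (\<Prod>j\<in>{..<p}. expectation (I j))"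
    by (rule indep_vars_lebesgue_integral[OF _ indep_vars_subset[OF indI] intI]) auto
  finally show ?thesis by (simp add: EI)
qed

text \<open>
The moderate deviation that is needed follows from the central limit theorem alone. The
stretch from \<open>K ^ k\<close> to \<open>K ^ (k + 1)\<close> is cut into \<open>p\<close> blocks with \<open>p\<close> of order \<open>ln k\<close>; if each block
sum exceeds \<open>y\<close> standard deviations, a fixed level, then the whole increment exceeds
\<open>y * sqrt p\<close> standard deviations, which is at least \<open>\<beta> * sqrt (2 * ln k)\<close>. The probability is at least
\<open>exp (- p (y + 1)\<^sup>2 / 2 - 2 p)\<close>, a power \<open>k powr - \<gamma>\<close> with \<open>\<gamma>\<close> close to \<open>\<beta>\<^sup>2\<close> for large \<open>y\<close>, so the
series diverges as soon as \<open>\<beta> < 1\<close>.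
\<close>

lemma iid_increments_lower:
  fixes B :: "nat \<Rightarrow> 'a \<Rightarrow> real" and \<beta> :: real and K :: nat
  assumes B: "indep_vars (\<lambda>_. borel) B UNIV"
    and same: "\<And>n. distr M borel (B n) = distr M borel (B 0)"
    and m0: "\<And>n. expectation (B n) = 0" and i2: "\<And>n. integrable M (\<lambda>\<omega>. (B n \<omega>)\<^sup>2)"
    and v: "\<And>n. expectation (\<lambda>\<omega>. (B n \<omega>)\<^sup>2) = v" "0 < v"
    and \<beta>: "0 < \<beta>" "\<beta> < 1" and K: "2 \<le> K"
  shows "AE \<omega> in M. \<exists>\<^sub>F k in sequentially. \<exists>m. (K - 2) * K ^ k \<le> m \<and> m \<le> (K - 1) * K ^ k \<and>
     \<beta> * sqrt (2 * v * real m * ln (real k)) \<le> (\<Sum>i<K ^ k + m. B i \<omega>) - (\<Sum>i<K ^ k. B i \<omega>)"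
proof -
  have [measurable]: "B n \<in> borel_measurable M" for n using B by (auto simp: indep_vars_def)
  (* The exponent of k in the probability of a large increment tends to beta^2 < 1 as y grows. *)
  have "((\<lambda>y::real. 2 * \<beta>\<^sup>2 / y\<^sup>2 * ((y + 1)\<^sup>2 / 2 + 2)) \<longlongrightarrow> \<beta>\<^sup>2) at_top"
    by real_asymp
  moreover have "\<beta>\<^sup>2 < 1" using \<beta> by (simp add: power_less_one_iff)
  ultimately have "\<forall>\<^sub>F y in at_top. 2 * \<beta>\<^sup>2 / y\<^sup>2 * ((y + 1)\<^sup>2 / 2 + 2) < 1" by (rule order_tendstoD)
  then have "\<forall>\<^sub>F y in at_top. 0 < y \<and> 2 * \<beta>\<^sup>2 / y\<^sup>2 * ((y + 1)\<^sup>2 / 2 + 2) < 1"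
    using eventually_gt_at_top[of "0::real"] by eventually_elim auto
  then obtain y :: real where y: "0 < y" and yg: "2 * \<beta>\<^sup>2 / y\<^sup>2 * ((y + 1)\<^sup>2 / 2 + 2) < 1"
    by (auto simp: eventually_at_top_linorder)
  define L where "L = (y + 1)\<^sup>2 / 2 + 2"
  define g where "g = 2 * \<beta>\<^sup>2 / y\<^sup>2"
  have g: "0 < g" "g * L < 1" using y \<beta> yg by (auto simp: g_def L_def)
  have L: "0 < L" by (simp add: L_def add_nonneg_pos)
  define p where "p k = nat \<lceil>g * ln (real k)\<rceil>" for k
  define N where "N k = ((K - 1) * K ^ k) div p k" for k
  define c where "c k = y * sqrt (real (N k) * v)" for k
  define f where "f k h = (if \<forall>j\<in>{..<p k}. c k < (\<Sum>i<N k. h (j * N k + i)) then 1 else 0 :: real)" for k and h :: "nat \<Rightarrow> real"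
  (* T k is the indicator of the event that all p k blocks in the k-th stretch are large. *)
  define T where "T k \<omega> = f k (\<lambda>i\<in>{..<(K - 1) * K ^ k}. B (K ^ k + i) \<omega>)" for k \<omega>
  have pN: "p k * N k \<le> (K - 1) * K ^ k" for k unfolding N_def by simp
  have idx: "j * N k + i < (K - 1) * K ^ k" if "j < p k" "i < N k" for j i k
  proof -
    have "j * N k + i < Suc j * N k" using that by simp
    also have "\<dots> \<le> p k * N k" using that by (intro mult_right_mono) auto
    finally show ?thesis using pN[of k] by simp
  qed
  have fm: "f k \<in> borel_measurable (PiM {..<(K - 1) * K ^ k} (\<lambda>_. borel))" for k
  proof -
    define P where "P = PiM {..<(K - 1) * K ^ k} (\<lambda>_. borel :: real measure)"
    have "Measurable.pred P (\<lambda>h. \<forall>j\<in>{..<p k}. c k < (\<Sum>i<N k. h (j * N k + i)))"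
    proof (intro pred_intros_finite)
      fix j assume "j \<in> {..<p k}"
      then have "(\<lambda>h. \<Sum>i<N k. h (j * N k + i)) \<in> borel_measurable P"
        unfolding P_def using idx by (intro borel_measurable_sum measurable_component_singleton) auto
      then show "Measurable.pred P (\<lambda>h. c k < (\<Sum>i<N k. h (j * N k + i)))" by measurable
    qed simp
    then have "f k \<in> borel_measurable P" unfolding f_def
      by (intro measurable_If measurable_const) (auto simp: pred_def)
    then show ?thesis by (simp add: P_def)
  qed
  have Tind: "indep_vars (\<lambda>_. borel) T UNIV"
    unfolding T_def
  proof (rule indep_vars_blocks[OF B _ fm])
    fix k show "K ^ k + (K - 1) * K ^ k \<le> K ^ Suc k" using K by (cases K) auto
  qed
  have T0: "0 < T k \<omega> \<longleftrightarrow> (\<forall>j<p k. c k < (\<Sum>i<N k. B (K ^ k + j * N k + i) \<omega>))" for k \<omega>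
  proof -
    have "(\<Sum>i<N k. (\<lambda>i\<in>{..<(K - 1) * K ^ k}. B (K ^ k + i) \<omega>) (j * N k + i)) = (\<Sum>i<N k. B (K ^ k + j * N k + i) \<omega>)"
      if "j < p k" for j
      using idx that by (intro sum.cong) (auto simp: add.assoc)
    then show ?thesis unfolding T_def f_def by auto
  qed
  have pk: "0 < p k" "g * ln (real k) \<le> real (p k)" "real (p k) \<le> g * ln (real k) + 1" if "2 \<le> k" for k
  proof -
    have "0 < g * ln (real k)" using g that by simp
    then show "0 < p k" "g * ln (real k) \<le> real (p k)" "real (p k) \<le> g * ln (real k) + 1"
      unfolding p_def by linarith+
  qed
  have Ninf: "\<forall>\<^sub>F k in sequentially. N0 \<le> N k" for N0
  proof -
    have "filterlim (\<lambda>k. 2 ^ k / (g * ln (real k) + 1)) at_top sequentially" using g by real_asymp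
    then have "\<forall>\<^sub>F k in sequentially. real N0 + 1 \<le> 2 ^ k / (g * ln (real k) + 1)" by (simp add: filterlim_at_top)
    then show ?thesis using eventually_ge_at_top[of 2]
    proof eventually_elim
      case (elim k)
      note p = pk[OF elim(2)]
      have "real N0 * real (p k) \<le> (real N0 + 1) * (g * ln (real k) + 1)"
        using p by (intro mult_mono) auto
      also have "\<dots> \<le> 2 ^ k" using elim p by (simp add: pos_le_divide_eq)
      also have "2 ^ k \<le> real ((K - 1) * K ^ k)"
      proof -
        have "(2::nat) ^ k \<le> K ^ k" using K by (intro power_mono) auto
        also have "\<dots> \<le> (K - 1) * K ^ k" using K by simp
        finally have "real (2 ^ k) \<le> real ((K - 1) * K ^ k)" by (simp only: of_nat_le_iff)
        then show ?thesis by simp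
      qed
      finally have "N0 * p k \<le> (K - 1) * K ^ k" by (simp only: of_nat_mult[symmetric] of_nat_le_iff)
      then show ?case unfolding N_def using p by (simp add: less_eq_div_iff_mult_less_eq)
    qed
  qed
  have prob_lower: "\<forall>\<^sub>F k in sequentially. exp (- L) * real k powr - (g * L) \<le> prob {\<omega>\<in>space M. 0 < T k \<omega>}"
  proof -
    from clt_tail_lower[OF B same m0 i2 v y] obtain N0 where
      N0: "\<And>n. n \<ge> N0 \<Longrightarrow> exp (- L) < prob {\<omega>\<in>space M. y * sqrt (real n * v) < (\<Sum>i<n. B i \<omega>)}"
      by (auto simp: eventually_sequentially L_def)
    from Ninf[of N0] eventually_ge_at_top[of 2] show ?thesis
    proof eventually_elim
      case (elim k)
      note p = pk[OF elim(2)]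
      have "exp (- L) * real k powr - (g * L) = exp (- L * (g * ln (real k) + 1))"
        using elim by (simp add: powr_def exp_add[symmetric] algebra_simps)
      also have "\<dots> \<le> exp (- L * real (p k))" using p L by simp
      also have "\<dots> = exp (- L) ^ p k" by (simp add: exp_of_nat_mult[symmetric] mult.commute)
      also have "\<dots> \<le> prob {\<omega>\<in>space M. c k < (\<Sum>i<N k. B i \<omega>)} ^ p k"
        using N0[OF elim(1)] unfolding c_def by (intro power_mono) auto
      also have "\<dots> = prob {\<omega>\<in>space M. 0 < T k \<omega>}"
        unfolding T0 by (rule prob_all_blocks[OF B same, symmetric])
      finally show ?case .
    qed
  qed
  have "\<not> summable (\<lambda>k. prob {\<omega>\<in>space M. 0 < T k \<omega>})"
  proof
    assume "summable (\<lambda>k. prob {\<omega>\<in>space M. 0 < T k \<omega>})"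
    then have "summable (\<lambda>k. exp (- L) * real k powr - (g * L))"
      by (rule summable_comparison_test_ev[rotated]) (use prob_lower in \<open>auto elim!: eventually_mono\<close>)
    then have "summable (\<lambda>k. real k powr - (g * L))" by (simp add: summable_cmult_iff)
    then show False using g by (simp add: summable_real_powr_iff)
  qed
  from AE_frequently_of_indep[OF Tind this] show ?thesis
  proof (rule AE_mp, intro AE_I2 impI)
    fix \<omega> assume fr: "\<exists>\<^sub>F k in sequentially. 0 < T k \<omega>"
    have "\<forall>\<^sub>F k in sequentially. g * ln (real k) + 1 \<le> 2 ^ k" using g by real_asymp
    then have ev: "\<forall>\<^sub>F k in sequentially. 2 \<le> k \<and> g * ln (real k) + 1 \<le> 2 ^ k"
      using eventually_ge_at_top[of 2] by eventually_elim auto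
    from frequently_eventually_frequently[OF fr ev]
    show "\<exists>\<^sub>F k in sequentially. \<exists>m. (K - 2) * K ^ k \<le> m \<and> m \<le> (K - 1) * K ^ k \<and>
       \<beta> * sqrt (2 * v * real m * ln (real k)) \<le> (\<Sum>i<K ^ k + m. B i \<omega>) - (\<Sum>i<K ^ k. B i \<omega>)"
    proof (rule frequently_elim1)
      fix k assume asm: "0 < T k \<omega> \<and> 2 \<le> k \<and> g * ln (real k) + 1 \<le> 2 ^ k"
      then have k: "2 \<le> k" by auto
      note p = pk[OF k]
      define m where "m = p k * N k"
      have "real (p k) \<le> 2 ^ k" using p asm by linarith
      then have "p k \<le> 2 ^ k" using of_nat_le_iff[of "p k" "2 ^ k", where 'a = real] by simp
      also have "\<dots> \<le> K ^ k" using K by (intro power_mono) auto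
      finally have pK: "p k \<le> K ^ k" .
      have "(K - 1) * K ^ k = m + ((K - 1) * K ^ k) mod p k"
        unfolding m_def N_def by (simp add: mult_div_mod_eq)
      moreover have "((K - 1) * K ^ k) mod p k < p k" using p by simp
      moreover have "(K - 1) * K ^ k = (K - 2) * K ^ k + K ^ k"
      proof -
        have "K - 1 = (K - 2) + 1" using K by simp
        then show ?thesis by (simp only: add_mult_distrib mult_1)
      qed
      ultimately have m1: "(K - 2) * K ^ k \<le> m" using pK by linarith
      have sums: "(\<Sum>i<K ^ k + m. B i \<omega>) - (\<Sum>i<K ^ k. B i \<omega>) = (\<Sum>j<p k. \<Sum>i<N k. B (K ^ k + j * N k + i) \<omega>)"
      proof -
        have "(\<Sum>i<K ^ k + m. B i \<omega>) = (\<Sum>i<K ^ k. B i \<omega>) + (\<Sum>i\<in>{K ^ k..<K ^ k + m}. B i \<omega>)"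
          by (simp add: lessThan_atLeast0 sum.atLeastLessThan_concat)
        also have "(\<Sum>i\<in>{K ^ k..<K ^ k + m}. B i \<omega>) = (\<Sum>i<p k * N k. B (K ^ k + i) \<omega>)"
          using sum.shift_bounds_nat_ivl[of "\<lambda>i. B i \<omega>" 0 "K ^ k" m]
          by (simp add: m_def lessThan_atLeast0 add.commute)
        also have "\<dots> = (\<Sum>j<p k. \<Sum>i\<in>{j * N k..<j * N k + N k}. B (K ^ k + i) \<omega>)"
          by (rule sum.nat_group[symmetric])
        also have "\<dots> = (\<Sum>j<p k. \<Sum>i<N k. B (K ^ k + j * N k + i) \<omega>)"
        proof (rule sum.cong[OF refl])
          fix j
          show "(\<Sum>i\<in>{j * N k..<j * N k + N k}. B (K ^ k + i) \<omega>) = (\<Sum>i<N k. B (K ^ k + j * N k + i) \<omega>)"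
            using sum.shift_bounds_nat_ivl[of "\<lambda>i. B (K ^ k + i) \<omega>" 0 "j * N k" "N k"]
            by (simp add: lessThan_atLeast0 ac_simps)
        qed
        finally show ?thesis by simp
      qed
      have "real (p k) * c k \<le> (\<Sum>j<p k. \<Sum>i<N k. B (K ^ k + j * N k + i) \<omega>)"
        using asm sum_mono[of "{..<p k}" "\<lambda>_. c k" "\<lambda>j. \<Sum>i<N k. B (K ^ k + j * N k + i) \<omega>"]
        unfolding T0 by (simp add: less_imp_le)
      moreover have "\<beta> * sqrt (2 * v * real m * ln (real k)) \<le> real (p k) * c k"
      proof -
        have lnk: "0 < ln (real k)" using k by simp
        have "(\<beta> * sqrt (2 * v * real m * ln (real k)))\<^sup>2 = y\<^sup>2 * (g * ln (real k)) * (v * real m)"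
          using v lnk y unfolding power_mult_distrib by (simp add: g_def field_simps)
        also have "\<dots> \<le> y\<^sup>2 * real (p k) * (v * real m)"
          using p v g lnk by (intro mult_mono mult_nonneg_nonneg) (auto intro: less_imp_le)
        also have "\<dots> = (real (p k) * c k)\<^sup>2"
          using v unfolding c_def m_def power_mult_distrib by (simp add: power2_eq_square)
        finally show ?thesis
          by (rule power2_le_imp_le) (use y v in \<open>simp add: c_def\<close>)
      qed
      ultimately show "\<exists>m. (K - 2) * K ^ k \<le> m \<and> m \<le> (K - 1) * K ^ k \<and>
         \<beta> * sqrt (2 * v * real m * ln (real k)) \<le> (\<Sum>i<K ^ k + m. B i \<omega>) - (\<Sum>i<K ^ k. B i \<omega>)"
        using m1 pN[of k, folded m_def] sums by (intro exI[of _ m]) simp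
    qed
  qed
qed

text \<open>
A large increment over \<open>K ^ k \<le> n \<le> K ^ (k + 1)\<close> starts from a partial sum that is smaller by the
factor \<open>1 / sqrt (K - 1)\<close>, thanks to any a priori bound of the order of the iterated logarithm;
letting \<open>K\<close> grow makes the loss negligible.
\<close>

lemma iid_lil_lower:
  fixes B :: "nat \<Rightarrow> 'a \<Rightarrow> real" and b C :: real
  assumes B: "indep_vars (\<lambda>_. borel) B UNIV"
    and same: "\<And>n. distr M borel (B n) = distr M borel (B 0)"
    and m0: "\<And>n. expectation (B n) = 0" and i2: "\<And>n. integrable M (\<lambda>\<omega>. (B n \<omega>)\<^sup>2)"
    and v: "\<And>n. expectation (\<lambda>\<omega>. (B n \<omega>)\<^sup>2) = v" "0 < v"
    and C: "0 \<le> C" "AE \<omega> in M. \<forall>\<^sub>F n in sequentially. \<bar>\<Sum>i<n. B i \<omega>\<bar> \<le> C * sqrt (real n * ln (ln (real n)))"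
    and b: "0 < b" "b < 1"
  shows "AE \<omega> in M. \<exists>\<^sub>F n in sequentially. b * sqrt (2 * v) * sqrt (real n * ln (ln (real n))) \<le> (\<Sum>i<n. B i \<omega>)"
proof -
  (* First K, then k is chosen large, each time consuming part of the gap between b and 1. *)
  define \<beta> where "\<beta> = (1 + b) / 2"
  have \<beta>: "0 < \<beta>" "\<beta> < 1" "b < \<beta>" using b by (auto simp: \<beta>_def)
  have "(\<lambda>K. \<beta> * sqrt (2 * v) * sqrt ((real K - 2) / (real K - 1)) - C * sqrt (1 / (real K - 1))) \<longlonglongrightarrow> \<beta> * sqrt (2 * v) * sqrt 1 - C * sqrt 0"
    by (intro tendsto_intros; real_asymp)
  moreover have "b * sqrt (2 * v) < \<beta> * sqrt (2 * v) * sqrt 1 - C * sqrt 0" using \<beta> v by simp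
  ultimately have "\<forall>\<^sub>F K in sequentially. b * sqrt (2 * v) < \<beta> * sqrt (2 * v) * sqrt ((real K - 2) / (real K - 1)) - C * sqrt (1 / (real K - 1))"
    by (rule order_tendstoD)
  then have "\<forall>\<^sub>F K in sequentially. 3 \<le> K \<and> b * sqrt (2 * v) < \<beta> * sqrt (2 * v) * sqrt ((real K - 2) / (real K - 1)) - C * sqrt (1 / (real K - 1))"
    using eventually_ge_at_top[of 3] by eventually_elim auto
  then obtain K :: nat where K: "3 \<le> K"
    and Kb: "b * sqrt (2 * v) < \<beta> * sqrt (2 * v) * sqrt ((real K - 2) / (real K - 1)) - C * sqrt (1 / (real K - 1))"
    by (auto simp: eventually_sequentially)
  define r where "r k = ln (real k) / ln ((real k + 1) * ln (real K))" for k :: nat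
  have lK: "1 < ln (real K)"
  proof -
    have "exp 1 < (3::real)" using e_less_272 by simp
    then have "ln (exp 1) < ln (3::real)" by (subst ln_less_cancel_iff) auto
    also have "\<dots> \<le> ln (real K)" using K by simp
    finally show ?thesis by simp
  qed
  have r1: "r \<longlonglongrightarrow> 1" unfolding r_def using lK by real_asymp
  have "(\<lambda>k. \<beta> * sqrt (2 * v) * sqrt ((real K - 2) / (real K - 1)) * sqrt (r k) - C * sqrt (1 / (real K - 1)))
     \<longlonglongrightarrow> \<beta> * sqrt (2 * v) * sqrt ((real K - 2) / (real K - 1)) * sqrt 1 - C * sqrt (1 / (real K - 1))"
    by (intro tendsto_intros r1)
  then have evr: "\<forall>\<^sub>F k in sequentially. b * sqrt (2 * v) < \<beta> * sqrt (2 * v) * sqrt ((real K - 2) / (real K - 1)) * sqrt (r k) - C * sqrt (1 / (real K - 1))"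
    by (rule order_tendstoD) (use Kb in simp)
  have "2 \<le> K" using K by simp
  from iid_increments_lower[OF B same m0 i2 v \<beta>(1,2) this] C(2) show ?thesis
  proof eventually_elim
    case (elim \<omega>)
    define S where "S n = (\<Sum>i<n. B i \<omega>)" for n
    have gr: "k < K ^ k" for k using K by (intro less_exp[THEN less_le_trans] power_mono) auto
    have "filterlim (\<lambda>k. K ^ k) at_top sequentially"
      by (rule filterlim_at_top_mono[OF filterlim_ident]) (intro always_eventually allI less_imp_le gr)
    then have evS: "\<forall>\<^sub>F k in sequentially. \<bar>S (K ^ k)\<bar> \<le> C * sqrt (real (K ^ k) * ln (ln (real (K ^ k))))"
      using elim(2) unfolding S_def filterlim_iff by blast
    have ev3: "\<forall>\<^sub>F k in sequentially. 1 < ln (real k)" by real_asymp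
    have ev: "\<forall>\<^sub>F k in sequentially. N \<le> k \<and> \<bar>S (K ^ k)\<bar> \<le> C * sqrt (real (K ^ k) * ln (ln (real (K ^ k))))
       \<and> 1 < ln (real k) \<and> b * sqrt (2 * v) < \<beta> * sqrt (2 * v) * sqrt ((real K - 2) / (real K - 1)) * sqrt (r k) - C * sqrt (1 / (real K - 1))" for N
      using evS ev3 evr eventually_ge_at_top[of N] by eventually_elim auto
    show ?case unfolding frequently_sequentially
    proof
      fix N
      from frequently_eventually_frequently[OF elim(1) ev[of N]]
      obtain k m where m: "(K - 2) * K ^ k \<le> m" "m \<le> (K - 1) * K ^ k"
        and inc: "\<beta> * sqrt (2 * v * real m * ln (real k)) \<le> S (K ^ k + m) - S (K ^ k)"
        and k: "N \<le> k" "\<bar>S (K ^ k)\<bar> \<le> C * sqrt (real (K ^ k) * ln (ln (real (K ^ k))))" "1 < ln (real k)"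
        and kb: "b * sqrt (2 * v) < \<beta> * sqrt (2 * v) * sqrt ((real K - 2) / (real K - 1)) * sqrt (r k) - C * sqrt (1 / (real K - 1))"
        unfolding S_def by (auto dest!: frequently_ex)
      define n where "n = K ^ k + m"
      define l where "l = ln (ln (real n))"
      have k0: "1 \<le> real k" using k(3) by (cases "k = 0") auto
      have "real k \<le> real (K ^ k)" using gr[of k] by (simp only: of_nat_le_iff less_imp_le)
      then have lnKk: "1 < ln (real (K ^ k))" using k(3) k0 ln_mono[of "real k" "real (K ^ k)"] by linarith
      have Kn: "real (K ^ k) \<le> real n" unfolding n_def by simp
      have K0: "0 < real (K ^ k)" using K by simp
      have n0: "0 < real n" using Kn K0 by linarith
      have lnn: "ln (real (K ^ k)) \<le> ln (real n)" by (subst ln_le_cancel_iff[OF K0 n0]) (rule Kn)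
      have l1: "ln (ln (real (K ^ k))) \<le> l" unfolding l_def using lnn lnKk by simp
      have l0: "0 < ln (ln (real (K ^ k)))" using lnKk by simp
      have "n \<le> K ^ Suc k" unfolding n_def using m(2) K by (cases K) auto
      then have "real n \<le> real (K ^ Suc k)" by (simp only: of_nat_le_iff)
      then have "ln (real n) \<le> ln (real (K ^ Suc k))" using n0 K by (subst ln_le_cancel_iff) auto
      also have "\<dots> = (real k + 1) * ln (real K)" using K by (subst of_nat_power, subst ln_realpow) (auto simp: algebra_simps)
      finally have "l \<le> ln ((real k + 1) * ln (real K))" unfolding l_def using lnn lnKk by (subst ln_le_cancel_iff) auto
      moreover have "0 < ln ((real k + 1) * ln (real K))"
      proof -
        have "1 * 1 < (real k + 1) * ln (real K)" using lK k0 by (intro mult_strict_mono) auto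
        then show ?thesis by simp
      qed
      ultimately have rl: "r k * l \<le> ln (real k)" unfolding r_def using k(3) by (simp add: divide_le_eq)
      have r0: "0 \<le> r k" unfolding r_def using k(3) \<open>0 < ln ((real k + 1) * ln (real K))\<close> by simp
      have mr: "(real K - 2) * real (K ^ k) \<le> real m"
      proof -
        have "real ((K - 2) * K ^ k) \<le> real m" using m(1) by (simp only: of_nat_le_iff)
        then show ?thesis using K by (simp add: of_nat_diff)
      qed
      have mn: "(real K - 2) / (real K - 1) * real n \<le> real m"
        using mr K unfolding n_def by (simp add: field_simps)
      have Kkn: "real (K ^ k) \<le> 1 / (real K - 1) * real n"
        using mr K unfolding n_def by (simp add: field_simps)
      have "b * sqrt (2 * v) * sqrt (real n * l) \<le> (\<beta> * sqrt (2 * v) * sqrt ((real K - 2) / (real K - 1)) * sqrt (r k) - C * sqrt (1 / (real K - 1))) * sqrt (real n * l)"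
        using kb l0 l1 by (intro mult_right_mono) auto
      also have "\<dots> = \<beta> * sqrt (2 * v * ((real K - 2) / (real K - 1) * real n) * (r k * l)) - C * sqrt (1 / (real K - 1) * real n * l)"
        unfolding real_sqrt_mult by (simp only: left_diff_distrib right_diff_distrib mult_ac)
      also have "\<dots> \<le> \<beta> * sqrt (2 * v * real m * ln (real k)) - C * sqrt (real (K ^ k) * ln (ln (real (K ^ k))))"
      proof (intro diff_mono mult_left_mono real_sqrt_le_mono)
        show "2 * v * ((real K - 2) / (real K - 1) * real n) * (r k * l) \<le> 2 * v * real m * ln (real k)"
          using mn rl v r0 l0 l1 K by (intro mult_mono mult_nonneg_nonneg) auto
        show "real (K ^ k) * ln (ln (real (K ^ k))) \<le> 1 / (real K - 1) * real n * l"
          using Kkn l0 l1 K by (intro mult_mono) auto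
      qed (use \<beta> C in auto)
      also have "\<dots> \<le> S n" using inc k(2) unfolding n_def by linarith
      finally have "b * sqrt (2 * v) * sqrt (real n * ln (ln (real n))) \<le> (\<Sum>i<n. B i \<omega>)" by (simp add: l_def S_def)
      moreover have "N \<le> n" using k(1) gr[of k] by (simp add: n_def)
      ultimately show "\<exists>n\<ge>N. b * sqrt (2 * v) * sqrt (real n * ln (ln (real n))) \<le> (\<Sum>i<n. B i \<omega>)" by blast
    qed
  qed
qed

end

section \<open>Linear processes\<close>

lemma sum_geometric_le:
  fixes r :: real
  assumes "0 \<le> r" "r < 1" "finite A" "inj_on f A"
  shows "(\<Sum>i\<in>A. r ^ f i) \<le> 1 / (1 - r)"
proof -
  have "(\<Sum>i\<in>A. r ^ f i) = (\<Sum>j\<in>f ` A. r ^ j)" using assms by (simp add: sum.reindex)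
  also have "\<dots> \<le> (\<Sum>j. r ^ j)"
    using assms by (intro sum_le_suminf summable_geometric) auto
  also have "\<dots> = 1 / (1 - r)" using assms by (intro suminf_geometric) auto
  finally show ?thesis .
qed

text \<open>
The index set may be a proper part of \<open>{..<k}\<close>: it is applied to whole linear processes and to
the part of them that remembers the time before a restart.
\<close>

lemma geometric_coefficient_sum:
  fixes g :: "nat \<Rightarrow> real" and C r :: real
  assumes g: "\<And>j. \<bar>g j\<bar> \<le> C * r ^ j" and r: "0 \<le> r" "r < 1" and A: "A \<subseteq> {..<k}"
  shows "(\<Sum>i\<in>A. \<bar>g (k - Suc i)\<bar>) \<le> C / (1 - r)"
proof -
  have fin: "finite A" using A finite_subset by blast
  have C: "0 \<le> C" using g[of 0] by simp
  have "(\<Sum>i\<in>A. \<bar>g (k - Suc i)\<bar>) \<le> C * (\<Sum>i\<in>A. r ^ (k - Suc i))"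
    unfolding sum_distrib_left by (intro sum_mono g)
  also have "\<dots> \<le> C * (1 / (1 - r))"
  proof (intro mult_left_mono sum_geometric_le)
    show "inj_on (\<lambda>i. k - Suc i) A"
    proof (rule inj_onI)
      fix x y assume "x \<in> A" "y \<in> A" "k - Suc x = k - Suc y"
      moreover from this A have "x < k" "y < k" by auto
      ultimately show "x = y" by linarith
    qed
  qed (use r fin C in auto)
  finally show ?thesis by simp
qed

text \<open>
Each period contributes at most \<open>1 / (1 - r)\<close>, so the mean weight is of order \<open>1 / L\<close>.
\<close>

lemma sum_periodic_weights_le:
  fixes r :: real
  assumes r: "0 \<le> r" "r < 1" and L: "0 < L"
  shows "(\<Sum>i<n. r ^ (L - Suc (i mod L))) \<le> (real n / real L + 1) / (1 - r)"
proof -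
  have "(\<Sum>i<n. r ^ (L - Suc (i mod L))) \<le> (\<Sum>i<Suc (n div L) * L. r ^ (L - Suc (i mod L)))"
  proof (rule sum_mono2)
    have "n < Suc (n div L) * L" using L by (metis dividend_less_div_times mult_Suc add.commute)
    then show "{..<n} \<subseteq> {..<Suc (n div L) * L}" by auto
  qed (use r in auto)
  also have "\<dots> = (\<Sum>m<Suc (n div L). \<Sum>i\<in>{m * L..<m * L + L}. r ^ (L - Suc (i mod L)))"
    by (rule sum.nat_group[symmetric])
  also have "\<dots> \<le> (\<Sum>m<Suc (n div L). 1 / (1 - r))"
  proof (rule sum_mono)
    fix m
    show "(\<Sum>i\<in>{m * L..<m * L + L}. r ^ (L - Suc (i mod L))) \<le> 1 / (1 - r)"
    proof (rule sum_geometric_le[OF r])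
      show "inj_on (\<lambda>i. L - Suc (i mod L)) {m * L..<m * L + L}"
      proof (rule inj_onI)
        fix x y assume xy: "x \<in> {m * L..<m * L + L}" "y \<in> {m * L..<m * L + L}" "L - Suc (x mod L) = L - Suc (y mod L)"
        have md: "z mod L = z - m * L" if z: "z \<in> {m * L..<m * L + L}" for z
        proof -
          obtain d where "z = m * L + d" "d < L" using z le_Suc_ex[of "m * L" z] by auto
          then show ?thesis by simp
        qed
        have "x mod L = x - m * L" "y mod L = y - m * L" using xy(1,2) by (auto intro: md)
        moreover have "x mod L < L" "y mod L < L" using L by auto
        ultimately show "x = y" using xy by auto
      qed
    qed simp
  qed
  also have "\<dots> = real (Suc (n div L)) / (1 - r)" by simp
  also have "\<dots> \<le> (real n / real L + 1) / (1 - r)"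
  proof (rule divide_right_mono)
    have "real (L * (n div L)) \<le> real n" by (simp only: of_nat_le_iff times_div_less_eq_dividend)
    then show "real (Suc (n div L)) \<le> real n / real L + 1" using L by (simp add: field_simps)
  qed (use r in simp)
  finally show ?thesis .
qed

context iid_noise begin

lemma mart_moments:
  assumes Y: "adapted Y" and Y2: "\<And>k. integrable M (\<lambda>\<omega>. (Y k \<omega>)\<^sup>2)"
  shows "integrable M (\<lambda>\<omega>. (mart Y n \<omega>)\<^sup>2) \<and> expectation (mart Y n) = 0 \<and>
    expectation (\<lambda>\<omega>. (mart Y n \<omega>)\<^sup>2) = s2 * (\<Sum>k<n. expectation (\<lambda>\<omega>. (Y k \<omega>)\<^sup>2))"
proof (induction n)
  case 0 show ?case by (simp add: mart_def)
next
  case (Suc n)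
  note [measurable] = adapted_measurable[OF Y] measurable_of_past[OF mart_past[OF Y order_refl]]
  have W2: "integrable M (\<lambda>\<omega>. (mart Y n \<omega>)\<^sup>2)" using Suc by simp
  have W1: "integrable M (mart Y n)" by (rule square_integrable_imp_integrable) (use W2 in auto)
  have Y1: "integrable M (Y n)" by (rule square_integrable_imp_integrable) (use Y2 in auto)
  have WY: "integrable M (\<lambda>\<omega>. mart Y n \<omega> * Y n \<omega>)"
    by (rule integrable_mult_of_squares) (use W2 Y2 in auto)
  have i0: "indep_var borel (Y n) borel (U n)" using adaptedD[OF Y order_refl] by (rule indep_var_past)
  have i1: "indep_var borel (\<lambda>\<omega>. mart Y n \<omega> * Y n \<omega>) borel (U n)"
    by (rule indep_var_past) (intro borel_measurable_times mart_past adaptedD Y order_refl)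
  have i2: "indep_var borel (\<lambda>\<omega>. (Y n \<omega>)\<^sup>2) borel (\<lambda>\<omega>. (U n \<omega>)\<^sup>2)"
    using indep_var_compose[OF i0, of "\<lambda>x. x\<^sup>2" borel "\<lambda>x. x\<^sup>2" borel] by (simp add: comp_def)
  note a0 = indep_var_integrable[OF i0 Y1 integrable_U] indep_var_lebesgue_integral[OF i0 Y1 integrable_U]
  note a1 = indep_var_integrable[OF i1 WY integrable_U] indep_var_lebesgue_integral[OF i1 WY integrable_U]
  note a2 = indep_var_integrable[OF i2 Y2 integrable_square] indep_var_lebesgue_integral[OF i2 Y2 integrable_square]
  have S: "mart Y (Suc n) \<omega> = mart Y n \<omega> + Y n \<omega> * U n \<omega>" for \<omega> by (simp add: mart_def)
  have S2: "(mart Y (Suc n) \<omega>)\<^sup>2 = (mart Y n \<omega>)\<^sup>2 + 2 * (mart Y n \<omega> * Y n \<omega> * U n \<omega>) + (Y n \<omega>)\<^sup>2 * (U n \<omega>)\<^sup>2" for \<omega>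
    unfolding S by (simp add: power2_sum power_mult_distrib algebra_simps)
  have "integrable M (\<lambda>\<omega>. (mart Y (Suc n) \<omega>)\<^sup>2)" unfolding S2 using W2 a1 a2 by simp
  moreover have "expectation (\<lambda>\<omega>. mart Y (Suc n) \<omega>) = 0" unfolding S using W1 a0 Suc by (simp add: mean)
  moreover have "expectation (\<lambda>\<omega>. (mart Y (Suc n) \<omega>)\<^sup>2) = s2 * (\<Sum>k<Suc n. expectation (\<lambda>\<omega>. (Y k \<omega>)\<^sup>2))"
    unfolding S2 using W2 a1 a2 Suc by (simp add: mean second algebra_simps)
  ultimately show ?case by simp
qed

text \<open>
The linear process with impulse response \<open>g\<close>, started from rest at time 0.
\<close>

definition lin :: "(nat \<Rightarrow> real) \<Rightarrow> nat \<Rightarrow> 'a \<Rightarrow> real" where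
  "lin g k \<omega> = (\<Sum>i<k. g (k - Suc i) * U i \<omega>)"

lemma adapted_lin_combination:
  assumes "\<And>k. A k \<subseteq> {..<k}"
  shows "adapted (\<lambda>k \<omega>. \<Sum>i\<in>A k. h k i * U i \<omega>)"
  unfolding adapted_def
  using assms by (intro allI borel_measurable_sum borel_measurable_times borel_measurable_const U_past) auto

lemma adapted_lin: "adapted (lin g)"
  unfolding lin_def by (rule adapted_lin_combination) auto

lemma fourth_moment_lin_combination:
  assumes H: "(\<Sum>i\<in>A. \<bar>h i\<bar>) \<le> H"
  shows "integrable M (\<lambda>\<omega>. (\<Sum>i\<in>A. h i * U i \<omega>) ^ 4)"
    and "expectation (\<lambda>\<omega>. (\<Sum>i\<in>A. h i * U i \<omega>) ^ 4) \<le> H ^ 4 * expectation (\<lambda>\<omega>. U 0 \<omega> ^ 4)"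
proof -
  have H0: "0 \<le> H" using H by (rule order_trans[rotated]) (auto intro: sum_nonneg)
  have int: "integrable M (\<lambda>\<omega>. H ^ 3 * (\<Sum>i\<in>A. \<bar>h i\<bar> * U i \<omega> ^ 4))"
    using fourth by simp
  have le: "(\<Sum>i\<in>A. h i * U i \<omega>) ^ 4 \<le> H ^ 3 * (\<Sum>i\<in>A. \<bar>h i\<bar> * U i \<omega> ^ 4)" for \<omega>
    by (rule sum_fourth_power_le[OF H])
  show 1: "integrable M (\<lambda>\<omega>. (\<Sum>i\<in>A. h i * U i \<omega>) ^ 4)"
    by (rule Bochner_Integration.integrable_bound[OF int]) (use le in \<open>auto intro!: order_trans[OF le] AE_I2\<close>)
  have "expectation (\<lambda>\<omega>. (\<Sum>i\<in>A. h i * U i \<omega>) ^ 4) \<le> expectation (\<lambda>\<omega>. H ^ 3 * (\<Sum>i\<in>A. \<bar>h i\<bar> * U i \<omega> ^ 4))"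
    by (intro integral_mono 1 int le)
  also have "\<dots> = H ^ 3 * (\<Sum>i\<in>A. \<bar>h i\<bar> * expectation (\<lambda>\<omega>. U i \<omega> ^ 4))"
    using fourth by simp
  also have "\<dots> = H ^ 3 * ((\<Sum>i\<in>A. \<bar>h i\<bar>) * expectation (\<lambda>\<omega>. U 0 \<omega> ^ 4))"
    unfolding sum_distrib_right
    by (intro arg_cong2[where f = "(*)"] sum.cong refl expectation_U[of "\<lambda>x. x ^ 4"]) simp
  also have "\<dots> \<le> H ^ 3 * (H * expectation (\<lambda>\<omega>. U 0 \<omega> ^ 4))"
    using H H0 by (intro mult_left_mono mult_right_mono) auto
  finally show "expectation (\<lambda>\<omega>. (\<Sum>i\<in>A. h i * U i \<omega>) ^ 4) \<le> H ^ 4 * expectation (\<lambda>\<omega>. U 0 \<omega> ^ 4)"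
    by (simp add: power3_eq_cube power4_eq_xxxx mult.assoc)
qed

text \<open>
Geometric weights transfer the growth bound from the noise to the linear process.
\<close>

lemma lin_fourth_power_sublinear:
  fixes g :: "nat \<Rightarrow> real" and C r :: real
  assumes g: "\<And>j. \<bar>g j\<bar> \<le> C * r ^ j" and r: "0 \<le> r" "r < 1"
    and U4: "(\<lambda>n. U n \<omega> ^ 4 / real n) \<longlonglongrightarrow> 0"
  shows "(\<lambda>n. lin g n \<omega> ^ 4 / real n) \<longlonglongrightarrow> 0"
proof (rule LIMSEQ_I)
  fix e :: real assume e: "0 < e"
  define H where "H = C / (1 - r) + 1"
  have C: "0 \<le> C" using g[of 0] by simp
  have H: "0 < H" using C r by (simp add: H_def add_nonneg_pos)
  define d where "d = e / (2 * H ^ 4)"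
  have d: "0 < d" using e H by (simp add: d_def)
  from order_tendstoD(2)[OF U4 d] obtain N where N: "\<And>n. n \<ge> N \<Longrightarrow> U n \<omega> ^ 4 / real n < d"
    by (auto simp: eventually_sequentially)
  define K where "K = (\<Sum>i\<le>N. U i \<omega> ^ 4)"
  have K0: "0 \<le> K" unfolding K_def by (intro sum_nonneg) auto
  have U: "U i \<omega> ^ 4 \<le> K + d * real n" if "i < n" for i n
  proof (cases "i \<le> N")
    case True
    then have "U i \<omega> ^ 4 \<le> K" unfolding K_def by (intro member_le_sum) auto
    then show ?thesis using d by (simp add: add_increasing2)
  next
    case False
    then have "U i \<omega> ^ 4 \<le> d * real i" using N[of i] by (simp add: divide_less_eq)
    also have "\<dots> \<le> d * real n" using that d by (intro mult_left_mono) auto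
    finally show ?thesis using K0 by simp
  qed
  have bound: "lin g n \<omega> ^ 4 \<le> H ^ 4 * (K + d * real n)" for n
  proof -
    have h: "(\<Sum>i<n. \<bar>g (n - Suc i)\<bar>) \<le> H"
      using geometric_coefficient_sum[of g C r "{..<n}" n] g r by (auto simp: H_def)
    have "lin g n \<omega> ^ 4 \<le> H ^ 3 * (\<Sum>i<n. \<bar>g (n - Suc i)\<bar> * U i \<omega> ^ 4)"
      unfolding lin_def by (rule sum_fourth_power_le[OF h])
    also have "\<dots> \<le> H ^ 3 * (\<Sum>i<n. \<bar>g (n - Suc i)\<bar> * (K + d * real n))"
      using H U by (intro mult_left_mono sum_mono) auto
    also have "\<dots> = H ^ 3 * ((\<Sum>i<n. \<bar>g (n - Suc i)\<bar>) * (K + d * real n))" by (simp add: sum_distrib_right)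
    also have "\<dots> \<le> H ^ 3 * (H * (K + d * real n))" using H h K0 d by (intro mult_left_mono mult_right_mono) auto
    finally show ?thesis by (simp add: power3_eq_cube power4_eq_xxxx mult.assoc)
  qed
  have "(\<lambda>n. H ^ 4 * K / real n) \<longlonglongrightarrow> 0" by real_asymp
  then have "\<forall>\<^sub>F n in sequentially. H ^ 4 * K / real n < e / 2" by (rule order_tendstoD) (use e in simp)
  then have "\<forall>\<^sub>F n in sequentially. norm (lin g n \<omega> ^ 4 / real n - 0) < e"
    using eventually_gt_at_top[of 0]
  proof eventually_elim
    case (elim n)
    have "lin g n \<omega> ^ 4 / real n \<le> H ^ 4 * (K + d * real n) / real n" using bound[of n] by (rule divide_right_mono) simp
    also have "\<dots> = H ^ 4 * K / real n + H ^ 4 * d" using elim by (simp add: field_simps)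
    also have "H ^ 4 * d = e / 2" using H by (simp add: d_def)
    finally have "lin g n \<omega> ^ 4 / real n < e" using elim by linarith
    then show ?case by simp
  qed
  then show "\<exists>no. \<forall>n\<ge>no. norm (lin g n \<omega> ^ 4 / real n - 0) < e" by (simp add: eventually_sequentially)
qed

lemma lin_second_moment:
  shows "integrable M (\<lambda>\<omega>. (lin g k \<omega>)\<^sup>2)" "expectation (\<lambda>\<omega>. (lin g k \<omega>)\<^sup>2) = s2 * (\<Sum>j<k. (g j)\<^sup>2)"
proof -
  define h where "h i \<omega> = g (k - Suc i)" for i :: nat and \<omega> :: 'a
  have h: "adapted h" by (simp add: adapted_def h_def[abs_def])
  have eq: "lin g k \<omega> = mart h k \<omega>" for \<omega> by (simp add: lin_def mart_def h_def mult.commute)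
  have s: "(\<Sum>i<k. (g (k - Suc i))\<^sup>2) = (\<Sum>j<k. (g j)\<^sup>2)"
    by (rule sum.nat_diff_reindex)
  show "integrable M (\<lambda>\<omega>. (lin g k \<omega>)\<^sup>2)" "expectation (\<lambda>\<omega>. (lin g k \<omega>)\<^sup>2) = s2 * (\<Sum>j<k. (g j)\<^sup>2)"
    unfolding eq using mart_moments[OF h, of k] s by (simp_all add: h_def prob_space)
qed

text \<open>
Let the linear process be restarted from rest at every multiple of \<open>L\<close>; \<open>memory\<close> is the
difference from the original process. The restarted process yields independent,
identically distributed block sums, and the memory is small on average when \<open>L\<close> is large,
since it decays geometrically after each restart.
\<close>

definition memory :: "(nat \<Rightarrow> real) \<Rightarrow> nat \<Rightarrow> nat \<Rightarrow> 'a \<Rightarrow> real" where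
  "memory g L k \<omega> = (\<Sum>i<L * (k div L). g (k - Suc i) * U i \<omega>)"

lemma adapted_memory: "adapted (memory g L)"
  unfolding memory_def by (rule adapted_lin_combination) (auto intro: less_le_trans)

text \<open>
Cauchy--Schwarz with geometric weights, then exchanging the sums: the innovation \<open>U i\<close> is
remembered only after the next multiple of \<open>L\<close>, which is \<open>L - i mod L\<close> steps ahead.
\<close>

lemma sum_memory_square_le:
  fixes g :: "nat \<Rightarrow> real" and C r :: real
  assumes g: "\<And>j. \<bar>g j\<bar> \<le> C * r ^ j" and r: "0 \<le> r" "r < 1" and L: "0 < L"
  shows "(\<Sum>k<n. (memory g L k \<omega>)\<^sup>2) \<le> C\<^sup>2 / (1 - r)\<^sup>2 * (\<Sum>i<n. r ^ (L - Suc (i mod L)) * (U i \<omega>)\<^sup>2)"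
proof -
  have C: "0 \<le> C" using g[of 0] by simp
  have one: "(memory g L k \<omega>)\<^sup>2 \<le> C\<^sup>2 / (1 - r) * (\<Sum>i<n. if i < L * (k div L) then r ^ (k - Suc i) * (U i \<omega>)\<^sup>2 else 0)"
    if "k < n" for k
  proof -
    have sub: "{..<L * (k div L)} \<subseteq> {..<k}" by (auto intro: less_le_trans)
    have "\<bar>memory g L k \<omega>\<bar> \<le> (\<Sum>i<L * (k div L). C * r ^ (k - Suc i) * \<bar>U i \<omega>\<bar>)"
      unfolding memory_def using g by (intro order_trans[OF sum_abs] sum_mono) (auto simp: abs_mult intro!: mult_right_mono)
    then have "\<bar>memory g L k \<omega>\<bar>\<^sup>2 \<le> (\<Sum>i<L * (k div L). C * r ^ (k - Suc i) * \<bar>U i \<omega>\<bar>)\<^sup>2"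
      by (intro power_mono) auto
    also have "\<dots> \<le> (\<Sum>i<L * (k div L). C * r ^ (k - Suc i)) * (\<Sum>i<L * (k div L). C * r ^ (k - Suc i) * \<bar>U i \<omega>\<bar>\<^sup>2)"
      using C r by (intro weighted_sum_square_le) auto
    also have "\<dots> \<le> C / (1 - r) * (\<Sum>i<L * (k div L). C * r ^ (k - Suc i) * \<bar>U i \<omega>\<bar>\<^sup>2)"
    proof (rule mult_right_mono)
      have "\<bar>C * r ^ j\<bar> \<le> C * r ^ j" for j using C r by simp
      from geometric_coefficient_sum[OF this r sub]
      show "(\<Sum>i<L * (k div L). C * r ^ (k - Suc i)) \<le> C / (1 - r)" using C r by simp
    qed (use C r in \<open>auto intro!: sum_nonneg\<close>)
    also have "\<dots> = C\<^sup>2 / (1 - r) * (\<Sum>i<L * (k div L). r ^ (k - Suc i) * (U i \<omega>)\<^sup>2)"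
      by (simp add: sum_distrib_left power2_eq_square mult_ac)
    also have "(\<Sum>i<L * (k div L). r ^ (k - Suc i) * (U i \<omega>)\<^sup>2) = (\<Sum>i<n. if i < L * (k div L) then r ^ (k - Suc i) * (U i \<omega>)\<^sup>2 else 0)"
    proof (rule sum.mono_neutral_cong_left)
      show "{..<L * (k div L)} \<subseteq> {..<n}" using sub that by (meson lessThan_subset_iff less_imp_le order_trans)
    qed auto
    finally show ?thesis by simp
  qed
  have "(\<Sum>k<n. (memory g L k \<omega>)\<^sup>2) \<le> (\<Sum>k<n. C\<^sup>2 / (1 - r) * (\<Sum>i<n. if i < L * (k div L) then r ^ (k - Suc i) * (U i \<omega>)\<^sup>2 else 0))"
    by (intro sum_mono one) auto
  also have "\<dots> = C\<^sup>2 / (1 - r) * (\<Sum>i<n. \<Sum>k<n. if i < L * (k div L) then r ^ (k - Suc i) * (U i \<omega>)\<^sup>2 else 0)"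
    unfolding sum_distrib_left[symmetric] by (subst sum.swap) simp
  also have "\<dots> \<le> C\<^sup>2 / (1 - r) * (\<Sum>i<n. 1 / (1 - r) * (r ^ (L - Suc (i mod L)) * (U i \<omega>)\<^sup>2))"
  proof (intro mult_left_mono sum_mono)
    fix i assume "i \<in> {..<n}"
    (* The first restart after time i. *)
    define a where "a = L * (i div L) + L"
    have a: "a - Suc i = L - Suc (i mod L)" "Suc i \<le> a"
    proof -
      have "i = L * (i div L) + i mod L" by simp
      moreover have "i mod L < L" using L by simp
      ultimately show "a - Suc i = L - Suc (i mod L)" "Suc i \<le> a" unfolding a_def by linarith+
    qed
    have "(\<Sum>k<n. if i < L * (k div L) then r ^ (k - Suc i) * (U i \<omega>)\<^sup>2 else 0)
       \<le> (\<Sum>k<n. if a \<le> k then r ^ (k - a) * (r ^ (a - Suc i) * (U i \<omega>)\<^sup>2) else 0)"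
    proof (rule sum_mono)
      fix k
      show "(if i < L * (k div L) then r ^ (k - Suc i) * (U i \<omega>)\<^sup>2 else 0)
        \<le> (if a \<le> k then r ^ (k - a) * (r ^ (a - Suc i) * (U i \<omega>)\<^sup>2) else 0)"
      proof (cases "i < L * (k div L)")
        case True
        then have "i div L < k div L" using L by (simp add: less_mult_imp_div_less mult.commute)
        then have "L * Suc (i div L) \<le> L * (k div L)" by (intro mult_left_mono) auto
        also have "\<dots> \<le> k" by simp
        finally have ak: "a \<le> k" by (simp add: a_def)
        then have "k - Suc i = (k - a) + (a - Suc i)" using a(2) by simp
        then have "r ^ (k - Suc i) = r ^ (k - a) * r ^ (a - Suc i)" by (simp only: power_add)
        then show ?thesis using True ak by (simp add: mult.assoc)
      qed (use r in simp)
    qed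
    also have "\<dots> = (\<Sum>k\<in>{..<n} \<inter> {a..}. r ^ (k - a)) * (r ^ (a - Suc i) * (U i \<omega>)\<^sup>2)"
      by (simp add: sum.If_cases sum_distrib_right atLeast_def)
    also have "\<dots> \<le> 1 / (1 - r) * (r ^ (a - Suc i) * (U i \<omega>)\<^sup>2)"
      using r by (intro mult_right_mono sum_geometric_le) (auto simp: inj_on_def)
    finally show "(\<Sum>k<n. if i < L * (k div L) then r ^ (k - Suc i) * (U i \<omega>)\<^sup>2 else 0)
       \<le> 1 / (1 - r) * (r ^ (L - Suc (i mod L)) * (U i \<omega>)\<^sup>2)" by (simp add: a)
  qed (use C r in auto)
  also have "\<dots> = C\<^sup>2 / (1 - r)\<^sup>2 * (\<Sum>i<n. r ^ (L - Suc (i mod L)) * (U i \<omega>)\<^sup>2)"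
    unfolding sum_distrib_left[symmetric] by (simp add: power2_eq_square)
  finally show ?thesis .
qed

text \<open>
The bracket of the memory term grows at a rate of order \<open>1 / L\<close>, so its contribution to the law
of the iterated logarithm vanishes as \<open>L\<close> tends to infinity.
\<close>

lemma brkt_memory_le:
  fixes g :: "nat \<Rightarrow> real" and C r :: real
  assumes g: "\<And>j. \<bar>g j\<bar> \<le> C * r ^ j" and r: "0 \<le> r" "r < 1" and L: "0 < L"
    and q: "s2\<^sup>2 * C\<^sup>2 / (1 - r) ^ 3 / real L < q"
  shows "AE \<omega> in M. \<forall>\<^sub>F n in sequentially. brkt (memory g L) n \<omega> \<le> q * real n"
proof -
  define w where "w i = r ^ (L - Suc (i mod L))" for i
  (* Deterministic weights are adapted; square roots because the strong law is stated for squares. *)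
  define sw where "sw i = sqrt (w i)" for i
  have w: "0 \<le> w i" "w i \<le> 1" for i using r by (auto simp: w_def power_le_one)
  have adw: "adapted (\<lambda>i \<omega>. sw i)" by (simp add: adapted_def)
  have "AE \<omega> in M. (\<lambda>n. (\<Sum>k<n. (sw k)\<^sup>2 * ((U k \<omega>)\<^sup>2 - s2)) / real n) \<longlonglongrightarrow> 0"
  proof (rule strong_law_squares[OF adw, of 1])
    show "expectation (\<lambda>\<omega>. sw k ^ 4) \<le> 1" for k
    proof -
      have "sw k \<le> 1" "0 \<le> sw k" using w by (auto simp: sw_def)
      then show ?thesis by (simp add: prob_space power_le_one)
    qed
  qed simp
  then have a1: "AE \<omega> in M. (\<lambda>n. (\<Sum>k<n. w k * ((U k \<omega>)\<^sup>2 - s2)) / real n) \<longlonglongrightarrow> 0"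
    using w by (simp add: sw_def)
  have m4: "integrable M (\<lambda>\<omega>. memory g L k \<omega> ^ 4)"
       "expectation (\<lambda>\<omega>. memory g L k \<omega> ^ 4) \<le> (C / (1 - r)) ^ 4 * expectation (\<lambda>\<omega>. U 0 \<omega> ^ 4)" for k
    unfolding memory_def
    by (intro fourth_moment_lin_combination geometric_coefficient_sum[OF g r]; auto intro: less_le_trans)+
  have a2: "AE \<omega> in M. (\<lambda>n. (\<Sum>k<n. (memory g L k \<omega>)\<^sup>2 * ((U k \<omega>)\<^sup>2 - s2)) / real n) \<longlonglongrightarrow> 0"
    by (rule strong_law_squares[OF adapted_memory m4])
  from a1 a2 show ?thesis
  proof eventually_elim
    case (elim \<omega>)
    define c where "c = C\<^sup>2 / (1 - r)\<^sup>2"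
    have c: "0 \<le> c" by (simp add: c_def)
    define P where "P n = (\<Sum>k<n. (memory g L k \<omega>)\<^sup>2 * ((U k \<omega>)\<^sup>2 - s2)) / real n / 3
        + s2 * c * ((\<Sum>k<n. w k * ((U k \<omega>)\<^sup>2 - s2)) / real n + s2 * ((1 / real L + 1 / real n) / (1 - r)))" for n
    have "P \<longlonglongrightarrow> 0 / 3 + s2 * c * (0 + s2 * ((1 / real L + 0) / (1 - r)))"
      unfolding P_def using r by (intro tendsto_intros elim; (real_asymp | simp))
    also have "0 / 3 + s2 * c * (0 + s2 * ((1 / real L + 0) / (1 - r))) = s2\<^sup>2 * C\<^sup>2 / (1 - r) ^ 3 / real L"
      by (simp add: c_def power2_eq_square power3_eq_cube mult_ac)
    finally have "\<forall>\<^sub>F n in sequentially. P n < q" using q by (rule order_tendstoD)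
    then show ?case using eventually_gt_at_top[of 0]
    proof eventually_elim
      case (elim n)
      have "brkt (memory g L) n \<omega> = (\<Sum>k<n. (memory g L k \<omega>)\<^sup>2 * ((U k \<omega>)\<^sup>2 - s2) / 3 + s2 * (memory g L k \<omega>)\<^sup>2)"
        unfolding brkt_def by (intro sum.cong) (auto simp: field_simps)
      also have "\<dots> = (\<Sum>k<n. (memory g L k \<omega>)\<^sup>2 * ((U k \<omega>)\<^sup>2 - s2)) / 3 + s2 * (\<Sum>k<n. (memory g L k \<omega>)\<^sup>2)"
        by (simp add: sum.distrib sum_distrib_left sum_divide_distrib)
      also have "\<dots> \<le> (\<Sum>k<n. (memory g L k \<omega>)\<^sup>2 * ((U k \<omega>)\<^sup>2 - s2)) / 3 + s2 * (c * (\<Sum>i<n. w i * (U i \<omega>)\<^sup>2))"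
        using sum_memory_square_le[OF g r L, where n=n and \<omega>=\<omega>] s2_nonneg unfolding c_def w_def
        by (intro add_left_mono mult_left_mono) auto
      also have "(\<Sum>i<n. w i * (U i \<omega>)\<^sup>2) = (\<Sum>i<n. w i * ((U i \<omega>)\<^sup>2 - s2)) + s2 * (\<Sum>i<n. w i)"
        by (simp add: right_diff_distrib sum_subtractf sum_distrib_left mult.commute)
      also have "(\<Sum>k<n. (memory g L k \<omega>)\<^sup>2 * ((U k \<omega>)\<^sup>2 - s2)) / 3 + s2 * (c * \<dots>)
         \<le> (\<Sum>k<n. (memory g L k \<omega>)\<^sup>2 * ((U k \<omega>)\<^sup>2 - s2)) / 3 + s2 * (c * ((\<Sum>i<n. w i * ((U i \<omega>)\<^sup>2 - s2)) + s2 * ((real n / real L + 1) / (1 - r))))"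
        using sum_periodic_weights_le[OF r L, of n] s2_nonneg c unfolding w_def
        by (intro add_left_mono mult_left_mono) auto
      also have "\<dots> = P n * real n"
        unfolding P_def using elim r L by (simp add: field_simps)
      also have "\<dots> \<le> q * real n" using elim by (intro mult_right_mono) auto
      finally show ?case .
    qed
  qed
qed

definition block_sum :: "(nat \<Rightarrow> real) \<Rightarrow> nat \<Rightarrow> nat \<Rightarrow> 'a \<Rightarrow> real" where
  "block_sum g L b \<omega> = (\<Sum>l<L. U (L * b + l) \<omega> * (\<Sum>i<l. g (l - Suc i) * U (L * b + i) \<omega>))"

lemma mart_lin_blocks:
  "mart (lin g) (L * n) \<omega> = mart (memory g L) (L * n) \<omega> + (\<Sum>b<n. block_sum g L b \<omega>)"
proof -
  have split: "lin g (L * b + l) \<omega> = memory g L (L * b + l) \<omega> + (\<Sum>i<l. g (l - Suc i) * U (L * b + i) \<omega>)"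
    if "l < L" for b l
  proof -
    have d: "(L * b + l) div L = b" using that by simp
    have "lin g (L * b + l) \<omega> = (\<Sum>i<L * b. g (L * b + l - Suc i) * U i \<omega>) + (\<Sum>i\<in>{L * b..<L * b + l}. g (L * b + l - Suc i) * U i \<omega>)"
      unfolding lin_def by (simp add: lessThan_atLeast0 sum.atLeastLessThan_concat)
    also have "(\<Sum>i\<in>{L * b..<L * b + l}. g (L * b + l - Suc i) * U i \<omega>) = (\<Sum>i<l. g (l - Suc i) * U (L * b + i) \<omega>)"
      using sum.shift_bounds_nat_ivl[of "\<lambda>i. g (L * b + l - Suc i) * U i \<omega>" 0 "L * b" l]
      by (simp add: lessThan_atLeast0 add.commute)
    finally show ?thesis unfolding memory_def d .
  qed
  have grp: "mart Y (L * n) \<omega> = (\<Sum>b<n. \<Sum>l<L. U (L * b + l) \<omega> * Y (L * b + l) \<omega>)" for Y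
  proof -
    have "mart Y (L * n) \<omega> = (\<Sum>b<n. \<Sum>k\<in>{b * L..<b * L + L}. U k \<omega> * Y k \<omega>)"
      unfolding mart_def mult.commute[of L n] by (rule sum.nat_group[symmetric])
    also have "\<dots> = (\<Sum>b<n. \<Sum>l<L. U (L * b + l) \<omega> * Y (L * b + l) \<omega>)"
    proof (rule sum.cong[OF refl])
      fix b
      show "(\<Sum>k\<in>{b * L..<b * L + L}. U k \<omega> * Y k \<omega>) = (\<Sum>l<L. U (L * b + l) \<omega> * Y (L * b + l) \<omega>)"
        using sum.shift_bounds_nat_ivl[of "\<lambda>k. U k \<omega> * Y k \<omega>" 0 "b * L" L]
        by (simp add: lessThan_atLeast0 ac_simps)
    qed
    finally show ?thesis .
  qed
  show ?thesis unfolding grp block_sum_def sum.distrib[symmetric]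
    by (intro sum.cong refl) (simp add: split distrib_left)
qed

lemma block_sum_iid:
  fixes g :: "nat \<Rightarrow> real" and L :: nat
  defines B: "B \<equiv> block_sum g L"
  shows "indep_vars (\<lambda>_. borel) B UNIV" "distr M borel (B n) = distr M borel (B 0)"
    "expectation (B n) = 0" "integrable M (\<lambda>\<omega>. (B n \<omega>)\<^sup>2)"
    "expectation (\<lambda>\<omega>. (B n \<omega>)\<^sup>2) = s2\<^sup>2 * (\<Sum>l<L. \<Sum>j<l. (g j)\<^sup>2)"
proof -
  define f where "f h = (\<Sum>l<L. h l * (\<Sum>i<l. g (l - Suc i) * h i))" for h :: "nat \<Rightarrow> real"
  have fm: "f \<in> borel_measurable (PiM {..<L} (\<lambda>_. borel))"
    unfolding f_def
    by (intro borel_measurable_sum borel_measurable_times borel_measurable_const measurable_component_singleton) auto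
  have Bf: "B b \<omega> = f (\<lambda>i\<in>{..<L}. U (L * b + i) \<omega>)" for b \<omega>
    unfolding B block_sum_def f_def by (intro sum.cong arg_cong2[where f="(*)"]) auto
  have Bf': "B b = (\<lambda>\<omega>. f (\<lambda>i\<in>{..<L}. U (L * b + i) \<omega>))" for b using Bf by auto
  show ind: "indep_vars (\<lambda>_. borel) B UNIV"
    unfolding Bf' by (rule indep_vars_blocks[OF indep]) (auto intro: fm)
  have same0: "distr M borel (B b) = distr M borel (\<lambda>\<omega>. f (\<lambda>i\<in>{..<L}. U i \<omega>))" for b
    unfolding Bf' by (rule distr_block[OF indep same_distr fm])
  show same: "distr M borel (B n) = distr M borel (B 0)" for n using same0[of n] same0[of 0] by simp
  have [measurable]: "B b \<in> borel_measurable M" for b using ind by (auto simp: indep_vars_def)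
  have B0: "B 0 \<omega> = mart (lin g) L \<omega>" for \<omega> by (simp add: B block_sum_def mart_def lin_def)
  note mom = mart_moments[OF adapted_lin lin_second_moment(1), of g L]
  have tr: "integrable M (\<lambda>\<omega>. \<phi> (B n \<omega>)) = integrable M (\<lambda>\<omega>. \<phi> (B 0 \<omega>))"
    "expectation (\<lambda>\<omega>. \<phi> (B n \<omega>)) = expectation (\<lambda>\<omega>. \<phi> (B 0 \<omega>))"
    if [measurable]: "\<phi> \<in> borel_measurable borel" for \<phi> :: "real \<Rightarrow> real"
  proof -
    have "integrable M (\<lambda>\<omega>. \<phi> (B b \<omega>)) = integrable (distr M borel (B b)) \<phi>" for b
      by (subst integrable_distr_eq) auto
    then show "integrable M (\<lambda>\<omega>. \<phi> (B n \<omega>)) = integrable M (\<lambda>\<omega>. \<phi> (B 0 \<omega>))" using same by metis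
    have "expectation (\<lambda>\<omega>. \<phi> (B b \<omega>)) = integral\<^sup>L (distr M borel (B b)) \<phi>" for b
      by (subst integral_distr) auto
    then show "expectation (\<lambda>\<omega>. \<phi> (B n \<omega>)) = expectation (\<lambda>\<omega>. \<phi> (B 0 \<omega>))" using same by metis
  qed
  show "expectation (B n) = 0" using tr(2)[of "\<lambda>x. x"] mom by (simp add: B0)
  show "integrable M (\<lambda>\<omega>. (B n \<omega>)\<^sup>2)" using tr(1)[of "\<lambda>x. x\<^sup>2"] mom by (simp add: B0)
  show "expectation (\<lambda>\<omega>. (B n \<omega>)\<^sup>2) = s2\<^sup>2 * (\<Sum>l<L. \<Sum>j<l. (g j)\<^sup>2)"
  proof -
    have "expectation (\<lambda>\<omega>. (B n \<omega>)\<^sup>2) = s2 * (\<Sum>l<L. s2 * (\<Sum>j<l. (g j)\<^sup>2))"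
      using tr(2)[of "\<lambda>x. x\<^sup>2"] mom by (simp add: B0 lin_second_moment)
    then show ?thesis by (simp add: sum_distrib_left[symmetric] power2_eq_square mult.assoc)
  qed
qed

lemma lin_fourth_moment:
  fixes g :: "nat \<Rightarrow> real" and C r :: real
  assumes g: "\<And>j. \<bar>g j\<bar> \<le> C * r ^ j" and r: "0 \<le> r" "r < 1"
  shows "integrable M (\<lambda>\<omega>. lin g k \<omega> ^ 4)"
    "expectation (\<lambda>\<omega>. lin g k \<omega> ^ 4) \<le> (C / (1 - r)) ^ 4 * expectation (\<lambda>\<omega>. U 0 \<omega> ^ 4)"
  unfolding lin_def
  by (rule fourth_moment_lin_combination, rule geometric_coefficient_sum[OF g r], simp)+

lemma noise_times_lin_average:
  fixes g :: "nat \<Rightarrow> real" and C r y :: real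
  assumes g: "\<And>j. \<bar>g j\<bar> \<le> C * r ^ j" and r: "0 \<le> r" "r < 1"
    and avg: "AE \<omega> in M. (\<lambda>n. (\<Sum>k<n. (lin g k \<omega>)\<^sup>2) / real n) \<longlonglongrightarrow> y"
  shows "AE \<omega> in M. (\<lambda>n. (\<Sum>k<n. (U k \<omega> * lin g k \<omega>)\<^sup>2) / real n) \<longlonglongrightarrow> s2 * y"
  using strong_law_squares[OF adapted_lin lin_fourth_moment[OF g r]] avg
proof eventually_elim
  case (elim \<omega>)
  have "(\<Sum>k<n. (U k \<omega> * lin g k \<omega>)\<^sup>2) / real n
     = (\<Sum>k<n. (lin g k \<omega>)\<^sup>2 * ((U k \<omega>)\<^sup>2 - s2)) / real n + s2 * ((\<Sum>k<n. (lin g k \<omega>)\<^sup>2) / real n)" for n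
  proof -
    have "(\<Sum>k<n. (U k \<omega> * lin g k \<omega>)\<^sup>2) = (\<Sum>k<n. (lin g k \<omega>)\<^sup>2 * ((U k \<omega>)\<^sup>2 - s2)) + s2 * (\<Sum>k<n. (lin g k \<omega>)\<^sup>2)"
      unfolding sum_distrib_left sum.distrib[symmetric] by (intro sum.cong) (auto simp: power_mult_distrib algebra_simps)
    then show ?thesis by (simp add: add_divide_distrib)
  qed
  moreover have "(\<lambda>n. (\<Sum>k<n. (lin g k \<omega>)\<^sup>2 * ((U k \<omega>)\<^sup>2 - s2)) / real n + s2 * ((\<Sum>k<n. (lin g k \<omega>)\<^sup>2) / real n)) \<longlonglongrightarrow> 0 + s2 * y"
    by (intro tendsto_intros elim)
  ultimately show ?case by simp
qed

lemma brkt_lin_le: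
  fixes g :: "nat \<Rightarrow> real" and C r y v :: real
  assumes g: "\<And>j. \<bar>g j\<bar> \<le> C * r ^ j" and r: "0 \<le> r" "r < 1"
    and avg: "AE \<omega> in M. (\<lambda>n. (\<Sum>k<n. (lin g k \<omega>)\<^sup>2) / real n) \<longlonglongrightarrow> y"
    and v: "s2 * y < v"
  shows "AE \<omega> in M. \<forall>\<^sub>F n in sequentially. brkt (lin g) n \<omega> \<le> v * real n"
  using noise_times_lin_average[OF g r avg] avg
proof eventually_elim
  case (elim \<omega>)
  have "(\<lambda>n. brkt (lin g) n \<omega> / real n) \<longlonglongrightarrow> s2 * y / 3 + 2 * s2 / 3 * y"
    by (rule brkt_average) fact+
  moreover have "s2 * y / 3 + 2 * s2 / 3 * y < v" using v by simp
  ultimately have "\<forall>\<^sub>F n in sequentially. brkt (lin g) n \<omega> / real n < v" by (rule order_tendstoD)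
  then show ?case using eventually_gt_at_top[of 0] by eventually_elim (simp add: divide_less_eq)
qed

lemma lil_lin_upper:
  fixes g :: "nat \<Rightarrow> real" and C r y c :: real
  assumes g: "\<And>j. \<bar>g j\<bar> \<le> C * r ^ j" and r: "0 \<le> r" "r < 1"
    and avg: "AE \<omega> in M. (\<lambda>n. (\<Sum>k<n. (lin g k \<omega>)\<^sup>2) / real n) \<longlonglongrightarrow> y" and y: "0 \<le> y"
    and c: "sqrt (2 * s2 * y) < c"
  shows "AE \<omega> in M. \<forall>\<^sub>F n in sequentially. \<bar>mart (lin g) n \<omega>\<bar> \<le> c * sqrt (real n * ln (ln (real n)))"
proof -
  have c0: "0 < c" using c real_sqrt_ge_zero[of "2 * s2 * y"] s2_nonneg y by (meson le_less_trans mult_nonneg_nonneg zero_le_numeral)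
  have sq: "2 * s2 * y < c\<^sup>2" using c c0 by (metis less_imp_le real_sqrt_less_iff real_sqrt_abs abs_of_nonneg)
  define v where "v = (c\<^sup>2 / 2 + s2 * y) / 2"
  have v: "s2 * y < v" "2 * v < c\<^sup>2" using sq by (auto simp: v_def field_simps)
  have v0: "0 < v" using v s2_nonneg y by (meson le_less_trans mult_nonneg_nonneg)
  have sv: "0 < sqrt (2 * v)" using v0 by simp
  have "sqrt (2 * v) < c" using v(2) c0 by (intro real_less_lsqrt) auto
  then have "1 < c / sqrt (2 * v)" using sv by (simp add: less_divide_eq)
  from lil_upper_abs[OF adapted_lin v0 this brkt_lin_le[OF g r avg v(1)]]
  have "AE \<omega> in M. \<forall>\<^sub>F n in sequentially. \<bar>mart (lin g) n \<omega>\<bar> \<le> c / sqrt (2 * v) * sqrt (2 * v * real n * ln (ln (real n)))" .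
  moreover have "c / sqrt (2 * v) * sqrt (2 * v * real n * ln (ln (real n))) = c * sqrt (real n * ln (ln (real n)))" for n
  proof -
    have "sqrt (2 * v * real n * ln (ln (real n))) = sqrt (2 * v) * sqrt (real n * ln (ln (real n)))"
      by (simp only: real_sqrt_mult mult.assoc)
    then show ?thesis using sv by (simp only: times_divide_eq_left mult.assoc[symmetric]) simp
  qed
  ultimately show ?thesis by simp
qed

text \<open>
At multiples of \<open>L\<close> the martingale is a sum of independent, identically distributed blocks plus
the memory martingale. The former obeys the lower law for i.i.d. sums, with variance per step
converging to \<open>s2\<^sup>2 G\<close> as \<open>L\<close> grows; the latter is bounded by the upper law with a constant that
tends to 0.
\<close>

lemma lil_lin_lower:
  fixes g :: "nat \<Rightarrow> real" and C r c :: real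
  assumes g: "\<And>j. \<bar>g j\<bar> \<le> C * r ^ j" and r: "0 \<le> r" "r < 1"
    and avg: "AE \<omega> in M. (\<lambda>n. (\<Sum>k<n. (lin g k \<omega>)\<^sup>2) / real n) \<longlonglongrightarrow> s2 * G"
    and G: "(\<lambda>j. (g j)\<^sup>2) sums G" and pos: "0 < s2\<^sup>2 * G"
    and c: "c < sqrt (2 * s2\<^sup>2 * G)"
  shows "AE \<omega> in M. \<exists>\<^sub>F n in sequentially. c * sqrt (real n * ln (ln (real n))) \<le> mart (lin g) n \<omega>"
proof -
  define \<kappa> where "\<kappa> = sqrt (2 * s2\<^sup>2 * G)"
  have \<kappa>: "0 < \<kappa>" using pos unfolding \<kappa>_def by (simp only: real_sqrt_gt_0_iff mult.assoc)
  define t where "t = max c 0 / \<kappa>"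
  define b where "b = (1 + t) / 2"
  have mk: "t < 1" "0 \<le> t" unfolding t_def using c \<kappa> by (auto simp: \<kappa>_def[symmetric])
  have b: "0 < b" "b < 1" using mk by (auto simp: b_def)
  have bc: "c < b * \<kappa>"
  proof -
    have "max c 0 = t * \<kappa>" using \<kappa> by (simp add: t_def)
    also have "t < b" using mk(1) by (simp add: b_def)
    then have "t * \<kappa> < b * \<kappa>" using \<kappa> by (rule mult_strict_right_mono)
    finally show ?thesis by simp
  qed
  define v where "v L = s2\<^sup>2 * (\<Sum>l<L. \<Sum>j<l. (g j)\<^sup>2)" for L
  have vL: "(\<lambda>L. v L / real L) \<longlonglongrightarrow> s2\<^sup>2 * G"
  proof -
    have "(\<lambda>L. s2\<^sup>2 * ((\<Sum>l<L. \<Sum>j<l. (g j)\<^sup>2) / real L)) \<longlonglongrightarrow> s2\<^sup>2 * G"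
      using G by (intro tendsto_intros cesaro_mean) (simp add: sums_def)
    then show ?thesis by (simp add: v_def)
  qed
  define Q where "Q = s2\<^sup>2 * C\<^sup>2 / (1 - r) ^ 3"
  (* The summand 1 makes the bound on the bracket strict, also when Q = 0. *)
  define q where "q L = (Q + 1) / real L" for L
  have Q: "0 \<le> Q" using r by (simp add: Q_def)
  have q0: "q \<longlonglongrightarrow> 0" unfolding q_def by real_asymp
  have "(\<lambda>L. b * sqrt (2 * (v L / real L)) - 2 * sqrt (2 * q L)) \<longlonglongrightarrow> b * sqrt (2 * (s2\<^sup>2 * G)) - 2 * sqrt (2 * 0)"
    by (intro tendsto_intros vL q0)
  then have "\<forall>\<^sub>F L in sequentially. c < b * sqrt (2 * (v L / real L)) - 2 * sqrt (2 * q L)"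
    by (rule order_tendstoD) (use bc in \<open>simp add: \<kappa>_def mult.assoc\<close>)
  moreover have "\<forall>\<^sub>F L in sequentially. 0 < v L / real L" using vL pos by (rule order_tendstoD)
  ultimately have "\<forall>\<^sub>F L in sequentially. c < b * sqrt (2 * (v L / real L)) - 2 * sqrt (2 * q L) \<and> 0 < v L / real L \<and> 0 < L"
    using eventually_gt_at_top[of 0] by eventually_elim auto
  then obtain L where L: "c < b * sqrt (2 * (v L / real L)) - 2 * sqrt (2 * q L)" "0 < v L / real L" "0 < L"
    by (auto simp: eventually_sequentially)
  have v0: "0 < v L" using L by (simp add: zero_less_divide_iff)
  have q1: "0 < q L" using Q L by (simp add: q_def)
  have "Q / real L < q L" using L by (simp add: q_def divide_strict_right_mono)
  from brkt_memory_le[OF g r L(3) this[unfolded Q_def]]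
  have "AE \<omega> in M. \<forall>\<^sub>F n in sequentially. brkt (memory g L) n \<omega> \<le> q L * real n" .
  from lil_upper_abs[OF adapted_memory q1 _ this, of 2]
  have mem: "AE \<omega> in M. \<forall>\<^sub>F n in sequentially. \<bar>mart (memory g L) n \<omega>\<bar> \<le> 2 * sqrt (2 * q L) * sqrt (real n * ln (ln (real n)))"
    by (simp add: real_sqrt_mult mult.assoc)
  have y0: "0 \<le> s2 * G"
    using s2_nonneg pos by (auto simp: zero_less_mult_iff)
  have "sqrt (2 * s2 * (s2 * G)) < \<kappa> + 1" by (simp add: \<kappa>_def power2_eq_square mult.assoc)
  from lil_lin_upper[OF g r avg y0 this]
  have all: "AE \<omega> in M. \<forall>\<^sub>F n in sequentially. \<bar>mart (lin g) n \<omega>\<bar> \<le> (\<kappa> + 1) * sqrt (real n * ln (ln (real n)))" .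
  define B where "B = block_sum g L"
  note Bp = block_sum_iid[where L=L and g=g, folded B_def]
  have dec: "(\<Sum>b<n. B b \<omega>) = mart (lin g) (L * n) \<omega> - mart (memory g L) (L * n) \<omega>" for n \<omega>
    using mart_lin_blocks[of g L n \<omega>] by (simp add: B_def)
  define C' where "C' = (\<kappa> + 1 + 2 * sqrt (2 * q L)) * sqrt (2 * real L)"
  have fL: "filterlim (\<lambda>n. L * n) at_top sequentially"
    by (rule filterlim_at_top_mono[OF filterlim_ident]) (use L in auto)
  have bnd: "AE \<omega> in M. \<forall>\<^sub>F n in sequentially. \<bar>\<Sum>i<n. B i \<omega>\<bar> \<le> C' * sqrt (real n * ln (ln (real n)))"
    using mem all
  proof eventually_elim
    case (elim \<omega>)
    have e1: "\<forall>\<^sub>F n in sequentially. \<bar>mart (memory g L) (L * n) \<omega>\<bar> \<le> 2 * sqrt (2 * q L) * sqrt (real (L * n) * ln (ln (real (L * n))))"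
      and e2: "\<forall>\<^sub>F n in sequentially. \<bar>mart (lin g) (L * n) \<omega>\<bar> \<le> (\<kappa> + 1) * sqrt (real (L * n) * ln (ln (real (L * n))))"
      using elim fL unfolding filterlim_iff by blast+
    have rL: "0 < real L" using L by simp
    have "(\<lambda>n. ln (ln (real L * real n)) / ln (ln (real n))) \<longlonglongrightarrow> 1" using rL by real_asymp
    then have e3: "\<forall>\<^sub>F n in sequentially. ln (ln (real L * real n)) / ln (ln (real n)) < 2" by (rule order_tendstoD) simp
    have e4: "\<forall>\<^sub>F n in sequentially. 0 < ln (ln (real n))" by real_asymp
    from e1 e2 e3 e4 show ?case
    proof eventually_elim
      case (elim n)
      have "real (L * n) * ln (ln (real (L * n))) \<le> 2 * real L * (real n * ln (ln (real n)))"
      proof -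
        have "ln (ln (real L * real n)) \<le> 2 * ln (ln (real n))" using elim(3,4) by (simp add: divide_less_eq)
        then have "real L * real n * ln (ln (real L * real n)) \<le> real L * real n * (2 * ln (ln (real n)))"
          by (rule mult_left_mono) simp
        then show ?thesis by (simp add: mult_ac)
      qed
      then have s: "sqrt (real (L * n) * ln (ln (real (L * n)))) \<le> sqrt (2 * real L) * sqrt (real n * ln (ln (real n)))"
        unfolding real_sqrt_mult[symmetric] by (rule real_sqrt_le_mono)
      have "\<bar>\<Sum>i<n. B i \<omega>\<bar> \<le> (\<kappa> + 1 + 2 * sqrt (2 * q L)) * sqrt (real (L * n) * ln (ln (real (L * n))))"
        unfolding dec using elim(1,2) by (simp add: distrib_right)
      also have "\<dots> \<le> (\<kappa> + 1 + 2 * sqrt (2 * q L)) * (sqrt (2 * real L) * sqrt (real n * ln (ln (real n))))"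
        using \<kappa> q1 s by (intro mult_left_mono) auto
      finally show ?case by (simp add: C'_def mult.assoc)
    qed
  qed
  have C'0: "0 \<le> C'" using \<kappa> q1 by (simp add: C'_def)
  have "AE \<omega> in M. \<exists>\<^sub>F n in sequentially. b * sqrt (2 * v L) * sqrt (real n * ln (ln (real n))) \<le> (\<Sum>i<n. B i \<omega>)"
    by (rule iid_lil_lower[OF Bp(1-4) _ v0 C'0 bnd b]) (simp add: Bp(5) v_def)
  with mem show ?thesis
  proof eventually_elim
    case (elim \<omega>)
    have e1: "\<forall>\<^sub>F n in sequentially. \<bar>mart (memory g L) (L * n) \<omega>\<bar> \<le> 2 * sqrt (2 * q L) * sqrt (real (L * n) * ln (ln (real (L * n))))"
      using elim(1) fL unfolding filterlim_iff by blast
    have rL: "0 < real L" using L by simp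
    have rho: "(\<lambda>n. ln (ln (real n)) / ln (ln (real L * real n))) \<longlonglongrightarrow> 1" using rL by real_asymp
    have "(\<lambda>n. b * sqrt (2 * (v L / real L)) * sqrt (ln (ln (real n)) / ln (ln (real L * real n))) - 2 * sqrt (2 * q L)) \<longlonglongrightarrow> b * sqrt (2 * (v L / real L)) * sqrt 1 - 2 * sqrt (2 * q L)"
      by (intro tendsto_intros rho)
    then have e2: "\<forall>\<^sub>F n in sequentially. c < b * sqrt (2 * (v L / real L)) * sqrt (ln (ln (real n)) / ln (ln (real L * real n))) - 2 * sqrt (2 * q L)"
      by (rule order_tendstoD) (use L in simp)
    have e3: "\<forall>\<^sub>F n in sequentially. 0 < ln (ln (real n))" by real_asymp
    have e4: "\<forall>\<^sub>F n in sequentially. 0 < ln (ln (real L * real n))" using rL by real_asymp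
    have ev: "\<forall>\<^sub>F n in sequentially. N \<le> n \<and> \<bar>mart (memory g L) (L * n) \<omega>\<bar> \<le> 2 * sqrt (2 * q L) * sqrt (real (L * n) * ln (ln (real (L * n))))
       \<and> c < b * sqrt (2 * (v L / real L)) * sqrt (ln (ln (real n)) / ln (ln (real L * real n))) - 2 * sqrt (2 * q L)
       \<and> 0 < ln (ln (real n)) \<and> 0 < ln (ln (real L * real n))" for N
      using e1 e2 e3 e4 eventually_ge_at_top[of N] by eventually_elim auto
    show ?case unfolding frequently_sequentially
    proof
      fix N
      from frequently_eventually_frequently[OF elim(2) ev[of N]]
      obtain n where n: "b * sqrt (2 * v L) * sqrt (real n * ln (ln (real n))) \<le> (\<Sum>i<n. B i \<omega>)" "N \<le> n"
        "\<bar>mart (memory g L) (L * n) \<omega>\<bar> \<le> 2 * sqrt (2 * q L) * sqrt (real (L * n) * ln (ln (real (L * n))))"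
        "c < b * sqrt (2 * (v L / real L)) * sqrt (ln (ln (real n)) / ln (ln (real L * real n))) - 2 * sqrt (2 * q L)"
        "0 < ln (ln (real n))" "0 < ln (ln (real L * real n))"
        by (auto dest!: frequently_ex)
      define S where "S = sqrt (real (L * n) * ln (ln (real (L * n))))"
      have S0: "0 \<le> S" unfolding S_def using n(6) by simp
      have "sqrt (2 * v L) * sqrt (real n * ln (ln (real n))) = sqrt (2 * (v L / real L)) * sqrt (ln (ln (real n)) / ln (ln (real L * real n))) * S"
        unfolding S_def real_sqrt_mult[symmetric] using n(6) rL by (intro arg_cong[where f=sqrt]) (simp add: field_simps)
      then have eq: "b * sqrt (2 * v L) * sqrt (real n * ln (ln (real n))) = b * sqrt (2 * (v L / real L)) * sqrt (ln (ln (real n)) / ln (ln (real L * real n))) * S"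
        by (simp only: mult.assoc)
      have "c * S \<le> (b * sqrt (2 * (v L / real L)) * sqrt (ln (ln (real n)) / ln (ln (real L * real n))) - 2 * sqrt (2 * q L)) * S"
        using n(4) S0 by (intro mult_right_mono) auto
      also have "\<dots> = b * sqrt (2 * v L) * sqrt (real n * ln (ln (real n))) - 2 * sqrt (2 * q L) * S"
        unfolding eq by (simp only: left_diff_distrib)
      also have "\<dots> \<le> mart (lin g) (L * n) \<omega>" using n(1,3) unfolding dec S_def by linarith
      finally have "c * sqrt (real (L * n) * ln (ln (real (L * n)))) \<le> mart (lin g) (L * n) \<omega>" by (simp only: S_def)
      moreover have "N \<le> L * n" using n(2) L(3) by (metis le_trans mult_le_mono1 nat_mult_1 Suc_leI One_nat_def)
      ultimately show "\<exists>m\<ge>N. c * sqrt (real m * ln (ln (real m))) \<le> mart (lin g) m \<omega>" by blast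
    qed
  qed
qed

end

section \<open>Sample moments of a second-order autoregression\<close>

lemma ar2_cross_identity:
  fixes x u :: "nat \<Rightarrow> real" and a b :: real
  assumes rec: "\<And>k. x (Suc (Suc k)) = a * x (Suc k) + b * x k + u (Suc k)"
  shows "(1 - b) * (\<Sum>k<n. x (Suc k) * x k) - a * (\<Sum>k<n. (x k)\<^sup>2)
     = x 1 * x 0 - x (Suc n) * x n + a * ((x n)\<^sup>2 - (x 0)\<^sup>2) + (\<Sum>k<Suc n. u k * x k) - u 0 * x 0"
proof (induction n)
  case (Suc n)
  show ?case using Suc by (simp add: rec[of n] algebra_simps power2_eq_square)
qed simp

lemma ar2_square_identity:
  fixes x u :: "nat \<Rightarrow> real" and a b :: real
  assumes rec: "\<And>k. x (Suc (Suc k)) = a * x (Suc k) + b * x k + u (Suc k)"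
  shows "(1 - a\<^sup>2 - b\<^sup>2) * (\<Sum>k<n. (x k)\<^sup>2) - 2 * a * b * (\<Sum>k<n. x (Suc k) * x k)
     = (x 0)\<^sup>2 + (x 1)\<^sup>2 - (x n)\<^sup>2 - (x (Suc n))\<^sup>2 + a\<^sup>2 * ((x n)\<^sup>2 - (x 0)\<^sup>2)
       + (\<Sum>k<Suc n. (u k)\<^sup>2) - (u 0)\<^sup>2 + 2 * a * ((\<Sum>k<Suc n. u k * x k) - u 0 * x 0)
       + 2 * b * (\<Sum>k<n. u (Suc k) * x k)"
proof (induction n)
  case (Suc n)
  show ?case using Suc by (simp add: rec[of n] algebra_simps power2_eq_square)
qed simp

lemma average_Suc:
  fixes s :: "nat \<Rightarrow> real"
  assumes "(\<lambda>n. s n / real n) \<longlonglongrightarrow> l"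
  shows "(\<lambda>n. s (Suc n) / real n) \<longlonglongrightarrow> l"
proof -
  have "(\<lambda>n. s (Suc n) / real (Suc n) * (real (Suc n) / real n)) \<longlonglongrightarrow> l * 1"
    by (intro tendsto_mult LIMSEQ_Suc[OF assms]) real_asymp
  then show ?thesis by (simp del: of_nat_Suc)
qed

lemma average_mult_null:
  fixes x y :: "nat \<Rightarrow> real"
  assumes "(\<lambda>n. (x n)\<^sup>2 / real n) \<longlonglongrightarrow> 0" "(\<lambda>n. (y n)\<^sup>2 / real n) \<longlonglongrightarrow> 0"
  shows "(\<lambda>n. x n * y n / real n) \<longlonglongrightarrow> 0"
proof (rule Lim_null_comparison)
  show "(\<lambda>n. (x n)\<^sup>2 / real n + (y n)\<^sup>2 / real n) \<longlonglongrightarrow> 0"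
    using tendsto_add[OF assms] by simp
  have "\<bar>x n * y n\<bar> \<le> (x n)\<^sup>2 + (y n)\<^sup>2" for n
    by (rule abs_mult_le_sum_squares)
  then show "\<forall>\<^sub>F n in sequentially. norm (x n * y n / real n) \<le> (x n)\<^sup>2 / real n + (y n)\<^sup>2 / real n"
    by (simp add: add_divide_distrib[symmetric] divide_right_mono)
qed

lemma square_over_n_null:
  fixes x :: "nat \<Rightarrow> real"
  assumes "(\<lambda>n. x n ^ 4 / real n) \<longlonglongrightarrow> 0"
  shows "(\<lambda>n. (x n)\<^sup>2 / real n) \<longlonglongrightarrow> 0"
proof (rule Lim_null_comparison)
  have "(\<lambda>n. 1 / real n + x n ^ 4 / real n) \<longlonglongrightarrow> 0 + 0" by (intro tendsto_add assms) real_asymp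
  then show "(\<lambda>n. 1 / real n + x n ^ 4 / real n) \<longlonglongrightarrow> 0" by simp
  have "(x n)\<^sup>2 \<le> 1 + x n ^ 4" for n
  proof -
    have "2 * (x n)\<^sup>2 \<le> 1 + x n ^ 4"
      using zero_le_power2[of "(x n)\<^sup>2 - 1"] by (simp add: power2_diff flip: power_mult)
    then show ?thesis using zero_le_power2[of "x n"] by linarith
  qed
  then show "\<forall>\<^sub>F n in sequentially. norm ((x n)\<^sup>2 / real n) \<le> 1 / real n + x n ^ 4 / real n"
    by (simp add: add_divide_distrib[symmetric] divide_right_mono)
qed

text \<open>
Multiplying the recursion by \<open>x\<close> at lag one and squaring it give two linear relations between the
sample variance and the sample autocovariance, up to terms of smaller order. Their
determinant is \<open>\<Delta>\<close>.
\<close>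

lemma ar2_averages:
  fixes x u :: "nat \<Rightarrow> real" and a b :: real
  assumes rec: "\<And>k. x (Suc (Suc k)) = a * x (Suc k) + b * x k + u (Suc k)"
    and E: "(\<lambda>n. (\<Sum>k<n. (u k)\<^sup>2) / real n) \<longlonglongrightarrow> e"
    and M: "(\<lambda>n. (\<Sum>k<n. u k * x k) / real n) \<longlonglongrightarrow> 0"
    and N: "(\<lambda>n. (\<Sum>k<n. u (Suc k) * x k) / real n) \<longlonglongrightarrow> 0"
    and x2: "(\<lambda>n. (x n)\<^sup>2 / real n) \<longlonglongrightarrow> 0"
    and \<Delta>: "\<Delta> = (1 + b) * ((1 - b)\<^sup>2 - a\<^sup>2)" "\<Delta> \<noteq> 0" and b: "b \<noteq> 1"
  shows "(\<lambda>n. (\<Sum>k<n. (x k)\<^sup>2) / real n) \<longlonglongrightarrow> (1 - b) / \<Delta> * e"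
    and "(\<lambda>n. (\<Sum>k<n. x (Suc k) * x k) / real n) \<longlonglongrightarrow> a / \<Delta> * e"
proof -
  define S where "S n = (\<Sum>k<n. (x k)\<^sup>2)" for n
  define P where "P n = (\<Sum>k<n. x (Suc k) * x k)" for n
  define F where "F n = (1 - b) * P n - a * S n" for n
  define G where "G n = (1 - a\<^sup>2 - b\<^sup>2) * S n - 2 * a * b * P n" for n
  have x2': "(\<lambda>n. (x (Suc n))\<^sup>2 / real n) \<longlonglongrightarrow> 0" by (rule average_Suc[OF x2])
  have xx: "(\<lambda>n. x (Suc n) * x n / real n) \<longlonglongrightarrow> 0" by (rule average_mult_null[OF x2' x2])
  have c: "(\<lambda>n. k / real n) \<longlonglongrightarrow> 0" for k :: real by real_asymp
  have "F n / real n = (x 1 * x 0 - a * (x 0)\<^sup>2 - u 0 * x 0) / real n - x (Suc n) * x n / real n + a * ((x n)\<^sup>2 / real n)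
      + (\<Sum>k<Suc n. u k * x k) / real n" for n
    unfolding F_def S_def P_def ar2_cross_identity[of x a b u, OF rec] by (simp add: add_divide_distrib diff_divide_distrib algebra_simps del: sum.lessThan_Suc)
  moreover have "(\<lambda>n. (x 1 * x 0 - a * (x 0)\<^sup>2 - u 0 * x 0) / real n - x (Suc n) * x n / real n + a * ((x n)\<^sup>2 / real n)
      + (\<Sum>k<Suc n. u k * x k) / real n) \<longlonglongrightarrow> 0 - 0 + a * 0 + 0"
    by (intro tendsto_intros c xx x2 average_Suc[OF M])
  ultimately have F: "(\<lambda>n. F n / real n) \<longlonglongrightarrow> 0" by simp
  have "G n / real n = ((x 0)\<^sup>2 + (x 1)\<^sup>2 - a\<^sup>2 * (x 0)\<^sup>2 - (u 0)\<^sup>2 - 2 * a * (u 0 * x 0)) / real n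
      + (a\<^sup>2 - 1) * ((x n)\<^sup>2 / real n) - (x (Suc n))\<^sup>2 / real n + (\<Sum>k<Suc n. (u k)\<^sup>2) / real n
      + 2 * a * ((\<Sum>k<Suc n. u k * x k) / real n) + 2 * b * ((\<Sum>k<n. u (Suc k) * x k) / real n)" for n
    unfolding G_def S_def P_def ar2_square_identity[of x a b u, OF rec] by (simp add: add_divide_distrib diff_divide_distrib algebra_simps del: sum.lessThan_Suc)
  moreover have "(\<lambda>n. ((x 0)\<^sup>2 + (x 1)\<^sup>2 - a\<^sup>2 * (x 0)\<^sup>2 - (u 0)\<^sup>2 - 2 * a * (u 0 * x 0)) / real n
      + (a\<^sup>2 - 1) * ((x n)\<^sup>2 / real n) - (x (Suc n))\<^sup>2 / real n + (\<Sum>k<Suc n. (u k)\<^sup>2) / real n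
      + 2 * a * ((\<Sum>k<Suc n. u k * x k) / real n) + 2 * b * ((\<Sum>k<n. u (Suc k) * x k) / real n))
      \<longlonglongrightarrow> 0 + (a\<^sup>2 - 1) * 0 - 0 + e + 2 * a * 0 + 2 * b * 0"
    by (intro tendsto_intros c x2 x2' average_Suc[OF M] average_Suc[OF E] N)
  ultimately have G: "(\<lambda>n. G n / real n) \<longlonglongrightarrow> e" by simp
  have "\<Delta> * S n = (1 - b) * G n + 2 * a * b * F n" for n
    unfolding F_def G_def \<Delta>(1) by (simp add: algebra_simps power2_eq_square)
  then have "S n = ((1 - b) * G n + 2 * a * b * F n) / \<Delta>" for n
    using \<Delta>(2) by (metis nonzero_mult_div_cancel_left)
  then have "S n / real n = ((1 - b) * (G n / real n) + 2 * a * b * (F n / real n)) / \<Delta>" for n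
    by (simp add: add_divide_distrib mult.commute)
  moreover have "(\<lambda>n. ((1 - b) * (G n / real n) + 2 * a * b * (F n / real n)) / \<Delta>) \<longlonglongrightarrow> ((1 - b) * e + 2 * a * b * 0) / \<Delta>"
    by (intro tendsto_intros F G \<Delta>(2))
  ultimately have S: "(\<lambda>n. S n / real n) \<longlonglongrightarrow> (1 - b) / \<Delta> * e" by simp
  then show "(\<lambda>n. (\<Sum>k<n. (x k)\<^sup>2) / real n) \<longlonglongrightarrow> (1 - b) / \<Delta> * e" by (simp add: S_def)
  have "P n = (a * S n + F n) / (1 - b)" for n
    unfolding F_def using b by simp
  then have "P n / real n = (a * (S n / real n) + F n / real n) / (1 - b)" for n
    by (simp add: add_divide_distrib mult.commute)
  moreover have "(\<lambda>n. (a * (S n / real n) + F n / real n) / (1 - b)) \<longlonglongrightarrow> (a * ((1 - b) / \<Delta> * e) + 0) / (1 - b)"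
    using b by (intro tendsto_intros S F) auto
  moreover have "(a * ((1 - b) / \<Delta> * e) + 0) / (1 - b) = a / \<Delta> * e" using b by simp
  ultimately show "(\<lambda>n. (\<Sum>k<n. x (Suc k) * x k) / real n) \<longlonglongrightarrow> a / \<Delta> * e" by (simp add: P_def)
qed

text \<open>
This covers both the impulse response and the effect of the initial values. Choosing \<open>r\<close>
strictly above \<open>\<bar>\<theta>\<bar>\<close> absorbs the resonance in the case \<open>\<theta> = \<rho>\<close>.
\<close>

lemma two_root_recursion_bound:
  fixes e :: "nat \<Rightarrow> real" and \<theta> \<rho> f r :: real
  assumes rec: "\<And>k. e (Suc k) = \<theta> * e k + f * \<rho> ^ k"
    and r: "\<bar>\<theta>\<bar> < r" "\<bar>\<rho>\<bar> \<le> r"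
  shows "\<bar>e k\<bar> \<le> max \<bar>e 0\<bar> (\<bar>f\<bar> / (r - \<bar>\<theta>\<bar>)) * r ^ k"
proof (induction k)
  case (Suc k)
  define C where "C = max \<bar>e 0\<bar> (\<bar>f\<bar> / (r - \<bar>\<theta>\<bar>))"
  have "\<bar>f\<bar> / (r - \<bar>\<theta>\<bar>) \<le> C" by (simp add: C_def)
  then have f: "\<bar>f\<bar> \<le> C * (r - \<bar>\<theta>\<bar>)" using r by (simp add: pos_divide_le_eq)
  have "\<bar>e (Suc k)\<bar> \<le> \<bar>\<theta>\<bar> * \<bar>e k\<bar> + \<bar>f\<bar> * \<bar>\<rho>\<bar> ^ k"
    unfolding rec by (intro order_trans[OF abs_triangle_ineq]) (simp add: abs_mult power_abs)
  also have "\<dots> \<le> \<bar>\<theta>\<bar> * (C * r ^ k) + C * (r - \<bar>\<theta>\<bar>) * r ^ k"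
    using Suc r f unfolding C_def[symmetric]
    by (intro add_mono mult_left_mono mult_mono power_mono) auto
  also have "\<dots> = C * r ^ Suc k" by (simp add: algebra_simps)
  finally show ?case by (simp add: C_def)
qed simp

section \<open>Iterated-logarithm laws of real sequences\<close>

definition lil_rate :: "nat \<Rightarrow> real" where "lil_rate n = sqrt (real n * ln (ln (real n)))"

text \<open>
Since \<open>lil_rate\<close> is eventually positive, this says that the limit superior of \<open>w n / lil_rate n\<close> is
\<open>\<kappa>\<close>; the formulation by inequalities is the one that the probabilistic bounds deliver.
\<close>

definition lil :: "(nat \<Rightarrow> real) \<Rightarrow> real \<Rightarrow> bool" where
  "lil w \<kappa> \<longleftrightarrow> (\<forall>c>\<kappa>. \<forall>\<^sub>F n in sequentially. w n \<le> c * lil_rate n) \<and>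
     (\<forall>c<\<kappa>. \<exists>\<^sub>F n in sequentially. c * lil_rate n \<le> w n)"

text \<open>
For the remainder terms only the order of magnitude matters.
\<close>

definition lil_bounded :: "(nat \<Rightarrow> real) \<Rightarrow> bool" where
  "lil_bounded w \<longleftrightarrow> (\<exists>C. \<forall>\<^sub>F n in sequentially. \<bar>w n\<bar> \<le> C * lil_rate n)"

lemma eventually_lil_rate_pos: "\<forall>\<^sub>F n in sequentially. 0 < lil_rate n"
  unfolding lil_rate_def by real_asymp

lemma lil_bounded_null_mult:
  assumes w: "lil_bounded w" and a: "\<alpha> \<longlonglongrightarrow> 0"
  shows "(\<lambda>n. \<alpha> n * w n / lil_rate n) \<longlonglongrightarrow> 0"
proof -
  from w obtain C where C: "\<forall>\<^sub>F n in sequentially. \<bar>w n\<bar> \<le> C * lil_rate n" by (auto simp: lil_bounded_def)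
  show ?thesis
  proof (rule Lim_null_comparison)
    show "(\<lambda>n. \<bar>\<alpha> n\<bar> * C) \<longlonglongrightarrow> 0" using tendsto_mult_right[OF tendsto_rabs[OF a], of C] tendsto_mult_left_zero[OF tendsto_rabs_zero[OF a], of C] by simp
    from C eventually_lil_rate_pos show "\<forall>\<^sub>F n in sequentially. norm (\<alpha> n * w n / lil_rate n) \<le> \<bar>\<alpha> n\<bar> * C"
    proof eventually_elim
      case (elim n)
      have "\<bar>\<alpha> n\<bar> * \<bar>w n\<bar> \<le> \<bar>\<alpha> n\<bar> * (C * lil_rate n)" using elim by (intro mult_left_mono) auto
      then show ?case using elim by (simp add: abs_mult divide_le_eq mult.assoc)
    qed
  qed
qed

lemma lil_perturb:
  assumes w: "lil w \<kappa>" "lil_bounded w" and a: "\<alpha> \<longlonglongrightarrow> A" "0 < A"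
    and r: "(\<lambda>n. r n / lil_rate n) \<longlonglongrightarrow> 0"
  shows "lil (\<lambda>n. \<alpha> n * w n + r n) (A * \<kappa>)"
proof -
  define q where "q n = (\<alpha> n - A) * w n + r n" for n
  have "(\<lambda>n. (\<alpha> n - A) * w n / lil_rate n + r n / lil_rate n) \<longlonglongrightarrow> 0 + 0"
    using a by (intro tendsto_add r lil_bounded_null_mult[OF w(2)]) (simp add: LIM_zero)
  then have q: "(\<lambda>n. q n / lil_rate n) \<longlonglongrightarrow> 0" by (simp add: q_def add_divide_distrib)
  have ev: "\<forall>\<^sub>F n in sequentially. \<bar>q n\<bar> \<le> d * lil_rate n" if d: "0 < d" for d
  proof -
    have "\<forall>\<^sub>F n in sequentially. \<bar>q n / lil_rate n\<bar> < d"
      using order_tendstoD(2)[OF tendsto_rabs_zero[OF q] d] .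
    with eventually_lil_rate_pos show ?thesis by eventually_elim (simp add: divide_less_eq)
  qed
  have eq: "\<alpha> n * w n + r n = A * w n + q n" for n by (simp add: q_def algebra_simps)
  show ?thesis unfolding lil_def eq
  proof (intro conjI allI impI)
    fix c assume c: "A * \<kappa> < c"
    define c1 where "c1 = (c / A + \<kappa>) / 2"
    have c1: "\<kappa> < c1" "0 < c - A * c1" using c a by (auto simp: c1_def field_simps)
    have "\<forall>\<^sub>F n in sequentially. w n \<le> c1 * lil_rate n" using w c1 by (simp add: lil_def)
    with ev[OF c1(2)] show "\<forall>\<^sub>F n in sequentially. A * w n + q n \<le> c * lil_rate n"
    proof eventually_elim
      case (elim n)
      have "A * w n \<le> A * (c1 * lil_rate n)" using elim a by (intro mult_left_mono) auto
      moreover have "(c - A * c1) * lil_rate n = c * lil_rate n - A * (c1 * lil_rate n)" by (simp add: algebra_simps)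
      ultimately show ?case using elim by linarith
    qed
  next
    fix c assume c: "c < A * \<kappa>"
    define c1 where "c1 = (c / A + \<kappa>) / 2"
    have c1: "c1 < \<kappa>" "0 < A * c1 - c" using c a by (auto simp: c1_def field_simps)
    have "\<exists>\<^sub>F n in sequentially. c1 * lil_rate n \<le> w n" using w c1 by (simp add: lil_def)
    from frequently_eventually_frequently[OF this ev[OF c1(2)]]
    show "\<exists>\<^sub>F n in sequentially. c * lil_rate n \<le> A * w n + q n"
    proof (rule frequently_elim1)
      fix n assume n: "c1 * lil_rate n \<le> w n \<and> \<bar>q n\<bar> \<le> (A * c1 - c) * lil_rate n"
      then have "A * (c1 * lil_rate n) \<le> A * w n" using a by (intro mult_left_mono) auto
      moreover have "(A * c1 - c) * lil_rate n = A * (c1 * lil_rate n) - c * lil_rate n" by (simp add: algebra_simps)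
      ultimately show "c * lil_rate n \<le> A * w n + q n" using n by linarith
    qed
  qed
qed

lemma limsup_of_eventually_frequently:
  fixes d :: "nat \<Rightarrow> real"
  assumes up: "\<And>c. \<sigma> < c \<Longrightarrow> \<forall>\<^sub>F n in sequentially. d n \<le> c"
    and lo: "\<And>c. c < \<sigma> \<Longrightarrow> \<exists>\<^sub>F n in sequentially. c \<le> d n"
  shows "limsup (\<lambda>n. ereal (d n)) = ereal \<sigma>"
proof (rule antisym)
  show "limsup (\<lambda>n. ereal (d n)) \<le> ereal \<sigma>"
  proof (rule ccontr)
    assume "\<not> limsup (\<lambda>n. ereal (d n)) \<le> ereal \<sigma>"
    then obtain c where c: "ereal \<sigma> < ereal c" "ereal c < limsup (\<lambda>n. ereal (d n))"
      using ereal_dense2[of "ereal \<sigma>"] by (auto simp: not_le)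
    have "\<forall>\<^sub>F n in sequentially. ereal (d n) \<le> ereal c" using up[of c] c by simp
    then have "limsup (\<lambda>n. ereal (d n)) \<le> ereal c" by (rule Limsup_bounded)
    then show False using c by simp
  qed
  show "ereal \<sigma> \<le> limsup (\<lambda>n. ereal (d n))"
  proof (rule ccontr)
    assume "\<not> ereal \<sigma> \<le> limsup (\<lambda>n. ereal (d n))"
    then have "limsup (\<lambda>n. ereal (d n)) < ereal \<sigma>" by simp
    then obtain c where c: "limsup (\<lambda>n. ereal (d n)) < ereal c" "ereal c < ereal \<sigma>"
      using ereal_dense2 by blast
    have "\<forall>\<^sub>F n in sequentially. ereal (d n) < ereal c" using c(1) by (rule Limsup_lessD)
    then have "\<forall>\<^sub>F n in sequentially. \<not> c \<le> d n" by eventually_elim simp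
    moreover have "\<exists>\<^sub>F n in sequentially. c \<le> d n" using lo c by simp
    ultimately show False by (simp add: frequently_def)
  qed
qed

lemma lil_estimator_bounds:
  assumes "lil w (sqrt 2 * \<sigma>)" and d: "\<And>n. w n = real n * d n"
  shows "\<And>c. \<sigma> < c \<Longrightarrow> \<forall>\<^sub>F n in sequentially. sqrt (real n / (2 * ln (ln (real n)))) * d n \<le> c"
    and "\<And>c. c < \<sigma> \<Longrightarrow> \<exists>\<^sub>F n in sequentially. c \<le> sqrt (real n / (2 * ln (ln (real n)))) * d n"
proof -
  have ev: "\<forall>\<^sub>F n in sequentially. 0 < ln (ln (real n))" by real_asymp
  have eq: "w n = sqrt 2 * lil_rate n * (sqrt (real n / (2 * ln (ln (real n)))) * d n)" "0 < sqrt 2 * lil_rate n"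
    if "0 < ln (ln (real n))" "0 < n" for n
  proof -
    have "sqrt 2 * lil_rate n * sqrt (real n / (2 * ln (ln (real n)))) = sqrt ((real n)\<^sup>2)"
      unfolding lil_rate_def real_sqrt_mult[symmetric] using that
      by (intro arg_cong[where f = sqrt]) (simp add: field_simps power2_eq_square)
    also have "\<dots> = real n" by simp
    finally show "w n = sqrt 2 * lil_rate n * (sqrt (real n / (2 * ln (ln (real n)))) * d n)"
      by (simp add: d mult.assoc[symmetric])
    show "0 < sqrt 2 * lil_rate n" using that by (simp add: lil_rate_def)
  qed
  {
    fix c assume "\<sigma> < c"
    then have "\<forall>\<^sub>F n in sequentially. w n \<le> (sqrt 2 * c) * lil_rate n" using assms(1) by (simp add: lil_def)
    then show "\<forall>\<^sub>F n in sequentially. sqrt (real n / (2 * ln (ln (real n)))) * d n \<le> c"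
      using ev eventually_gt_at_top[of 0]
    proof eventually_elim
      case (elim n)
      have "sqrt 2 * lil_rate n * (sqrt (real n / (2 * ln (ln (real n)))) * d n) \<le> sqrt 2 * lil_rate n * c"
        using elim eq[of n] by (simp only: mult_ac)
      then show ?case using eq(2)[OF elim(2,3)] by (simp only: mult_le_cancel_left_pos)
    qed
  next
    fix c assume "c < \<sigma>"
    then have "\<exists>\<^sub>F n in sequentially. (sqrt 2 * c) * lil_rate n \<le> w n" using assms(1) by (simp add: lil_def)
    moreover have "\<forall>\<^sub>F n in sequentially. 0 < ln (ln (real n)) \<and> 0 < n" using ev eventually_gt_at_top[of 0] by eventually_elim auto
    ultimately have "\<exists>\<^sub>F n in sequentially. (sqrt 2 * c) * lil_rate n \<le> w n \<and> 0 < ln (ln (real n)) \<and> 0 < n"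
      by (rule frequently_eventually_frequently)
    then show "\<exists>\<^sub>F n in sequentially. c \<le> sqrt (real n / (2 * ln (ln (real n)))) * d n"
    proof (rule frequently_elim1)
      fix n assume n: "(sqrt 2 * c) * lil_rate n \<le> w n \<and> 0 < ln (ln (real n)) \<and> 0 < n"
      then have "sqrt 2 * lil_rate n * c \<le> sqrt 2 * lil_rate n * (sqrt (real n / (2 * ln (ln (real n)))) * d n)"
        using eq(1)[of n] by (simp only: mult_ac)
      then show "c \<le> sqrt (real n / (2 * ln (ln (real n)))) * d n" using eq(2)[of n] n by (simp only: mult_le_cancel_left_pos)
    qed
  }
qed

lemma lil_estimator:
  fixes d :: "nat \<Rightarrow> real"
  assumes up: "lil (\<lambda>n. real n * d n) (sqrt 2 * \<sigma>)" and dn: "lil (\<lambda>n. - (real n * d n)) (sqrt 2 * \<sigma>)"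
    and \<sigma>: "0 \<le> \<sigma>"
  shows "limsup (\<lambda>n. ereal (sqrt (real n / (2 * ln (ln (real n)))) * d n)) = ereal \<sigma>"
    and "liminf (\<lambda>n. ereal (sqrt (real n / (2 * ln (ln (real n)))) * d n)) = - ereal \<sigma>"
    and "limsup (\<lambda>n. ereal (real n / (2 * ln (ln (real n))) * (d n)\<^sup>2)) = ereal (\<sigma>\<^sup>2)"
proof -
  define D where "D n = sqrt (real n / (2 * ln (ln (real n)))) * d n" for n
  note u = lil_estimator_bounds[OF up refl, folded D_def]
  have "lil (\<lambda>n. - (real n * d n)) (sqrt 2 * \<sigma>) \<Longrightarrow> (\<And>n. - (real n * d n) = real n * - d n)" by simp
  note l = lil_estimator_bounds[OF dn this[OF dn], simplified mult_minus_right, folded D_def]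
  show "limsup (\<lambda>n. ereal (sqrt (real n / (2 * ln (ln (real n)))) * d n)) = ereal \<sigma>"
    using limsup_of_eventually_frequently[OF u] by (simp add: D_def)
  have "limsup (\<lambda>n. - ereal (D n)) = ereal \<sigma>"
    using limsup_of_eventually_frequently[OF l] by simp
  then have "- liminf (\<lambda>n. ereal (D n)) = ereal \<sigma>" using ereal_Limsup_uminus[of sequentially "\<lambda>n. ereal (D n)"] by simp
  then show "liminf (\<lambda>n. ereal (sqrt (real n / (2 * ln (ln (real n)))) * d n)) = - ereal \<sigma>"
    by (simp add: D_def ereal_uminus_eq_reorder)
  have "limsup (\<lambda>n. ereal ((D n)\<^sup>2)) = ereal (\<sigma>\<^sup>2)"
  proof (rule limsup_of_eventually_frequently)
    fix c assume c: "\<sigma>\<^sup>2 < c"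
    then have c0: "0 \<le> c" using zero_le_power2[of \<sigma>] by linarith
    have "\<sigma> < sqrt c" using c \<sigma> by (intro real_less_rsqrt)
    from u(1)[OF this] l(1)[OF this] show "\<forall>\<^sub>F n in sequentially. (D n)\<^sup>2 \<le> c"
    proof eventually_elim
      case (elim n)
      then have "\<bar>D n\<bar> \<le> sqrt c" by linarith
      then have "\<bar>D n\<bar>\<^sup>2 \<le> (sqrt c)\<^sup>2" by (intro power_mono) auto
      then show ?case using c0 by simp
    qed
  next
    fix c assume c: "c < \<sigma>\<^sup>2"
    show "\<exists>\<^sub>F n in sequentially. c \<le> (D n)\<^sup>2"
    proof (cases "c < 0")
      case True
      have "\<forall>\<^sub>F n in sequentially. c \<le> (D n)\<^sup>2" using True by (intro always_eventually allI) (simp add: less_imp_le order_trans[OF less_imp_le zero_le_power2])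
      then show ?thesis by (rule eventually_frequently[rotated]) simp
    next
      case False
      have "sqrt c < \<sigma>" using c \<sigma> False by (intro real_less_lsqrt) auto
      from u(2)[OF this] show ?thesis
      proof (rule frequently_elim1)
        fix n assume "sqrt c \<le> D n"
        then have "(sqrt c)\<^sup>2 \<le> (D n)\<^sup>2" using False by (intro power_mono) auto
        then show "c \<le> (D n)\<^sup>2" using False by simp
      qed
    qed
  qed
  moreover have "\<forall>\<^sub>F n in sequentially. ereal (real n / (2 * ln (ln (real n))) * (d n)\<^sup>2) = ereal ((D n)\<^sup>2)"
  proof -
    have "\<forall>\<^sub>F n in sequentially. 0 < ln (ln (real n))" by real_asymp
    then show ?thesis by eventually_elim (simp add: D_def power_mult_distrib)
  qed
  ultimately show "limsup (\<lambda>n. ereal (real n / (2 * ln (ln (real n))) * (d n)\<^sup>2)) = ereal (\<sigma>\<^sup>2)"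
    by (simp only: Limsup_eq)
qed

section \<open>Linearization of the serial correlation estimator\<close>

lemma theta_hat_alt: "theta_hat x n = (\<Sum>k<n. x (Suc k) * x k) / (\<Sum>k<n. (x k)\<^sup>2)"
  unfolding theta_hat_def by (simp add: sum.atLeast1_atMost_eq)

definition residual_energy :: "(nat \<Rightarrow> real) \<Rightarrow> nat \<Rightarrow> real" where
  "residual_energy x n = (\<Sum>k<n. (residual x n k)\<^sup>2)"

text \<open>
At \<open>k = 0\<close> the residual is \<open>x 0\<close>, as if the trajectory were preceded by the value 0; this accounts for
the boundary terms in the sums below.
\<close>

lemma rho_hat_alt: "rho_hat x n = (\<Sum>k<n. residual x n (Suc k) * residual x n k) / residual_energy x n"
  unfolding rho_hat_def residual_energy_def by (simp add: sum.atLeast1_atMost_eq)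

lemma residual_cross_sum:
  assumes "t = theta_hat x (Suc m)"
  shows "(\<Sum>k<Suc m. residual x (Suc m) (Suc k) * residual x (Suc m) k)
    = (\<Sum>k<Suc m. x (Suc k) * x k) - t * (\<Sum>k<Suc m. (x k)\<^sup>2) - t * (\<Sum>k<m. x (Suc (Suc k)) * x k)
      + t\<^sup>2 * (\<Sum>k<m. x (Suc k) * x k)"
proof -
  have "(\<Sum>k<Suc m. residual x (Suc m) (Suc k) * residual x (Suc m) k)
    = (x 1 - t * x 0) * x 0 + (\<Sum>k<m. (x (Suc (Suc k)) - t * x (Suc k)) * (x (Suc k) - t * x k))"
    unfolding sum.lessThan_Suc_shift by (simp add: residual_def assms)
  also have "\<dots> = (\<Sum>k<Suc m. x (Suc k) * x k) - t * (\<Sum>k<Suc m. (x k)\<^sup>2) - t * (\<Sum>k<m. x (Suc (Suc k)) * x k)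
      + t\<^sup>2 * (\<Sum>k<m. x (Suc k) * x k)"
    by (induction m) (simp_all add: algebra_simps power2_eq_square)
  finally show ?thesis .
qed

lemma residual_square_sum:
  assumes "t = theta_hat x (Suc m)"
  shows "residual_energy x (Suc m)
    = (\<Sum>k<Suc m. (x k)\<^sup>2) - 2 * t * (\<Sum>k<m. x (Suc k) * x k) + t\<^sup>2 * (\<Sum>k<m. (x k)\<^sup>2)"
proof -
  have "residual_energy x (Suc m) = (x 0)\<^sup>2 + (\<Sum>k<m. (x (Suc k) - t * x k)\<^sup>2)"
    unfolding residual_energy_def sum.lessThan_Suc_shift by (simp add: residual_def assms)
  also have "\<dots> = (\<Sum>k<Suc m. (x k)\<^sup>2) - 2 * t * (\<Sum>k<m. x (Suc k) * x k) + t\<^sup>2 * (\<Sum>k<m. (x k)\<^sup>2)"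
    by (induction m) (simp_all add: algebra_simps power2_eq_square)
  finally show ?thesis .
qed

text \<open>
An exact identity. Inserting the recursion into the two sums of residuals, every quantity of
order \<open>n\<close> cancels and the deviation of the estimator from \<open>- b * \<tau>\<close> becomes a combination of the
two martingales \<open>\<Sum> u\<^sub>k x\<^sub>k\<close> and \<open>\<Sum> u\<^bsub>k + 1\<^esub> x\<^sub>k\<close> plus boundary terms that involve only the first and the
last two observations.
\<close>

lemma rho_hat_expansion:
  fixes x u :: "nat \<Rightarrow> real" and a b \<tau> t :: real and m :: nat
  assumes rec: "\<And>k. x (Suc (Suc k)) = a * x (Suc k) + b * x k + u (Suc k)"
    and b: "b \<noteq> 1" and \<tau>: "\<tau> = a / (1 - b)" and t: "t = theta_hat x (Suc m)"
    and S: "(\<Sum>k<Suc m. (x k)\<^sup>2) \<noteq> 0" and D: "residual_energy x (Suc m) \<noteq> 0"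
  shows "rho_hat x (Suc m) + b * \<tau> =
    ((t\<^sup>2 - b * (1 - t\<^sup>2) / (1 - b)) * ((\<Sum>k<Suc m. u k * x k)
          + (x 1 * x 0 - a * (x 0)\<^sup>2 - u 0 * x 0 - b * (x (Suc m) * x m)))
       - t * ((\<Sum>k<m. u (Suc k) * x k) - a * (x (Suc m) * x m) - b * (x m)\<^sup>2)
       - t\<^sup>2 * (x (Suc m) * x m) + b * \<tau> * (2 * t * (x (Suc m) * x m) - t\<^sup>2 * (x m)\<^sup>2))
    / residual_energy x (Suc m)"
proof -
  define SS where "SS = (\<Sum>k<Suc m. (x k)\<^sup>2)"
  define P where "P = (\<Sum>k<Suc m. x (Suc k) * x k)"
  define MM where "MM = (\<Sum>k<Suc m. u k * x k)
          + (x 1 * x 0 - a * (x 0)\<^sup>2 - u 0 * x 0 - b * (x (Suc m) * x m))"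
  define NN where "NN = (\<Sum>k<m. u (Suc k) * x k)"
  define y where "y = x (Suc m) * x m"
  define z where "z = (x m)\<^sup>2"
  have "t = P / SS" unfolding t theta_hat_alt P_def SS_def ..
  then have P: "P = t * SS" using S by (simp add: SS_def)
  have a: "a = \<tau> * (1 - b)" using b by (simp add: \<tau>)
  have Pm: "(\<Sum>k<m. x (Suc k) * x k) = P - y" by (simp add: P_def y_def)
  have Sm: "(\<Sum>k<m. (x k)\<^sup>2) = SS - z" by (simp add: SS_def z_def)
  have "(1 - b) * P - a * SS = MM"
    unfolding P_def SS_def MM_def ar2_cross_identity[of x a b u, OF rec]
    by (simp add: rec[of m] algebra_simps power2_eq_square)
  then have MM: "MM = (1 - b) * (t - \<tau>) * SS" by (simp add: P a algebra_simps)
  have Q: "(\<Sum>k<m. x (Suc (Suc k)) * x k) = a * (P - y) + b * (SS - z) + NN"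
    unfolding Pm[symmetric] Sm[symmetric] NN_def sum_distrib_left sum.distrib[symmetric]
    by (intro sum.cong) (auto simp: rec algebra_simps power2_eq_square)
  have num: "(\<Sum>k<Suc m. residual x (Suc m) (Suc k) * residual x (Suc m) k)
     = P - t * SS - t * (a * (P - y) + b * (SS - z) + NN) + t\<^sup>2 * (P - y)"
    unfolding residual_cross_sum[OF t] Q Pm P_def[symmetric] SS_def[symmetric] ..
  have den: "residual_energy x (Suc m) = SS - 2 * t * (P - y) + t\<^sup>2 * (SS - z)"
    unfolding residual_square_sum[OF t] Pm Sm SS_def[symmetric] ..
  have "(t\<^sup>2 - b * (1 - t\<^sup>2) / (1 - b)) * MM = (t\<^sup>2 * (1 - b) - b * (1 - t\<^sup>2)) * (t - \<tau>) * SS"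
  proof -
    have "(t\<^sup>2 - b * (1 - t\<^sup>2) / (1 - b)) * (1 - b) = t\<^sup>2 * (1 - b) - b * (1 - t\<^sup>2)"
      using b by (simp add: left_diff_distrib)
    then show ?thesis unfolding MM mult.assoc[symmetric] by simp
  qed
  then have "(P - t * SS - t * (a * (P - y) + b * (SS - z) + NN) + t\<^sup>2 * (P - y))
       + b * \<tau> * (SS - 2 * t * (P - y) + t\<^sup>2 * (SS - z))
    = (t\<^sup>2 - b * (1 - t\<^sup>2) / (1 - b)) * MM - t * (NN - a * y - b * z) - t\<^sup>2 * y + b * \<tau> * (2 * t * y - t\<^sup>2 * z)"
    unfolding P by (simp add: a algebra_simps power2_eq_square)
  then have eq: "(P - t * SS - t * (a * (P - y) + b * (SS - z) + NN) + t\<^sup>2 * (P - y)) + b * \<tau> * residual_energy x (Suc m)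
    = (t\<^sup>2 - b * (1 - t\<^sup>2) / (1 - b)) * MM - t * (NN - a * y - b * z) - t\<^sup>2 * y + b * \<tau> * (2 * t * y - t\<^sup>2 * z)"
    unfolding den .
  have "rho_hat x (Suc m) + b * \<tau> = ((P - t * SS - t * (a * (P - y) + b * (SS - z) + NN) + t\<^sup>2 * (P - y)) + b * \<tau> * residual_energy x (Suc m)) / residual_energy x (Suc m)"
  proof -
    have "A / d + c = (A + c * d) / d" if "d \<noteq> 0" for A c d :: real using that by (simp add: add_divide_distrib)
    then show ?thesis unfolding rho_hat_alt num using D by blast
  qed
  then show ?thesis unfolding eq unfolding MM_def NN_def y_def z_def .
qed

lemma log_average_square_weights:
  fixes w \<beta> :: "nat \<Rightarrow> real"
  assumes w: "(\<lambda>n. (\<Sum>k=1..n. (w k / real k)\<^sup>2) / ln (real n)) \<longlonglongrightarrow> v" and \<beta>: "\<beta> \<longlonglongrightarrow> B"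
  shows "(\<lambda>n. (\<Sum>k=1..n. (\<beta> k * w k / real k)\<^sup>2) / ln (real n)) \<longlonglongrightarrow> B\<^sup>2 * v"
  using log_average_weights[of "\<lambda>k. (w k / real k)\<^sup>2" v "\<lambda>k. (\<beta> k)\<^sup>2" "B\<^sup>2"] w tendsto_power[OF \<beta>, of 2]
  by (simp add: power_mult_distrib power_divide)

lemma log_average_square_of_small:
  fixes d :: "nat \<Rightarrow> real"
  assumes d: "(\<lambda>n. d n / sqrt (real n)) \<longlonglongrightarrow> 0"
  shows "(\<lambda>n. (\<Sum>k=1..n. (d k / real k)\<^sup>2) / ln (real n)) \<longlonglongrightarrow> 0"
proof -
  have "(\<lambda>n. (\<Sum>k=1..n. (d k / sqrt (real k))\<^sup>2 / real k) / ln (real n)) \<longlonglongrightarrow> 0"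
    by (rule log_average) (use tendsto_power[OF d, of 2] in simp)
  then show ?thesis by (simp add: power_divide power2_eq_square)
qed

text \<open>
In the exact expansion the random coefficients converge, since \<open>theta_hat\<close> tends to \<open>\<tau>\<close>. Freezing
them at their limits costs remainders that are null coefficients times the two martingales,
negligible both at the iterated-logarithm scale and in logarithmic quadratic mean.
\<close>

lemma rho_hat_linearization:
  fixes x u Mu Nu :: "nat \<Rightarrow> real" and a b \<tau> s c1 :: real
  assumes Mu_def: "\<And>n. Mu n = (\<Sum>k<n. u k * x k)" and Nu_def: "\<And>n. Nu n = (\<Sum>k<n - 1. u (Suc k) * x k)"
    and c1_def: "c1 = \<tau>\<^sup>2 - b * (1 - \<tau>\<^sup>2) / (1 - b)"
    and rec: "\<And>k. x (Suc (Suc k)) = a * x (Suc k) + b * x k + u (Suc k)"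
    and b: "b \<noteq> 1" and \<tau>: "\<tau> = a / (1 - b)" "\<tau>\<^sup>2 < 1" and s: "0 < s"
    and S: "(\<lambda>n. (\<Sum>k<n. (x k)\<^sup>2) / real n) \<longlonglongrightarrow> s"
    and P: "(\<lambda>n. (\<Sum>k<n. x (Suc k) * x k) / real n) \<longlonglongrightarrow> \<tau> * s"
    and x4: "(\<lambda>n. x n ^ 4 / real n) \<longlonglongrightarrow> 0"
    and Mb: "lil_bounded Mu" "(\<lambda>n. (\<Sum>k=1..n. (Mu k / real k)\<^sup>2) / ln (real n)) \<longlonglongrightarrow> vM"
    and Nb: "lil_bounded Nu" "(\<lambda>n. (\<Sum>k=1..n. (Nu k / real k)\<^sup>2) / ln (real n)) \<longlonglongrightarrow> vN"
  obtains \<alpha> q where "\<And>n. real n * (rho_hat x n + b * \<tau>) = \<alpha> n * (c1 * Mu n - \<tau> * Nu n) + q n"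
    "\<alpha> \<longlonglongrightarrow> 1 / (s * (1 - \<tau>\<^sup>2))" "(\<lambda>n. q n / lil_rate n) \<longlonglongrightarrow> 0"
    "(\<lambda>n. (\<Sum>k=1..n. (q k / real k)\<^sup>2) / ln (real n)) \<longlonglongrightarrow> 0"
proof -
  define t where "t n = theta_hat x n" for n
  define y where "y n = x n * x (n - 1)" for n
  define z where "z n = (x (n - 1))\<^sup>2" for n
  have x2: "(\<lambda>n. (x n)\<^sup>2 / sqrt (real n)) \<longlonglongrightarrow> 0"
  proof -
    have "(\<lambda>n. sqrt (x n ^ 4 / real n)) \<longlonglongrightarrow> sqrt 0" by (intro tendsto_intros x4)
    moreover have "sqrt (x n ^ 4) = (x n)\<^sup>2" for n
      using real_sqrt_abs[of "(x n)\<^sup>2"] by (simp flip: power_mult)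
    ultimately show ?thesis by (simp add: real_sqrt_divide)
  qed
  have z: "(\<lambda>n. z n / sqrt (real n)) \<longlonglongrightarrow> 0"
  proof -
    have "(\<lambda>n. (x n)\<^sup>2 / sqrt (real n) * sqrt (real n / real (Suc n))) \<longlonglongrightarrow> 0 * 1"
      by (intro tendsto_mult x2) real_asymp
    then have "(\<lambda>n. (x n)\<^sup>2 / sqrt (real n) * sqrt (real n / real (Suc n))) \<longlonglongrightarrow> 0" by simp
    then have "(\<lambda>n. z (Suc n) / sqrt (real (Suc n))) \<longlonglongrightarrow> 0"
    proof (rule Lim_transform_eventually)
      show "\<forall>\<^sub>F n in sequentially. (x n)\<^sup>2 / sqrt (real n) * sqrt (real n / real (Suc n)) = z (Suc n) / sqrt (real (Suc n))"
        using eventually_gt_at_top[of 0]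
        by eventually_elim (simp add: z_def real_sqrt_divide del: of_nat_Suc)
    qed
    then show ?thesis by (rule LIMSEQ_imp_Suc)
  qed
  have y: "(\<lambda>n. y n / sqrt (real n)) \<longlonglongrightarrow> 0"
  proof (rule Lim_null_comparison)
    show "(\<lambda>n. (x n)\<^sup>2 / sqrt (real n) + z n / sqrt (real n)) \<longlonglongrightarrow> 0"
      using tendsto_add[OF x2 z] by simp
    have "\<bar>y n\<bar> \<le> (x n)\<^sup>2 + z n" for n
      unfolding y_def z_def by (rule abs_mult_le_sum_squares)
    then show "\<forall>\<^sub>F n in sequentially. norm (y n / sqrt (real n)) \<le> (x n)\<^sup>2 / sqrt (real n) + z n / sqrt (real n)"
      by (simp add: add_divide_distrib[symmetric] divide_right_mono)
  qed
  have over_n: "(\<lambda>n. d n / real n) \<longlonglongrightarrow> 0" if "(\<lambda>n. d n / sqrt (real n)) \<longlonglongrightarrow> 0" for d :: "nat \<Rightarrow> real"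
  proof -
    have "(\<lambda>n. d n / sqrt (real n) * (1 / sqrt (real n))) \<longlonglongrightarrow> 0 * 0"
      by (intro tendsto_mult that) real_asymp
    then show ?thesis by simp
  qed
  have t: "t \<longlonglongrightarrow> \<tau>"
  proof -
    have "(\<lambda>n. ((\<Sum>k<n. x (Suc k) * x k) / real n) / ((\<Sum>k<n. (x k)\<^sup>2) / real n)) \<longlonglongrightarrow> \<tau> * s / s"
      by (intro tendsto_intros S P) (use s in auto)
    moreover have "\<tau> * s / s = \<tau>" using s by simp
    moreover have "\<forall>\<^sub>F n in sequentially. ((\<Sum>k<n. x (Suc k) * x k) / real n) / ((\<Sum>k<n. (x k)\<^sup>2) / real n) = t n"
      using eventually_gt_at_top[of 0] by eventually_elim (simp add: t_def theta_hat_alt)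
    ultimately show ?thesis by (auto intro: Lim_transform_eventually)
  qed
  define E where "E n = residual_energy x n" for n
  have E: "(\<lambda>n. E n / real n) \<longlonglongrightarrow> s * (1 - \<tau>\<^sup>2)"
  proof -
    have "(\<lambda>n. (\<Sum>k<n. (x k)\<^sup>2) / real n - 2 * t n * ((\<Sum>k<n. x (Suc k) * x k) / real n - y n / real n)
       + (t n)\<^sup>2 * ((\<Sum>k<n. (x k)\<^sup>2) / real n - z n / real n)) \<longlonglongrightarrow> s - 2 * \<tau> * (\<tau> * s - 0) + \<tau>\<^sup>2 * (s - 0)"
      by (intro tendsto_intros S P t over_n y z)
    moreover have "s - 2 * \<tau> * (\<tau> * s - 0) + \<tau>\<^sup>2 * (s - 0) = s * (1 - \<tau>\<^sup>2)" by (simp add: algebra_simps power2_eq_square)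
    moreover have "\<forall>\<^sub>F n in sequentially. (\<Sum>k<n. (x k)\<^sup>2) / real n - 2 * t n * ((\<Sum>k<n. x (Suc k) * x k) / real n - y n / real n)
       + (t n)\<^sup>2 * ((\<Sum>k<n. (x k)\<^sup>2) / real n - z n / real n) = E n / real n"
      using eventually_gt_at_top[of 0]
    proof eventually_elim
      case (elim n)
      then obtain m where m: "n = Suc m" by (cases n) auto
      have "E n = (\<Sum>k<n. (x k)\<^sup>2) - 2 * t n * ((\<Sum>k<n. x (Suc k) * x k) - y n) + (t n)\<^sup>2 * ((\<Sum>k<n. (x k)\<^sup>2) - z n)"
        unfolding E_def m residual_square_sum[OF refl] t_def by (simp add: y_def z_def)
      then show ?case by (simp add: add_divide_distrib diff_divide_distrib right_diff_distrib)
    qed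
    ultimately show ?thesis by (auto intro: Lim_transform_eventually)
  qed
  define A where "A = s * (1 - \<tau>\<^sup>2)"
  have A: "0 < A" using s \<tau> by (simp add: A_def)
  define \<alpha> where "\<alpha> n = real n / E n" for n
  have \<alpha>: "\<alpha> \<longlonglongrightarrow> 1 / A"
    using tendsto_divide[OF tendsto_const[of 1] E] s \<tau>(2) by (simp add: \<alpha>_def[abs_def] A_def)
  define ct where "ct n = (t n)\<^sup>2 - b * (1 - (t n)\<^sup>2) / (1 - b)" for n
  have ct: "ct \<longlonglongrightarrow> c1" unfolding ct_def c1_def using b by (intro tendsto_intros t) auto
  define R where "R n = ct n * (x 1 * x 0 - a * (x 0)\<^sup>2 - u 0 * x 0 - b * y n) + t n * (a * y n + b * z n)
      - (t n)\<^sup>2 * y n + b * \<tau> * (2 * t n * y n - (t n)\<^sup>2 * z n)" for n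
  have R: "(\<lambda>n. R n / sqrt (real n)) \<longlonglongrightarrow> 0"
  proof -
    have k: "(\<lambda>n. (x 1 * x 0 - a * (x 0)\<^sup>2 - u 0 * x 0) / sqrt (real n)) \<longlonglongrightarrow> 0" by real_asymp
    have "(\<lambda>n. ct n * ((x 1 * x 0 - a * (x 0)\<^sup>2 - u 0 * x 0) / sqrt (real n) - b * (y n / sqrt (real n)))
      + t n * (a * (y n / sqrt (real n)) + b * (z n / sqrt (real n)))
      - (t n)\<^sup>2 * (y n / sqrt (real n)) + b * \<tau> * (2 * t n * (y n / sqrt (real n)) - (t n)\<^sup>2 * (z n / sqrt (real n))))
      \<longlonglongrightarrow> c1 * (0 - b * 0) + \<tau> * (a * 0 + b * 0) - \<tau>\<^sup>2 * 0 + b * \<tau> * (2 * \<tau> * 0 - \<tau>\<^sup>2 * 0)"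
      by (intro tendsto_intros k ct t y z)
    moreover have "ct n * ((x 1 * x 0 - a * (x 0)\<^sup>2 - u 0 * x 0) / sqrt (real n) - b * (y n / sqrt (real n)))
      + t n * (a * (y n / sqrt (real n)) + b * (z n / sqrt (real n)))
      - (t n)\<^sup>2 * (y n / sqrt (real n)) + b * \<tau> * (2 * t n * (y n / sqrt (real n)) - (t n)\<^sup>2 * (z n / sqrt (real n)))
      = R n / sqrt (real n)" for n
      unfolding R_def by (simp add: add_divide_distrib diff_divide_distrib algebra_simps)
    ultimately show ?thesis by simp
  qed
  (* The remainder that the expansion predicts; the remainder q defined by subtraction agrees with it
     once the denominators are positive, and differs for at most finitely many n. *)
  define q' where "q' n = \<alpha> n * (ct n - c1) * Mu n + \<alpha> n * (\<tau> - t n) * Nu n + \<alpha> n * R n" for n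
  define q where "q n = real n * (rho_hat x n + b * \<tau>) - \<alpha> n * (c1 * Mu n - \<tau> * Nu n)" for n
  have qq: "\<forall>\<^sub>F n in sequentially. q n = q' n"
  proof -
    have "\<forall>\<^sub>F n in sequentially. 0 < E n / real n" using E A unfolding A_def by (rule order_tendstoD)
    moreover have "\<forall>\<^sub>F n in sequentially. 0 < (\<Sum>k<n. (x k)\<^sup>2) / real n" using S s by (rule order_tendstoD)
    ultimately show ?thesis using eventually_gt_at_top[of 0]
    proof eventually_elim
      case (elim n)
      then obtain m where m: "n = Suc m" by (cases n) auto
      have S0: "(\<Sum>k<Suc m. (x k)\<^sup>2) \<noteq> 0" and D0: "residual_energy x (Suc m) \<noteq> 0"
        using elim(1,2) unfolding m E_def by auto
      have eq: "rho_hat x n + b * \<tau> = (ct n * Mu n - t n * Nu n + R n) / E n"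
      proof -
        have "rho_hat x n + b * \<tau> = (ct n * (Mu n + (x 1 * x 0 - a * (x 0)\<^sup>2 - u 0 * x 0 - b * y n))
            - t n * (Nu n - a * y n - b * z n) - (t n)\<^sup>2 * y n + b * \<tau> * (2 * t n * y n - (t n)\<^sup>2 * z n)) / E n"
          using rho_hat_expansion[OF rec b \<tau>(1) refl S0 D0]
          unfolding m E_def ct_def t_def Mu_def Nu_def y_def z_def diff_Suc_1 .
        also have "\<dots> = (ct n * Mu n - t n * Nu n + R n) / E n"
          unfolding R_def by (intro arg_cong2[where f = "(/)"] refl) (simp add: algebra_simps)
        finally show ?thesis .
      qed
      have "real n * (rho_hat x n + b * \<tau>) = \<alpha> n * (ct n * Mu n - t n * Nu n + R n)"
        unfolding eq \<alpha>_def by simp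
      then show ?case unfolding q_def q'_def by (simp add: algebra_simps)
    qed
  qed
  have ac: "(\<lambda>n. \<alpha> n * (ct n - c1)) \<longlonglongrightarrow> 0" "(\<lambda>n. \<alpha> n * (\<tau> - t n)) \<longlonglongrightarrow> 0"
    using tendsto_mult[OF \<alpha> tendsto_diff[OF ct tendsto_const[of c1]]] tendsto_mult[OF \<alpha> tendsto_diff[OF tendsto_const[of \<tau>] t]] by simp_all
  have aR: "(\<lambda>n. \<alpha> n * R n / sqrt (real n)) \<longlonglongrightarrow> 0"
    using tendsto_mult[OF \<alpha> R] by simp
  have q1: "(\<lambda>n. q' n / lil_rate n) \<longlonglongrightarrow> 0"
  proof -
    have "(\<lambda>n. sqrt (real n) / lil_rate n) \<longlonglongrightarrow> 0" unfolding lil_rate_def by real_asymp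
    from tendsto_mult[OF aR this] have "(\<lambda>n. \<alpha> n * R n / sqrt (real n) * (sqrt (real n) / lil_rate n)) \<longlonglongrightarrow> 0" by simp
    then have "(\<lambda>n. \<alpha> n * R n / lil_rate n) \<longlonglongrightarrow> 0"
    proof (rule Lim_transform_eventually)
      show "\<forall>\<^sub>F n in sequentially. \<alpha> n * R n / sqrt (real n) * (sqrt (real n) / lil_rate n) = \<alpha> n * R n / lil_rate n"
        using eventually_gt_at_top[of 0] by eventually_elim simp
    qed
    from tendsto_add[OF tendsto_add[OF lil_bounded_null_mult[OF Mb(1) ac(1)] lil_bounded_null_mult[OF Nb(1) ac(2)]] this]
    show ?thesis by (simp add: q'_def add_divide_distrib)
  qed
  have q2: "(\<lambda>n. (\<Sum>k=1..n. (q' k / real k)\<^sup>2) / ln (real n)) \<longlonglongrightarrow> 0"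
  proof -
    have 1: "(\<lambda>n. (\<Sum>k=1..n. (\<alpha> k * (ct k - c1) * Mu k / real k)\<^sup>2) / ln (real n)) \<longlonglongrightarrow> 0"
      using log_average_square_weights[OF Mb(2) ac(1)] by simp
    have 2: "(\<lambda>n. (\<Sum>k=1..n. (\<alpha> k * (\<tau> - t k) * Nu k / real k)\<^sup>2) / ln (real n)) \<longlonglongrightarrow> 0"
      using log_average_square_weights[OF Nb(2) ac(2)] by simp
    show ?thesis unfolding q'_def add_divide_distrib
      by (intro log_average_square_perturb 1 2 log_average_square_of_small aR)
  qed
  show thesis
  proof (rule that[of \<alpha> q])
    show "\<alpha> \<longlonglongrightarrow> 1 / (s * (1 - \<tau>\<^sup>2))" using \<alpha> by (simp add: A_def)
    show "(\<lambda>n. q n / lil_rate n) \<longlonglongrightarrow> 0"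
      by (rule Lim_transform_eventually[OF q1]) (use qq in \<open>auto elim: eventually_mono\<close>)
    have "(\<lambda>n. (\<Sum>k=1..n. (q' k / real k + (q k - q' k) / real k)\<^sup>2) / ln (real n)) \<longlonglongrightarrow> 0"
    proof (rule log_average_square_perturb[OF q2 log_average_square_of_small])
      show "(\<lambda>n. (q n - q' n) / sqrt (real n)) \<longlonglongrightarrow> 0"
        by (rule tendsto_eventually) (use qq in \<open>auto elim: eventually_mono\<close>)
    qed
    then show "(\<lambda>n. (\<Sum>k=1..n. (q k / real k)\<^sup>2) / ln (real n)) \<longlonglongrightarrow> 0"
      by (simp add: add_divide_distrib[symmetric])
  qed (simp add: q_def)
qed

section \<open>Impulse response and limiting variance\<close>

primrec ar2_impulse :: "real \<Rightarrow> real \<Rightarrow> nat \<Rightarrow> real" where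
  "ar2_impulse \<theta> \<rho> 0 = 1"
| "ar2_impulse \<theta> \<rho> (Suc j) = \<theta> * ar2_impulse \<theta> \<rho> j + \<rho> ^ Suc j"

lemma ar2_impulse_rec:
  "ar2_impulse \<theta> \<rho> (Suc (Suc j)) = (\<theta> + \<rho>) * ar2_impulse \<theta> \<rho> (Suc j) + - (\<theta> * \<rho>) * ar2_impulse \<theta> \<rho> j"
  by (simp add: algebra_simps)

text \<open>
The impulse response of \<open>c1 * x k + c2 * x (k - 1)\<close> when \<open>x\<close> has impulse response \<open>d\<close>.
\<close>

definition two_lag :: "(nat \<Rightarrow> real) \<Rightarrow> real \<Rightarrow> real \<Rightarrow> nat \<Rightarrow> real" where
  "two_lag d c1 c2 j = c1 * d j + c2 * case_nat 0 d j"

text \<open>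
Eliminating the error process turns the model into an autoregression of order two with
coefficients \<open>a\<close> and \<open>b\<close>; \<open>\<tau>\<close> is the limit of \<open>theta_hat\<close>, and \<open>r\<close> a rate strictly between
\<open>max \<bar>\<theta>\<bar> \<bar>\<rho>\<bar>\<close> and 1.
\<close>

locale stationary_ar =
  fixes \<theta> \<rho> :: real
  assumes \<theta>: "\<bar>\<theta>\<bar> < 1" and \<rho>: "\<bar>\<rho>\<bar> < 1"
begin

definition "d = ar2_impulse \<theta> \<rho>"
definition "a = \<theta> + \<rho>"
definition "b = - (\<theta> * \<rho>)"
definition "\<tau> = a / (1 - b)"
definition "\<Delta> = (1 + b) * ((1 - b)\<^sup>2 - a\<^sup>2)"
definition "r = (max \<bar>\<theta>\<bar> \<bar>\<rho>\<bar> + 1) / 2"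

lemma r: "0 < r" "r < 1" "\<bar>\<theta>\<bar> < r" "\<bar>\<rho>\<bar> \<le> r"
  using \<theta> \<rho> by (auto simp: r_def max_def)

lemma b_bound: "0 < 1 - b" "0 < 1 + b" "b \<noteq> 1"
proof -
  have "\<bar>\<theta>\<bar> * \<bar>\<rho>\<bar> < 1 * 1" using \<theta> \<rho> by (intro mult_strict_mono') auto
  then have "\<bar>\<theta> * \<rho>\<bar> < 1" by (simp add: abs_mult)
  then show "0 < 1 - b" "0 < 1 + b" "b \<noteq> 1" by (auto simp: b_def)
qed

lemma disc: "(1 - b)\<^sup>2 - a\<^sup>2 = (1 - \<theta>\<^sup>2) * (1 - \<rho>\<^sup>2)"
  by (simp add: a_def b_def power2_eq_square algebra_simps)

lemma disc_pos: "0 < (1 - b)\<^sup>2 - a\<^sup>2"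
  unfolding disc using \<theta> \<rho> by (simp add: abs_square_less_1)

lemma \<Delta>_pos: "0 < \<Delta>"
  unfolding \<Delta>_def using disc_pos b_bound by simp

lemma \<tau>_square: "1 - \<tau>\<^sup>2 = ((1 - b)\<^sup>2 - a\<^sup>2) / (1 - b)\<^sup>2" "\<tau>\<^sup>2 < 1"
proof -
  show 1: "1 - \<tau>\<^sup>2 = ((1 - b)\<^sup>2 - a\<^sup>2) / (1 - b)\<^sup>2"
    using b_bound by (simp add: \<tau>_def power_divide diff_divide_distrib)
  have "0 < 1 - \<tau>\<^sup>2" unfolding 1 using disc_pos b_bound by simp
  then show "\<tau>\<^sup>2 < 1" by simp
qed

lemma d_rec: "d (Suc (Suc j)) = a * d (Suc j) + b * d j"
  unfolding d_def a_def b_def by (rule ar2_impulse_rec)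

lemma d_0: "d 0 = 1" "d (Suc 0) = a"
  by (simp_all add: d_def a_def)

lemma d_bound: obtains C where "\<And>j. \<bar>d j\<bar> \<le> C * r ^ j"
proof -
  have "d (Suc k) = \<theta> * d k + \<rho> * \<rho> ^ k" for k by (simp add: d_def)
  from two_root_recursion_bound[of d, OF this r(3,4)] show thesis using that by blast
qed

lemma two_lag_bound: obtains C where "\<And>j. \<bar>two_lag d c1 c2 j\<bar> \<le> C * r ^ j"
proof -
  obtain C where C: "\<And>j. \<bar>d j\<bar> \<le> C * r ^ j" using d_bound by blast
  have C0: "0 \<le> C" using C[of 0] by simp
  have sh: "\<bar>case_nat 0 d j\<bar> \<le> C / r * r ^ j" for j
    using C C0 r(1) by (cases j) auto
  show thesis
  proof (rule that)
    fix j
    have "\<bar>two_lag d c1 c2 j\<bar> \<le> \<bar>c1\<bar> * \<bar>d j\<bar> + \<bar>c2\<bar> * \<bar>case_nat 0 d j\<bar>"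
      unfolding two_lag_def by (intro order_trans[OF abs_triangle_ineq]) (simp add: abs_mult)
    also have "\<dots> \<le> \<bar>c1\<bar> * (C * r ^ j) + \<bar>c2\<bar> * (C / r * r ^ j)"
      by (intro add_mono mult_left_mono C sh) auto
    also have "\<dots> = (\<bar>c1\<bar> * C + \<bar>c2\<bar> * (C / r)) * r ^ j" by (simp add: distrib_right)
    finally show "\<bar>two_lag d c1 c2 j\<bar> \<le> (\<bar>c1\<bar> * C + \<bar>c2\<bar> * (C / r)) * r ^ j" .
  qed
qed

text \<open>
The recursion of the impulse response gives the same two linear equations for these two series
as for the sample moments.
\<close>

lemma d_sums: "(\<lambda>j. (d j)\<^sup>2) sums ((1 - b) / \<Delta>)" "(\<lambda>j. d j * d (Suc j)) sums (a / \<Delta>)"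
proof -
  obtain C where C: "\<And>j. \<bar>d j\<bar> \<le> C * r ^ j" using d_bound by blast
  have C0: "0 \<le> C" using C[of 0] by simp
  have geo: "summable (\<lambda>j. C\<^sup>2 * (r\<^sup>2) ^ j)"
    using r by (intro summable_mult summable_geometric) (simp add: abs_square_less_1)
  have sA: "summable (\<lambda>j. (d j)\<^sup>2)"
  proof (rule summable_comparison_test'[OF geo])
    fix j
    have "\<bar>d j\<bar>\<^sup>2 \<le> (C * r ^ j)\<^sup>2" by (intro power_mono C) auto
    then show "norm ((d j)\<^sup>2) \<le> C\<^sup>2 * (r\<^sup>2) ^ j" by (simp add: power_mult_distrib power_mult[symmetric] mult.commute)
  qed
  have sB: "summable (\<lambda>j. d j * d (Suc j))"
  proof (rule summable_comparison_test'[OF summable_add[OF sA summable_Suc_iff[THEN iffD2, OF sA]]])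
    fix j
    show "norm (d j * d (Suc j)) \<le> (d j)\<^sup>2 + (d (Suc j))\<^sup>2"
      unfolding real_norm_def by (rule abs_mult_le_sum_squares)
  qed
  define A where "A = (\<Sum>j. (d j)\<^sup>2)"
  define B where "B = (\<Sum>j. d j * d (Suc j))"
  have sA: "(\<lambda>j. (d j)\<^sup>2) sums A" and sB: "(\<lambda>j. d j * d (Suc j)) sums B"
    using sA sB by (simp_all add: A_def B_def summable_sums)
  have A1: "(\<lambda>j. (d (Suc j))\<^sup>2) sums (A - 1)" using sA sums_Suc_iff[of "\<lambda>j. (d j)\<^sup>2" "A - 1"] by (simp add: d_0)
  have A2: "(\<lambda>j. (d (Suc (Suc j)))\<^sup>2) sums (A - 1 - a\<^sup>2)" using A1 sums_Suc_iff[of "\<lambda>j. (d (Suc j))\<^sup>2" "A - 1 - a\<^sup>2"] by (simp add: d_0)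
  have B1: "(\<lambda>j. d (Suc j) * d (Suc (Suc j))) sums (B - a)" using sB sums_Suc_iff[of "\<lambda>j. d j * d (Suc j)" "B - a"] by (simp add: d_0)
  have "(\<lambda>j. a * (d (Suc j))\<^sup>2 + b * (d j * d (Suc j))) sums (a * (A - 1) + b * B)"
    by (intro sums_add sums_mult A1 sB)
  moreover have "(\<lambda>j. a * (d (Suc j))\<^sup>2 + b * (d j * d (Suc j))) = (\<lambda>j. d (Suc j) * d (Suc (Suc j)))"
    by (auto simp: d_rec algebra_simps power2_eq_square)
  ultimately have "(\<lambda>j. d (Suc j) * d (Suc (Suc j))) sums (a * (A - 1) + b * B)" by (simp only:)
  from sums_unique2[OF B1 this] have "B - a = a * (A - 1) + b * B" .
  then have eq1: "(1 - b) * B = a * A" by (simp add: algebra_simps)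
  have "(\<lambda>j. a\<^sup>2 * (d (Suc j))\<^sup>2 + b\<^sup>2 * (d j)\<^sup>2 + 2 * a * b * (d j * d (Suc j))) sums (a\<^sup>2 * (A - 1) + b\<^sup>2 * A + 2 * a * b * B)"
    by (intro sums_add sums_mult A1 sA sB)
  moreover have "(\<lambda>j. a\<^sup>2 * (d (Suc j))\<^sup>2 + b\<^sup>2 * (d j)\<^sup>2 + 2 * a * b * (d j * d (Suc j))) = (\<lambda>j. (d (Suc (Suc j)))\<^sup>2)"
    by (auto simp: d_rec algebra_simps power2_eq_square)
  ultimately have "(\<lambda>j. (d (Suc (Suc j)))\<^sup>2) sums (a\<^sup>2 * (A - 1) + b\<^sup>2 * A + 2 * a * b * B)" by (simp only:)
  from sums_unique2[OF A2 this] have "A - 1 - a\<^sup>2 = a\<^sup>2 * (A - 1) + b\<^sup>2 * A + 2 * a * b * B" .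
  then have eq2: "(1 - a\<^sup>2 - b\<^sup>2) * A - 2 * a * b * B = 1" by (simp add: algebra_simps)
  have "\<Delta> * A = (1 - b) * ((1 - a\<^sup>2 - b\<^sup>2) * A - 2 * a * b * B) + 2 * a * b * ((1 - b) * B - a * A)"
    unfolding \<Delta>_def by (simp add: algebra_simps power2_eq_square)
  then have "\<Delta> * A = 1 - b" using eq1 eq2 by simp
  then have A: "A = (1 - b) / \<Delta>" using \<Delta>_pos by (simp add: field_simps)
  have "B = a * A / (1 - b)" using eq1 b_bound by (simp add: field_simps)
  then have "B = a / \<Delta>" using b_bound unfolding A by simp
  with sA sB A show "(\<lambda>j. (d j)\<^sup>2) sums ((1 - b) / \<Delta>)" "(\<lambda>j. d j * d (Suc j)) sums (a / \<Delta>)" by auto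
qed

text \<open>
The squared norm of \<open>two_lag d c1 c2\<close>.
\<close>

definition gain :: "real \<Rightarrow> real \<Rightarrow> real" where
  "gain c1 c2 = (c1\<^sup>2 + c2\<^sup>2) * ((1 - b) / \<Delta>) + 2 * c1 * c2 * (a / \<Delta>)"

lemma two_lag_sums: "(\<lambda>j. (two_lag d c1 c2 j)\<^sup>2) sums gain c1 c2"
proof -
  have "(\<lambda>j. (d (Suc j))\<^sup>2) sums ((1 - b) / \<Delta> - 1)"
    using d_sums(1) sums_Suc_iff[of "\<lambda>j. (d j)\<^sup>2" "(1 - b) / \<Delta> - 1"] by (simp add: d_0)
  then have "(\<lambda>j. c1\<^sup>2 * (d (Suc j))\<^sup>2 + c2\<^sup>2 * (d j)\<^sup>2 + 2 * c1 * c2 * (d j * d (Suc j)))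
     sums (c1\<^sup>2 * ((1 - b) / \<Delta> - 1) + c2\<^sup>2 * ((1 - b) / \<Delta>) + 2 * c1 * c2 * (a / \<Delta>))"
    by (intro sums_add sums_mult d_sums)
  moreover have "(\<lambda>j. c1\<^sup>2 * (d (Suc j))\<^sup>2 + c2\<^sup>2 * (d j)\<^sup>2 + 2 * c1 * c2 * (d j * d (Suc j))) = (\<lambda>j. (two_lag d c1 c2 (Suc j))\<^sup>2)"
    by (auto simp: two_lag_def algebra_simps power2_eq_square)
  moreover have "c1\<^sup>2 * ((1 - b) / \<Delta> - 1) + c2\<^sup>2 * ((1 - b) / \<Delta>) + 2 * c1 * c2 * (a / \<Delta>) = gain c1 c2 - (two_lag d c1 c2 0)\<^sup>2"
    by (simp add: gain_def two_lag_def d_0 algebra_simps)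
  ultimately show ?thesis using sums_Suc_iff[of "\<lambda>j. (two_lag d c1 c2 j)\<^sup>2" "gain c1 c2 - (two_lag d c1 c2 0)\<^sup>2"] by simp
qed

lemma gain_nonneg: "0 \<le> gain c1 c2"
  using two_lag_sums[of c1 c2] by (rule sums_le[OF _ sums_zero, rotated]) simp

lemma rho_star_eq: "rho_star \<theta> \<rho> = - (b * \<tau>)"
  by (simp add: rho_star_def \<tau>_def a_def b_def)

text \<open>
The right-hand side is the variance of the leading martingale, whose weights have norm \<open>gain\<close>,
divided by the square of the limit of the normalized residual energy. Completing the square in
\<open>gain\<close> reduces it to \<open>((b / (1 - b))\<^sup>2 + \<tau>\<^sup>2 / (1 - \<tau>\<^sup>2)) * \<Delta> / (1 - b)\<close>.
\<close>

lemma sigma_rho_sq_eq: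
  "sigma_rho_sq \<theta> \<rho> = gain (\<tau>\<^sup>2 - b * (1 - \<tau>\<^sup>2) / (1 - b)) (- \<tau>) / ((1 - b) / \<Delta> * (1 - \<tau>\<^sup>2))\<^sup>2"
proof -
  define A where "A = (1 - b) / \<Delta>"
  define w where "w = 1 - \<tau>\<^sup>2"
  define D where "D = (1 - b)\<^sup>2 - a\<^sup>2"
  define p where "p = 1 - b"
  have p: "0 < p" "p \<noteq> 0" using b_bound by (auto simp: p_def)
  have D0: "0 < D" using disc_pos by (simp add: D_def)
  have w0: "0 < w" using \<tau>_square(2) by (simp add: w_def)
  have A0: "0 < A" using b_bound \<Delta>_pos by (simp add: A_def)
  have B: "a / \<Delta> = \<tau> * A" unfolding A_def \<tau>_def using b_bound by simp
  have t2: "\<tau>\<^sup>2 = 1 - w" by (simp add: w_def)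
  have "gain (\<tau>\<^sup>2 - b * w / p) (- \<tau>) = A * ((b * w / p)\<^sup>2 + \<tau>\<^sup>2 * w)"
  proof -
    have "gain (\<tau>\<^sup>2 - c) (- \<tau>) = A * (c\<^sup>2 + \<tau>\<^sup>2 * (1 - \<tau>\<^sup>2))" for c
      unfolding gain_def B A_def[symmetric] by (simp add: power2_eq_square algebra_simps)
    then show ?thesis by (simp add: w_def)
  qed
  then have "gain (\<tau>\<^sup>2 - b * w / p) (- \<tau>) / (A * w)\<^sup>2 = ((b / p)\<^sup>2 + \<tau>\<^sup>2 / w) / A"
    using A0 w0 p by (simp add: power2_eq_square field_simps)
  also have "\<tau>\<^sup>2 / w = a\<^sup>2 / D"
    unfolding w_def \<tau>_square(1) using b_bound by (simp add: \<tau>_def D_def power_divide)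
  also have "((b / p)\<^sup>2 + a\<^sup>2 / D) / A = (1 + b) * D / p * ((b / p)\<^sup>2 + a\<^sup>2 / D)"
    unfolding A_def p_def \<Delta>_def D_def by simp
  also have "\<dots> = (1 + b) / p ^ 3 * (a\<^sup>2 * p\<^sup>2 + b\<^sup>2 * D)"
    using D0 p by (simp add: power2_eq_square power3_eq_cube field_simps)
  also have "\<dots> = sigma_rho_sq \<theta> \<rho>"
    unfolding sigma_rho_sq_def D_def disc p_def by (simp add: a_def b_def mult.assoc)
  finally show ?thesis by (simp add: A_def w_def p_def)
qed

end

section \<open>Limit laws of the linear functionals of the autoregression\<close>

context iid_noise begin

lemma lin_Suc: "lin g (Suc k) \<omega> = g 0 * U k \<omega> + lin (\<lambda>j. g (Suc j)) k \<omega>"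
proof -
  have "(\<Sum>i<k. g (k - i) * U i \<omega>) = (\<Sum>i<k. g (Suc (k - Suc i)) * U i \<omega>)"
    by (intro sum.cong) (auto simp: Suc_diff_Suc)
  then show ?thesis by (simp add: lin_def)
qed

lemma lin_shift: "lin (case_nat 0 g) k \<omega> = lin g (k - 1) \<omega>"
proof (cases k)
  case 0 then show ?thesis by (simp add: lin_def)
next
  case (Suc m) then show ?thesis by (simp add: lin_Suc)
qed

lemma lin_linear: "lin (\<lambda>j. c1 * g j + c2 * h j) k \<omega> = c1 * lin g k \<omega> + c2 * lin h k \<omega>"
  by (simp add: lin_def distrib_right sum.distrib sum_distrib_left mult.assoc)

lemma lin_two_lag: "lin (two_lag d c1 c2) k \<omega> = c1 * lin d k \<omega> + c2 * lin d (k - 1) \<omega>"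
  unfolding two_lag_def[abs_def] lin_linear lin_shift ..

lemma mart_linear:
  assumes "\<And>k. Y k \<omega> = c1 * Y1 k \<omega> + c2 * Y2 k \<omega>"
  shows "mart Y n \<omega> = c1 * mart Y1 n \<omega> + c2 * mart Y2 n \<omega>"
  unfolding mart_def assms by (simp add: distrib_left sum.distrib sum_distrib_left mult_ac)

lemma noise_average: "AE \<omega> in M. (\<lambda>n. (\<Sum>k<n. (U k \<omega>)\<^sup>2) / real n) \<longlonglongrightarrow> s2"
proof -
  have "adapted (\<lambda>_ _. 1)" by (simp add: adapted_def)
  from strong_law_squares[OF this, of 1]
  have "AE \<omega> in M. (\<lambda>n. (\<Sum>k<n. (U k \<omega>)\<^sup>2 - s2) / real n) \<longlonglongrightarrow> 0" by (simp add: prob_space)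
  then show ?thesis
  proof eventually_elim
    case (elim \<omega>)
    have "(\<lambda>n. (\<Sum>k<n. (U k \<omega>)\<^sup>2 - s2) / real n + s2) \<longlonglongrightarrow> 0 + s2" by (intro tendsto_intros elim)
    then have "(\<lambda>n. (\<Sum>k<n. (U k \<omega>)\<^sup>2 - s2) / real n + s2) \<longlonglongrightarrow> s2" by simp
    then show ?case
    proof (rule Lim_transform_eventually)
      show "\<forall>\<^sub>F n in sequentially. (\<Sum>k<n. (U k \<omega>)\<^sup>2 - s2) / real n + s2 = (\<Sum>k<n. (U k \<omega>)\<^sup>2) / real n"
        using eventually_gt_at_top[of 0] by eventually_elim (simp add: sum_subtractf field_simps)
    qed
  qed
qed

text \<open>
The bounds for fixed constants are collected along \<open>\<kappa> \<plusminus> 1 / (i + 1)\<close>, a countable family. In the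
degenerate case of vanishing variance the lower half follows from the upper bound on the
absolute value.
\<close>

lemma AE_lil_lin:
  fixes g :: "nat \<Rightarrow> real" and C r G :: real
  assumes g: "\<And>j. \<bar>g j\<bar> \<le> C * r ^ j" and r: "0 \<le> r" "r < 1"
    and avg: "AE \<omega> in M. (\<lambda>n. (\<Sum>k<n. (lin g k \<omega>)\<^sup>2) / real n) \<longlonglongrightarrow> s2 * G"
    and G: "(\<lambda>j. (g j)\<^sup>2) sums G"
  shows "AE \<omega> in M. lil (\<lambda>n. mart (lin g) n \<omega>) (sqrt (2 * (s2 * (s2 * G)))) \<and> lil_bounded (\<lambda>n. mart (lin g) n \<omega>)"
proof -
  define \<kappa> where "\<kappa> = sqrt (2 * s2 * (s2 * G))"
  have G0: "0 \<le> G" using G by (rule sums_le[OF _ sums_zero, rotated]) simp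
  have y0: "0 \<le> s2 * G" using G0 s2_nonneg by simp
  have k0: "0 \<le> \<kappa>" unfolding \<kappa>_def using s2_nonneg G0 by simp
  have up: "AE \<omega> in M. \<forall>\<^sub>F n in sequentially. \<bar>mart (lin g) n \<omega>\<bar> \<le> c * lil_rate n" if "\<kappa> < c" for c
    using lil_lin_upper[OF g r avg y0, of c] that unfolding \<kappa>_def lil_rate_def by simp
  have lo: "AE \<omega> in M. \<exists>\<^sub>F n in sequentially. c * lil_rate n \<le> mart (lin g) n \<omega>" if c: "c < \<kappa>" for c
  proof (cases "s2\<^sup>2 * G = 0")
    case True
    then have "\<kappa> = 0" by (auto simp: \<kappa>_def)
    then have "\<kappa> < - c" using c by simp
    from up[OF this] show ?thesis
    proof eventually_elim
      case (elim \<omega>)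
      then have "\<forall>\<^sub>F n in sequentially. c * lil_rate n \<le> mart (lin g) n \<omega>"
        by eventually_elim (auto simp: abs_le_iff)
      then show ?case by (rule eventually_frequently[rotated]) simp
    qed
  next
    case False
    then have "0 < s2\<^sup>2 * G" using G0 by (metis less_eq_real_def mult_nonneg_nonneg zero_le_power2)
    moreover have "c < sqrt (2 * s2\<^sup>2 * G)" using c by (simp add: \<kappa>_def power2_eq_square mult.assoc)
    ultimately show ?thesis unfolding lil_rate_def by (intro lil_lin_lower[OF g r avg G])
  qed
  have "AE \<omega> in M. \<forall>i. (\<forall>\<^sub>F n in sequentially. \<bar>mart (lin g) n \<omega>\<bar> \<le> (\<kappa> + 1 / real (Suc i)) * lil_rate n) \<and>
      (\<exists>\<^sub>F n in sequentially. (\<kappa> - 1 / real (Suc i)) * lil_rate n \<le> mart (lin g) n \<omega>)"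
    unfolding AE_all_countable
  proof
    fix i
    have "\<kappa> < \<kappa> + 1 / real (Suc i)" "\<kappa> - 1 / real (Suc i) < \<kappa>" by auto
    from up[OF this(1)] lo[OF this(2)]
    show "AE \<omega> in M. (\<forall>\<^sub>F n in sequentially. \<bar>mart (lin g) n \<omega>\<bar> \<le> (\<kappa> + 1 / real (Suc i)) * lil_rate n) \<and>
      (\<exists>\<^sub>F n in sequentially. (\<kappa> - 1 / real (Suc i)) * lil_rate n \<le> mart (lin g) n \<omega>)"
      by eventually_elim auto
  qed
  then show ?thesis
  proof eventually_elim
    case (elim \<omega>)
    have "lil_bounded (\<lambda>n. mart (lin g) n \<omega>)" unfolding lil_bounded_def using elim by blast
    moreover have "lil (\<lambda>n. mart (lin g) n \<omega>) \<kappa>" unfolding lil_def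
    proof (intro conjI allI impI)
      fix c assume "\<kappa> < c"
      then obtain i where i: "1 / real (Suc i) < c - \<kappa>" using nat_approx_posE[of "c - \<kappa>"] by auto
      have "\<forall>\<^sub>F n in sequentially. \<bar>mart (lin g) n \<omega>\<bar> \<le> (\<kappa> + 1 / real (Suc i)) * lil_rate n" using elim by blast
      with eventually_lil_rate_pos show "\<forall>\<^sub>F n in sequentially. mart (lin g) n \<omega> \<le> c * lil_rate n"
      proof eventually_elim
        case (elim n)
        have "(\<kappa> + 1 / real (Suc i)) * lil_rate n \<le> c * lil_rate n" using i elim by (intro mult_right_mono) auto
        then show ?case using elim by linarith
      qed
    next
      fix c assume "c < \<kappa>"
      then obtain i where i: "1 / real (Suc i) < \<kappa> - c" using nat_approx_posE[of "\<kappa> - c"] by auto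
      have "\<exists>\<^sub>F n in sequentially. (\<kappa> - 1 / real (Suc i)) * lil_rate n \<le> mart (lin g) n \<omega>" using elim by blast
      from frequently_eventually_frequently[OF this eventually_lil_rate_pos]
      show "\<exists>\<^sub>F n in sequentially. c * lil_rate n \<le> mart (lin g) n \<omega>"
      proof (rule frequently_elim1)
        fix n assume n: "(\<kappa> - 1 / real (Suc i)) * lil_rate n \<le> mart (lin g) n \<omega> \<and> 0 < lil_rate n"
        then have "c * lil_rate n \<le> (\<kappa> - 1 / real (Suc i)) * lil_rate n" using i by (intro mult_right_mono) auto
        then show "c * lil_rate n \<le> mart (lin g) n \<omega>" using n by linarith
      qed
    qed
    ultimately show ?case by (simp add: \<kappa>_def mult.assoc)
  qed
qed

end

locale stationary_ar_noise = iid_noise M U s2 + stationary_ar \<theta> \<rho>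
  for M :: "'a measure" and U :: "nat \<Rightarrow> 'a \<Rightarrow> real" and s2 \<theta> \<rho> :: real
begin

lemma lin_d_pred: "lin d k \<omega> = \<theta> * lin d (k - 1) \<omega> + lin (\<lambda>j. \<rho> ^ j) k \<omega>"
proof -
  have "d j = \<theta> * case_nat 0 d j + 1 * \<rho> ^ j" for j by (cases j) (simp_all add: d_def)
  then have "lin d k \<omega> = lin (\<lambda>j. \<theta> * case_nat 0 d j + 1 * \<rho> ^ j) k \<omega>" by (simp add: lin_def)
  then show ?thesis unfolding lin_linear lin_shift by simp
qed

lemma lin_geometric_Suc: "lin (\<lambda>j. \<rho> ^ j) (Suc k) \<omega> = \<rho> * lin (\<lambda>j. \<rho> ^ j) k \<omega> + U k \<omega>"
  by (simp add: lin_Suc) (simp add: lin_def sum_distrib_left mult.assoc)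

lemma lin_d_rec: "lin d (Suc (Suc k)) \<omega> = a * lin d (Suc k) \<omega> + b * lin d k \<omega> + U (Suc k) \<omega>"
  using lin_d_pred[of "Suc (Suc k)" \<omega>] lin_d_pred[of "Suc k" \<omega>] lin_geometric_Suc[of "Suc k" \<omega>]
  by (simp add: a_def b_def algebra_simps)

lemma lin_two_lag_strong_law: "AE \<omega> in M. (\<lambda>n. mart (lin (two_lag d c1 c2)) n \<omega> / real n) \<longlonglongrightarrow> 0"
proof -
  obtain C where C: "\<And>j. \<bar>two_lag d c1 c2 j\<bar> \<le> C * r ^ j" using two_lag_bound[of c1 c2] by blast
  show ?thesis
    by (rule strong_law_mart[OF adapted_lin lin_fourth_moment[OF C less_imp_le[OF r(1)] r(2)]])
qed

lemma two_lag_undelayed: "two_lag d 1 0 = d"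
  by (simp add: two_lag_def[abs_def])

lemma mart_lin_delayed: "mart (lin (two_lag d 0 1)) n \<omega> = (\<Sum>k<n - 1. U (Suc k) \<omega> * lin d k \<omega>)"
proof (cases n)
  case 0 then show ?thesis by (simp add: mart_def)
next
  case (Suc m)
  have "lin d 0 \<omega> = 0" by (simp add: lin_def)
  then show ?thesis unfolding Suc mart_def sum.lessThan_Suc_shift by (simp add: lin_two_lag)
qed

lemma lin_d_averages:
  "AE \<omega> in M. (\<lambda>n. (\<Sum>k<n. (lin d k \<omega>)\<^sup>2) / real n) \<longlonglongrightarrow> (1 - b) / \<Delta> * s2 \<and>
     (\<lambda>n. (\<Sum>k<n. lin d (Suc k) \<omega> * lin d k \<omega>) / real n) \<longlonglongrightarrow> a / \<Delta> * s2"
  using noise_average lin_two_lag_strong_law[of 1 0] lin_two_lag_strong_law[of 0 1] AE_fourth_power_sublinear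
proof eventually_elim
  case (elim \<omega>)
  obtain C where C: "\<And>j. \<bar>d j\<bar> \<le> C * r ^ j" using d_bound by blast
  have 1: "(\<lambda>n. (\<Sum>k<n. U k \<omega> * lin d k \<omega>) / real n) \<longlonglongrightarrow> 0"
    using elim(2) by (simp add: mart_def two_lag_undelayed)
  have 2: "(\<lambda>n. (\<Sum>k<n. U (Suc k) \<omega> * lin d k \<omega>) / real n) \<longlonglongrightarrow> 0"
    using average_Suc[OF elim(3)] unfolding mart_lin_delayed by simp
  have 3: "(\<lambda>n. (lin d n \<omega>)\<^sup>2 / real n) \<longlonglongrightarrow> 0"
    by (rule square_over_n_null[OF lin_fourth_power_sublinear[OF C less_imp_le[OF r(1)] r(2) elim(4)]])
  have "\<Delta> \<noteq> 0" using \<Delta>_pos by simp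
  from ar2_averages[of "\<lambda>k. lin d k \<omega>" a b "\<lambda>k. U k \<omega>", OF lin_d_rec elim(1) 1 2 3 \<Delta>_def this b_bound(3)]
  show ?case by simp
qed

lemma lin_two_lag_average:
  "AE \<omega> in M. (\<lambda>n. (\<Sum>k<n. (lin (two_lag d c1 c2) k \<omega>)\<^sup>2) / real n) \<longlonglongrightarrow> s2 * gain c1 c2"
  using lin_d_averages
proof eventually_elim
  case (elim \<omega>)
  define S where "S n = (\<Sum>k<n. (lin d k \<omega>)\<^sup>2)" for n
  define P where "P n = (\<Sum>k<n. lin d (Suc k) \<omega> * lin d k \<omega>)" for n
  have S: "(\<lambda>n. S n / real n) \<longlonglongrightarrow> (1 - b) / \<Delta> * s2" and P: "(\<lambda>n. P n / real n) \<longlonglongrightarrow> a / \<Delta> * s2"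
    using elim by (simp_all add: S_def P_def)
  have id: "(\<Sum>k<Suc n. (lin (two_lag d c1 c2) k \<omega>)\<^sup>2) = c1\<^sup>2 * S (Suc n) + c2\<^sup>2 * S n + 2 * c1 * c2 * P n" for n
  proof (induction n)
    case (Suc n)
    then show ?case by (simp add: S_def P_def lin_two_lag power2_eq_square algebra_simps)
  qed (simp add: S_def P_def lin_two_lag lin_def)
  have "(\<lambda>n. c1\<^sup>2 * (S (Suc n) / real n) + c2\<^sup>2 * (S n / real n) + 2 * c1 * c2 * (P n / real n))
     \<longlonglongrightarrow> c1\<^sup>2 * ((1 - b) / \<Delta> * s2) + c2\<^sup>2 * ((1 - b) / \<Delta> * s2) + 2 * c1 * c2 * (a / \<Delta> * s2)"
    by (intro tendsto_intros S P average_Suc[OF S])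
  also have "c1\<^sup>2 * ((1 - b) / \<Delta> * s2) + c2\<^sup>2 * ((1 - b) / \<Delta> * s2) + 2 * c1 * c2 * (a / \<Delta> * s2) = s2 * gain c1 c2"
    by (simp add: gain_def algebra_simps)
  finally have "(\<lambda>n. (\<Sum>k<Suc n. (lin (two_lag d c1 c2) k \<omega>)\<^sup>2) / real n) \<longlonglongrightarrow> s2 * gain c1 c2"
    unfolding id by (simp add: add_divide_distrib)
  from tendsto_mult[OF this, of "\<lambda>n. real n / real (Suc n)" 1]
  have "(\<lambda>n. (\<Sum>k<Suc n. (lin (two_lag d c1 c2) k \<omega>)\<^sup>2) / real n * (real n / real (Suc n))) \<longlonglongrightarrow> s2 * gain c1 c2 * 1"
    by (auto intro: LIMSEQ_n_over_Suc_n simp del: sum.lessThan_Suc of_nat_Suc)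
  then have "(\<lambda>n. (\<Sum>k<Suc n. (lin (two_lag d c1 c2) k \<omega>)\<^sup>2) / real n * (real n / real (Suc n))) \<longlonglongrightarrow> s2 * gain c1 c2"
    by (simp only: mult_1_right)
  then have "(\<lambda>n. (\<Sum>k<Suc n. (lin (two_lag d c1 c2) k \<omega>)\<^sup>2) / real (Suc n)) \<longlonglongrightarrow> s2 * gain c1 c2"
  proof (rule Lim_transform_eventually)
    show "\<forall>\<^sub>F n in sequentially. (\<Sum>k<Suc n. (lin (two_lag d c1 c2) k \<omega>)\<^sup>2) / real n * (real n / real (Suc n))
        = (\<Sum>k<Suc n. (lin (two_lag d c1 c2) k \<omega>)\<^sup>2) / real (Suc n)"
      using eventually_gt_at_top[of 0] by eventually_elim (simp del: of_nat_Suc sum.lessThan_Suc)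
  qed
  then show ?case by (rule LIMSEQ_imp_Suc)
qed

lemma lin_two_lag_limit_laws:
  "AE \<omega> in M. lil (\<lambda>n. mart (lin (two_lag d c1 c2)) n \<omega>) (sqrt (2 * (s2 * (s2 * gain c1 c2)))) \<and>
     lil_bounded (\<lambda>n. mart (lin (two_lag d c1 c2)) n \<omega>) \<and>
     (\<lambda>n. (\<Sum>k=1..n. (mart (lin (two_lag d c1 c2)) k \<omega> / real k)\<^sup>2) / ln (real n)) \<longlonglongrightarrow> s2 * (s2 * gain c1 c2)"
proof -
  obtain C where C: "\<And>j. \<bar>two_lag d c1 c2 j\<bar> \<le> C * r ^ j" using two_lag_bound[of c1 c2] by blast
  have r0: "0 \<le> r" using r(1) by simp
  note avg = lin_two_lag_average[of c1 c2]
  from AE_lil_lin[OF C r0 r(2) avg two_lag_sums]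
    quadratic_strong_law[OF adapted_lin noise_times_lin_average[OF C r0 r(2) avg] avg]
  show ?thesis by eventually_elim auto
qed

text \<open>
The noise grows at most linearly, while the influence of the initial values decays
geometrically; this is a pathwise statement, so the initial values may depend on the noise.
\<close>

lemma geometric_perturbation_summable:
  assumes U4: "(\<lambda>n. U n \<omega> ^ 4 / real n) \<longlonglongrightarrow> 0" and e: "\<And>k. \<bar>e k\<bar> \<le> C * r ^ k"
  shows "summable (\<lambda>k. \<bar>U k \<omega> * e k\<bar>)" "summable (\<lambda>k. \<bar>U (Suc k) \<omega> * e k\<bar>)"
proof -
  have C0: "0 \<le> C" using e[of 0] by simp
  have ev: "\<forall>\<^sub>F n in sequentially. \<bar>U n \<omega>\<bar> \<le> real n"
  proof -
    have "\<forall>\<^sub>F n in sequentially. U n \<omega> ^ 4 / real n < 1" using U4 by (rule order_tendstoD) simp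
    then show ?thesis using eventually_ge_at_top[of 1]
    proof eventually_elim
      case (elim n)
      have "\<bar>U n \<omega>\<bar> ^ 4 \<le> real n" using elim by (simp add: power_even_abs divide_less_eq)
      also have "\<dots> \<le> real n ^ 4" using elim by (intro self_le_power) auto
      finally show ?case by (rule power_le_imp_le_base[of _ 3, simplified numeral_eq_Suc, simplified]) simp
    qed
  qed
  have ev': "\<forall>\<^sub>F n in sequentially. \<bar>U (Suc n) \<omega>\<bar> \<le> real (Suc n)"
    using eventually_sequentially_Suc[of "\<lambda>n. \<bar>U n \<omega>\<bar> \<le> real n"] ev by blast
  have sm: "summable (\<lambda>k. real (Suc k) * (C * r ^ k))"
  proof -
    have "summable (\<lambda>k. C * (real (Suc k) * r ^ k))"
      using geometric_deriv_sums[of r] r by (intro summable_mult) (auto simp: sums_iff)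
    then show ?thesis by (simp only: mult_ac)
  qed
  show "summable (\<lambda>k. \<bar>U k \<omega> * e k\<bar>)"
  proof (rule summable_comparison_test_ev[OF _ sm])
    from ev show "\<forall>\<^sub>F k in sequentially. norm \<bar>U k \<omega> * e k\<bar> \<le> real (Suc k) * (C * r ^ k)"
    proof eventually_elim
      case (elim k)
      have "\<bar>U k \<omega>\<bar> * \<bar>e k\<bar> \<le> real (Suc k) * (C * r ^ k)" using elim e[of k] by (intro mult_mono) auto
      then show ?case by (simp add: abs_mult)
    qed
  qed
  show "summable (\<lambda>k. \<bar>U (Suc k) \<omega> * e k\<bar>)"
  proof (rule summable_comparison_test_ev[OF _ sm])
    from ev' show "\<forall>\<^sub>F k in sequentially. norm \<bar>U (Suc k) \<omega> * e k\<bar> \<le> real (Suc k) * (C * r ^ k)"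
    proof eventually_elim
      case (elim k)
      have "\<bar>U (Suc k) \<omega>\<bar> * \<bar>e k\<bar> \<le> real (Suc k) * (C * r ^ k)" using elim e[of k] by (intro mult_mono) auto
      then show ?case by (simp add: abs_mult)
    qed
  qed
qed

end

section \<open>Transfer to arbitrary initial values\<close>

lemma Bseq_partial_sums:
  fixes f :: "nat \<Rightarrow> real"
  assumes "summable (\<lambda>k. \<bar>f k\<bar>)"
  shows "Bseq (\<lambda>n. \<Sum>k<n. f k)"
proof -
  have "convergent (\<lambda>n. \<Sum>k<n. f k)" using summable_rabs_cancel[OF assms] by (simp add: summable_iff_convergent)
  then show ?thesis by (rule convergent_imp_Bseq)
qed

lemma Bseq_div_null:
  fixes f h :: "nat \<Rightarrow> real"
  assumes f: "Bseq f" and h: "(\<lambda>n. 1 / h n) \<longlonglongrightarrow> 0"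
  shows "(\<lambda>n. f n / h n) \<longlonglongrightarrow> 0"
proof -
  obtain K where K: "\<And>n. \<bar>f n\<bar> \<le> K" using f by (auto simp: Bseq_def)
  show ?thesis
  proof (rule Lim_null_comparison)
    show "(\<lambda>n. K * \<bar>1 / h n\<bar>) \<longlonglongrightarrow> 0"
      by (rule tendsto_mult_right_zero[OF tendsto_rabs_zero[OF h]])
    have "\<bar>f n\<bar> * \<bar>1 / h n\<bar> \<le> K * \<bar>1 / h n\<bar>" for n using K by (rule mult_right_mono) simp
    then show "\<forall>\<^sub>F n in sequentially. norm (f n / h n) \<le> K * \<bar>1 / h n\<bar>" by (simp add: abs_mult[symmetric])
  qed
qed

lemma lil_bounded_add_Bseq:
  assumes w: "lil_bounded w" and f: "Bseq f"
  shows "lil_bounded (\<lambda>n. w n + f n)"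
proof -
  from w obtain C where C: "\<forall>\<^sub>F n in sequentially. \<bar>w n\<bar> \<le> C * lil_rate n" by (auto simp: lil_bounded_def)
  have "(\<lambda>n. 1 / lil_rate n) \<longlonglongrightarrow> 0" unfolding lil_rate_def by real_asymp
  from tendsto_rabs_zero[OF Bseq_div_null[OF f this]]
  have "\<forall>\<^sub>F n in sequentially. \<bar>f n / lil_rate n\<bar> < 1" by (rule order_tendstoD) simp
  from this C eventually_lil_rate_pos have "\<forall>\<^sub>F n in sequentially. \<bar>w n + f n\<bar> \<le> (C + 1) * lil_rate n"
    by eventually_elim (auto simp: divide_less_eq distrib_right)
  then show ?thesis by (auto simp: lil_bounded_def)
qed

lemma log_average_add_Bseq:
  assumes w: "(\<lambda>n. (\<Sum>k=1..n. (w k / real k)\<^sup>2) / ln (real n)) \<longlonglongrightarrow> v" and f: "Bseq f"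
  shows "(\<lambda>n. (\<Sum>k=1..n. ((w k + f k) / real k)\<^sup>2) / ln (real n)) \<longlonglongrightarrow> v"
proof -
  have "(\<lambda>n. 1 / sqrt (real n)) \<longlonglongrightarrow> 0" by real_asymp
  from log_average_square_perturb[OF w log_average_square_of_small[OF Bseq_div_null[OF f this]]]
  show ?thesis by (simp add: add_divide_distrib)
qed

context stationary_ar_noise begin

text \<open>
The exceptional null set does not depend on the trajectory: for almost every realization of the
noise the laws hold for all solutions of the recursion, whatever their initial values. The
second hypothesis on \<open>x\<close> says that the difference from the solution started at rest obeys the
homogeneous recursion.
\<close>

lemma AE_limit_laws_rho_hat:
  assumes s2: "0 < s2"
  shows "AE \<omega> in M. \<forall>x \<epsilon>0. (\<forall>k. x (Suc (Suc k)) = a * x (Suc k) + b * x k + U (Suc k) \<omega>) \<longrightarrow>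
      (\<forall>k. x (Suc k) - lin d (Suc k) \<omega> = \<theta> * (x k - lin d k \<omega>) + \<epsilon>0 * \<rho> ^ k) \<longrightarrow>
      lil (\<lambda>n. real n * (rho_hat x n - rho_star \<theta> \<rho>)) (sqrt 2 * sigma_rho \<theta> \<rho>) \<and>
      lil (\<lambda>n. - (real n * (rho_hat x n - rho_star \<theta> \<rho>))) (sqrt 2 * sigma_rho \<theta> \<rho>) \<and>
      (\<lambda>n. (\<Sum>k=1..n. (rho_hat x k - rho_star \<theta> \<rho>)\<^sup>2) / ln (real n)) \<longlonglongrightarrow> sigma_rho_sq \<theta> \<rho>"
proof -
  define c1 where "c1 = \<tau>\<^sup>2 - b * (1 - \<tau>\<^sup>2) / (1 - b)"
  define A where "A = (1 - b) / \<Delta>"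
  have A: "0 < A" using b_bound \<Delta>_pos by (simp add: A_def)
  have w: "0 < 1 - \<tau>\<^sup>2" using \<tau>_square(2) by simp
  define s where "s = A * s2"
  have s: "0 < s" using A s2 by (simp add: s_def)
  define \<alpha>0 where "\<alpha>0 = 1 / (s * (1 - \<tau>\<^sup>2))"
  have \<alpha>0: "0 < \<alpha>0" using s w by (simp add: \<alpha>0_def)
  define v where "v = s2 * (s2 * gain c1 (- \<tau>))"
  have v0: "0 \<le> v" using s2 gain_nonneg by (simp add: v_def)
  have var: "\<alpha>0\<^sup>2 * v = sigma_rho_sq \<theta> \<rho>"
    unfolding sigma_rho_sq_eq c1_def[symmetric] A_def[symmetric] \<alpha>0_def v_def s_def
    using s2 A w by (simp add: power2_eq_square)
  have dev: "\<alpha>0 * sqrt (2 * v) = sqrt 2 * sigma_rho \<theta> \<rho>"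
  proof -
    have "sigma_rho \<theta> \<rho> = \<alpha>0 * sqrt v" unfolding sigma_rho_def var[symmetric] using \<alpha>0 by (simp add: real_sqrt_mult)
    then show ?thesis by (simp add: real_sqrt_mult)
  qed
  have gain_minus: "gain (- c1) \<tau> = gain c1 (- \<tau>)" by (simp add: gain_def)
  show ?thesis
    using lin_two_lag_limit_laws[of c1 "- \<tau>"] lin_two_lag_limit_laws[of "- c1" \<tau>]
      lin_two_lag_limit_laws[of 1 0] lin_two_lag_limit_laws[of 0 1]
      lin_two_lag_strong_law[of 1 0] lin_two_lag_strong_law[of 0 1]
      noise_average AE_fourth_power_sublinear
  proof eventually_elim
    case (elim \<omega>)
    show ?case
    proof (intro allI impI)
      fix x \<epsilon>0 assume rec: "\<forall>k. x (Suc (Suc k)) = a * x (Suc k) + b * x k + U (Suc k) \<omega>"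
        and diff: "\<forall>k. x (Suc k) - lin d (Suc k) \<omega> = \<theta> * (x k - lin d k \<omega>) + \<epsilon>0 * \<rho> ^ k"
      define e where "e k = x k - lin d k \<omega>" for k
      define C where "C = max \<bar>e 0\<bar> (\<bar>\<epsilon>0\<bar> / (r - \<bar>\<theta>\<bar>))"
      have e: "\<bar>e k\<bar> \<le> C * r ^ k" for k
        unfolding C_def by (rule two_root_recursion_bound[OF _ r(3,4)]) (use diff in \<open>simp add: e_def\<close>)
      have x_eq: "x k = lin d k \<omega> + e k" for k by (simp add: e_def)
      note sm = geometric_perturbation_summable[OF elim(8) e]
      define f1 where "f1 n = (\<Sum>k<n. U k \<omega> * e k)" for n
      define f2 where "f2 n = (\<Sum>k<n. U (Suc k) \<omega> * e k)" for n
      have f1: "Bseq f1" and f2: "Bseq f2" unfolding f1_def f2_def using sm by (auto intro: Bseq_partial_sums)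
      have f2': "Bseq (\<lambda>n. f2 (n - 1))" using f2 unfolding Bseq_def by blast
      define Mu where "Mu = (\<lambda>n. \<Sum>k<n. U k \<omega> * x k)"
      define Nu where "Nu = (\<lambda>n. \<Sum>k<n - 1. U (Suc k) \<omega> * x k)"
      have Mu: "Mu n = mart (lin (two_lag d 1 0)) n \<omega> + f1 n" for n
        by (simp add: Mu_def f1_def mart_def two_lag_undelayed x_eq distrib_left sum.distrib)
      have Nu: "Nu n = mart (lin (two_lag d 0 1)) n \<omega> + f2 (n - 1)" for n
        by (simp add: Nu_def f2_def mart_lin_delayed x_eq distrib_left sum.distrib)
      have comb: "mart (lin (two_lag d y z)) n \<omega> = y * mart (lin (two_lag d 1 0)) n \<omega> + z * mart (lin (two_lag d 0 1)) n \<omega>" for y z n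
        by (rule mart_linear) (simp add: lin_two_lag)
      have x4: "(\<lambda>n. x n ^ 4 / real n) \<longlonglongrightarrow> 0"
      proof -
        obtain C' where C': "\<And>j. \<bar>d j\<bar> \<le> C' * r ^ j" using d_bound by blast
        have l: "(\<lambda>n. lin d n \<omega> ^ 4 / real n) \<longlonglongrightarrow> 0"
          by (rule lin_fourth_power_sublinear[OF C' less_imp_le[OF r(1)] r(2) elim(8)])
        have "(\<lambda>n. 8 * (lin d n \<omega> ^ 4 / real n) + 8 * (C ^ 4 / real n)) \<longlonglongrightarrow> 8 * 0 + 8 * 0"
          by (intro tendsto_intros l)
        then have lim: "(\<lambda>n. 8 * (lin d n \<omega> ^ 4 / real n) + 8 * (C ^ 4 / real n)) \<longlonglongrightarrow> 0" by simp
        show ?thesis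
        proof (rule Lim_null_comparison[OF _ lim])
          have "x n ^ 4 \<le> 8 * lin d n \<omega> ^ 4 + 8 * C ^ 4" for n
          proof -
            have C0: "0 \<le> C" by (simp add: C_def)
            have q: "(y + z) ^ 4 \<le> 8 * y ^ 4 + 8 * z ^ 4" for y z :: real
            proof -
              have "(y + z)\<^sup>2 \<le> 2 * y\<^sup>2 + 2 * z\<^sup>2" using zero_le_power2[of "y - z"] by (simp add: power2_eq_square algebra_simps)
              then have "((y + z)\<^sup>2)\<^sup>2 \<le> (2 * y\<^sup>2 + 2 * z\<^sup>2)\<^sup>2" by (intro power_mono) auto
              also have "\<dots> \<le> 8 * (y\<^sup>2)\<^sup>2 + 8 * (z\<^sup>2)\<^sup>2" using zero_le_power2[of "y\<^sup>2 - z\<^sup>2"] by (simp add: power2_eq_square algebra_simps)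
              finally show ?thesis by (simp flip: power_mult)
            qed
            have "\<bar>e n\<bar> \<le> C * 1" using r C0 by (intro order_trans[OF e] mult_left_mono power_le_one) auto
            then have "\<bar>e n\<bar> ^ 4 \<le> C ^ 4" by (intro power_mono) auto
            then have "e n ^ 4 \<le> C ^ 4" by (simp add: power_even_abs)
            then show ?thesis using q[of "lin d n \<omega>" "e n"] by (simp add: x_eq)
          qed
          then show "\<forall>\<^sub>F n in sequentially. norm (x n ^ 4 / real n) \<le> 8 * (lin d n \<omega> ^ 4 / real n) + 8 * (C ^ 4 / real n)"
            by (simp add: add_divide_distrib[symmetric] divide_right_mono)
        qed
      qed
      have inv: "(\<lambda>n. 1 / real n) \<longlonglongrightarrow> 0" by real_asymp
      have M0: "(\<lambda>n. (\<Sum>k<n. U k \<omega> * x k) / real n) \<longlonglongrightarrow> 0"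
        using tendsto_add[OF elim(5) Bseq_div_null[OF f1 inv]] Mu by (simp add: Mu_def add_divide_distrib)
      have "(\<lambda>n. Nu n / real n) \<longlonglongrightarrow> 0"
        using tendsto_add[OF elim(6) Bseq_div_null[OF f2' inv]] Nu by (simp add: add_divide_distrib)
      then have N0: "(\<lambda>n. (\<Sum>k<n. U (Suc k) \<omega> * x k) / real n) \<longlonglongrightarrow> 0"
        using average_Suc[of Nu 0] by (simp add: Nu_def)
      have "\<Delta> \<noteq> 0" using \<Delta>_pos by simp
      note avg = ar2_averages[of x a b "\<lambda>k. U k \<omega>", OF rec[rule_format] elim(7) M0 N0 square_over_n_null[OF x4] \<Delta>_def this b_bound(3)]
      have S: "(\<lambda>n. (\<Sum>k<n. (x k)\<^sup>2) / real n) \<longlonglongrightarrow> s" using avg(1) by (simp add: s_def A_def)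
      have "a / \<Delta> * s2 = \<tau> * s" using b_bound by (simp add: s_def A_def \<tau>_def)
      then have P: "(\<lambda>n. (\<Sum>k<n. x (Suc k) * x k) / real n) \<longlonglongrightarrow> \<tau> * s" using avg(2) by simp
      have Mb: "lil_bounded Mu" "(\<lambda>n. (\<Sum>k=1..n. (Mu k / real k)\<^sup>2) / ln (real n)) \<longlonglongrightarrow> s2 * (s2 * gain 1 0)"
        unfolding ext[of Mu, OF Mu]
        by (rule lil_bounded_add_Bseq[OF _ f1] log_average_add_Bseq[OF _ f1], use elim(3) in blast)+
      have Nb: "lil_bounded Nu" "(\<lambda>n. (\<Sum>k=1..n. (Nu k / real k)\<^sup>2) / ln (real n)) \<longlonglongrightarrow> s2 * (s2 * gain 0 1)"
        unfolding ext[of Nu, OF Nu]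
        by (rule lil_bounded_add_Bseq[OF _ f2'] log_average_add_Bseq[OF _ f2'], use elim(4) in blast)+
      obtain \<alpha> q where lin: "\<And>n. real n * (rho_hat x n + b * \<tau>) = \<alpha> n * (c1 * Mu n - \<tau> * Nu n) + q n"
        and \<alpha>: "\<alpha> \<longlonglongrightarrow> \<alpha>0" and q1: "(\<lambda>n. q n / lil_rate n) \<longlonglongrightarrow> 0"
        and q2: "(\<lambda>n. (\<Sum>k=1..n. (q k / real k)\<^sup>2) / ln (real n)) \<longlonglongrightarrow> 0"
        using rho_hat_linearization[where Mu = Mu and Nu = Nu and u = "\<lambda>k. U k \<omega>",
            OF _ _ c1_def rec[rule_format] b_bound(3) \<tau>_def \<tau>_square(2) s S P x4 Mb Nb]
        unfolding \<alpha>0_def[symmetric] by (simp add: Mu_def Nu_def) blast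
      (* The bounded effect of the initial values on the leading martingale. *)
      define f where "f n = c1 * f1 n - \<tau> * f2 (n - 1)" for n
      define W where "W n = mart (lin (two_lag d c1 (- \<tau>))) n \<omega>" for n
      have Bf: "Bseq f"
      proof -
        obtain K1 where K1: "\<And>n. \<bar>f1 n\<bar> \<le> K1" using f1 by (auto simp: Bseq_def)
        obtain K2 where K2: "\<And>n. \<bar>f2 n\<bar> \<le> K2" using f2 by (auto simp: Bseq_def)
        have "\<bar>f n\<bar> \<le> \<bar>c1\<bar> * K1 + \<bar>\<tau>\<bar> * K2" for n
        proof -
          have "\<bar>f n\<bar> \<le> \<bar>c1\<bar> * \<bar>f1 n\<bar> + \<bar>\<tau>\<bar> * \<bar>f2 (n - 1)\<bar>"
            unfolding f_def by (intro order_trans[OF abs_triangle_ineq4]) (simp add: abs_mult)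
          also have "\<dots> \<le> \<bar>c1\<bar> * K1 + \<bar>\<tau>\<bar> * K2" by (intro add_mono mult_left_mono K1 K2) auto
          finally show ?thesis .
        qed
        then show ?thesis by (intro BseqI'[of _ "\<bar>c1\<bar> * K1 + \<bar>\<tau>\<bar> * K2"]) simp
      qed
      have WM: "c1 * Mu n - \<tau> * Nu n = W n + f n" for n
        unfolding W_def comb[of c1 "- \<tau>"] Mu Nu f_def by (simp add: algebra_simps)
      have W': "- W n = mart (lin (two_lag d (- c1) \<tau>)) n \<omega>" for n
        unfolding W_def comb[of c1 "- \<tau>"] comb[of "- c1" \<tau>] by simp
      have Wl: "lil W (sqrt (2 * v))" "lil_bounded W" "(\<lambda>n. (\<Sum>k=1..n. (W k / real k)\<^sup>2) / ln (real n)) \<longlonglongrightarrow> v"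
        using elim(1) unfolding W_def[symmetric] v_def by auto
      have Wl': "lil (\<lambda>n. - W n) (sqrt (2 * v))" "lil_bounded (\<lambda>n. - W n)"
        using elim(2) unfolding W'[symmetric] gain_minus v_def by auto
      define q' where "q' n = \<alpha> n * f n + q n" for n
      have expand: "real n * (rho_hat x n - rho_star \<theta> \<rho>) = \<alpha> n * W n + q' n" for n
        unfolding rho_star_eq q'_def using lin[of n] unfolding WM by (simp add: algebra_simps)
      have B\<alpha>: "Bseq (\<lambda>n. \<alpha> n * f n)"
        using Bseq_mult[OF convergent_imp_Bseq[OF convergentI[OF \<alpha>]] Bf] .
      have rate: "(\<lambda>n. 1 / lil_rate n) \<longlonglongrightarrow> 0" unfolding lil_rate_def by real_asymp
      have q1': "(\<lambda>n. q' n / lil_rate n) \<longlonglongrightarrow> 0"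
        using tendsto_add[OF Bseq_div_null[OF B\<alpha> rate] q1] by (simp add: q'_def add_divide_distrib)
      have q2': "(\<lambda>n. (\<Sum>k=1..n. (q' k / real k)\<^sup>2) / ln (real n)) \<longlonglongrightarrow> 0"
        using log_average_add_Bseq[OF q2 B\<alpha>] by (simp add: q'_def add.commute)
      have 1: "lil (\<lambda>n. real n * (rho_hat x n - rho_star \<theta> \<rho>)) (sqrt 2 * sigma_rho \<theta> \<rho>)"
        unfolding expand dev[symmetric] by (rule lil_perturb[OF Wl(1,2) \<alpha> \<alpha>0 q1'])
      have "(\<lambda>n. - q' n / lil_rate n) \<longlonglongrightarrow> 0" using tendsto_minus[OF q1'] by simp
      from lil_perturb[OF Wl' \<alpha> \<alpha>0 this]
      have 2: "lil (\<lambda>n. - (real n * (rho_hat x n - rho_star \<theta> \<rho>))) (sqrt 2 * sigma_rho \<theta> \<rho>)"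
        unfolding expand dev[symmetric] by simp
      have "(\<lambda>n. (\<Sum>k=1..n. (\<alpha> k * W k / real k + q' k / real k)\<^sup>2) / ln (real n)) \<longlonglongrightarrow> \<alpha>0\<^sup>2 * v"
        by (rule log_average_square_perturb[OF log_average_square_weights[OF Wl(3) \<alpha>] q2'])
      moreover have "(\<Sum>k=1..n. (\<alpha> k * W k / real k + q' k / real k)\<^sup>2) = (\<Sum>k=1..n. (rho_hat x k - rho_star \<theta> \<rho>)\<^sup>2)" for n
        by (intro sum.cong) (auto simp: add_divide_distrib[symmetric] expand[symmetric])
      ultimately have 3: "(\<lambda>n. (\<Sum>k=1..n. (rho_hat x k - rho_star \<theta> \<rho>)\<^sup>2) / ln (real n)) \<longlonglongrightarrow> sigma_rho_sq \<theta> \<rho>"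
        by (simp add: var)
      show "lil (\<lambda>n. real n * (rho_hat x n - rho_star \<theta> \<rho>)) (sqrt 2 * sigma_rho \<theta> \<rho>) \<and>
        lil (\<lambda>n. - (real n * (rho_hat x n - rho_star \<theta> \<rho>))) (sqrt 2 * sigma_rho \<theta> \<rho>) \<and>
        (\<lambda>n. (\<Sum>k=1..n. (rho_hat x k - rho_star \<theta> \<rho>)\<^sup>2) / ln (real n)) \<longlonglongrightarrow> sigma_rho_sq \<theta> \<rho>"
        using 1 2 3 by blast
    qed
  qed
qed

end

section \<open>The limit laws of the estimator\<close>

lemma sigma_rho_sq_nonneg:
  assumes "\<bar>\<theta>\<bar> < 1" "\<bar>\<rho>\<bar> < 1"
  shows "0 \<le> sigma_rho_sq \<theta> \<rho>"
proof -
  interpret stationary_ar \<theta> \<rho> by unfold_locales fact+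
  show ?thesis unfolding sigma_rho_sq_eq using gain_nonneg by (intro divide_nonneg_nonneg) auto
qed

theorem theorem3p3:
  fixes M :: "'a measure" and X \<epsilon> V :: "nat \<Rightarrow> 'a \<Rightarrow> real" and \<theta> \<rho> \<sigma> :: real
  assumes "prob_space M"
    and "\<bar>\<theta>\<bar> < 1" and "\<bar>\<rho>\<bar> < 1"
    and "prob_space.indep_vars M (\<lambda>_. borel) V {1..}"
    and "\<And>n. n \<ge> 1 \<Longrightarrow> distr M borel (V n) = distr M borel (V 1)"
    and "\<And>n. n \<ge> 1 \<Longrightarrow> prob_space.expectation M (V n) = 0"
    and "\<And>n. n \<ge> 1 \<Longrightarrow> prob_space.variance M (V n) = \<sigma>\<^sup>2" and "\<sigma>\<^sup>2 > 0"
    and "\<And>n. n \<ge> 1 \<Longrightarrow> integrable M (\<lambda>\<omega>. V n \<omega> ^ 4)"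
    and "X 0 \<in> borel_measurable M" and "\<epsilon> 0 \<in> borel_measurable M"
    and "\<And>n \<omega>. n \<ge> 1 \<Longrightarrow> \<omega> \<in> space M \<Longrightarrow> X n \<omega> = \<theta> * X (n - 1) \<omega> + \<epsilon> n \<omega>"
    and "\<And>n \<omega>. n \<ge> 1 \<Longrightarrow> \<omega> \<in> space M \<Longrightarrow> \<epsilon> n \<omega> = \<rho> * \<epsilon> (n - 1) \<omega> + V n \<omega>"
  shows
    "(AE \<omega> in M.
        (\<lambda>n. 1 / ln (real n) * (\<Sum>k=1..n. (rho_hat (\<lambda>j. X j \<omega>) k - rho_star \<theta> \<rho>)\<^sup>2))
          \<longlonglongrightarrow> sigma_rho_sq \<theta> \<rho>) \<and>
     (AE \<omega> in M.
        limsup (\<lambda>n. ereal (sqrt (real n / (2 * ln (ln (real n))))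
                            * (rho_hat (\<lambda>j. X j \<omega>) n - rho_star \<theta> \<rho>)))
          = - liminf (\<lambda>n. ereal (sqrt (real n / (2 * ln (ln (real n))))
                            * (rho_hat (\<lambda>j. X j \<omega>) n - rho_star \<theta> \<rho>)))
        \<and> - liminf (\<lambda>n. ereal (sqrt (real n / (2 * ln (ln (real n))))
                            * (rho_hat (\<lambda>j. X j \<omega>) n - rho_star \<theta> \<rho>)))
          = ereal (sigma_rho \<theta> \<rho>)) \<and>
     (AE \<omega> in M.
        limsup (\<lambda>n. ereal (real n / (2 * ln (ln (real n)))
                            * (rho_hat (\<lambda>j. X j \<omega>) n - rho_star \<theta> \<rho>)\<^sup>2))
          = ereal (sigma_rho_sq \<theta> \<rho>))"
proof -
  interpret prob_space M by fact
  (* Shifted so that the innovation of index k is independent of the k innovations before it. *)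
  define U where "U k = V (Suc k)" for k
  have indU: "indep_vars (\<lambda>_. borel) U UNIV"
  proof -
    have "indep_vars (\<lambda>j. PiM {Suc j} (\<lambda>_. borel)) (\<lambda>j \<omega>. restrict (\<lambda>i. V i \<omega>) {Suc j}) UNIV"
      by (rule indep_vars_restrict[OF assms(4)]) (auto simp: disjoint_family_on_def)
    then have "indep_vars (\<lambda>_. borel) (\<lambda>j \<omega>. (\<lambda>h. h (Suc j)) (restrict (\<lambda>i. V i \<omega>) {Suc j})) UNIV"
      by (rule indep_vars_compose2) (auto intro!: measurable_component_singleton)
    then show ?thesis by (simp add: U_def[abs_def])
  qed
  interpret stationary_ar_noise M U "\<sigma>\<^sup>2" \<theta> \<rho>
  proof unfold_locales
    show "indep_vars (\<lambda>_. borel) U UNIV" by (rule indU)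
    show "distr M borel (U n) = distr M borel (U 0)" for n using assms(5)[of "Suc n"] by (simp add: U_def)
    show "expectation (U n) = 0" for n using assms(6)[of "Suc n"] by (simp add: U_def)
    show "integrable M (\<lambda>\<omega>. U n \<omega> ^ 4)" for n using assms(9)[of "Suc n"] by (simp add: U_def)
    show "expectation (\<lambda>\<omega>. (U n \<omega>)\<^sup>2) = \<sigma>\<^sup>2" for n
      using assms(7)[of "Suc n"] assms(6)[of "Suc n"] by (simp add: U_def)
  qed fact+
  have laws: "AE \<omega> in M.
      lil (\<lambda>n. real n * (rho_hat (\<lambda>j. X j \<omega>) n - rho_star \<theta> \<rho>)) (sqrt 2 * sigma_rho \<theta> \<rho>) \<and>
      lil (\<lambda>n. - (real n * (rho_hat (\<lambda>j. X j \<omega>) n - rho_star \<theta> \<rho>))) (sqrt 2 * sigma_rho \<theta> \<rho>) \<and>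
      (\<lambda>n. (\<Sum>k=1..n. (rho_hat (\<lambda>j. X j \<omega>) k - rho_star \<theta> \<rho>)\<^sup>2) / ln (real n)) \<longlonglongrightarrow> sigma_rho_sq \<theta> \<rho>"
    using AE_limit_laws_rho_hat[OF assms(8)] AE_space
  proof eventually_elim
    case (elim \<omega>)
    have X: "X (Suc k) \<omega> = \<theta> * X k \<omega> + \<epsilon> (Suc k) \<omega>" for k
      using assms(12)[of "Suc k" \<omega>] elim(2) by simp
    have \<epsilon>: "\<epsilon> (Suc k) \<omega> = \<rho> * \<epsilon> k \<omega> + U k \<omega>" for k
      using assms(13)[of "Suc k" \<omega>] elim(2) by (simp add: U_def)
    have rec: "\<forall>k. X (Suc (Suc k)) \<omega> = a * X (Suc k) \<omega> + b * X k \<omega> + U (Suc k) \<omega>"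
    proof
      fix k
      have e: "\<epsilon> (Suc k) \<omega> = X (Suc k) \<omega> - \<theta> * X k \<omega>" using X[of k] by simp
      have "X (Suc (Suc k)) \<omega> = \<theta> * X (Suc k) \<omega> + (\<rho> * (X (Suc k) \<omega> - \<theta> * X k \<omega>) + U (Suc k) \<omega>)"
        unfolding e[symmetric] \<epsilon>[of "Suc k", symmetric] by (rule X)
      then show "X (Suc (Suc k)) \<omega> = a * X (Suc k) \<omega> + b * X k \<omega> + U (Suc k) \<omega>"
        by (simp add: a_def b_def algebra_simps)
    qed
    (* The initial error is forgotten geometrically, along each trajectory. *)
    have start: "\<epsilon> k \<omega> - lin (\<lambda>j. \<rho> ^ j) k \<omega> = \<rho> ^ k * \<epsilon> 0 \<omega>" for k
    proof (induction k)
      case 0 show ?case by (simp add: lin_def)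
    next
      case (Suc k)
      have "\<epsilon> (Suc k) \<omega> - lin (\<lambda>j. \<rho> ^ j) (Suc k) \<omega> = \<rho> * (\<epsilon> k \<omega> - lin (\<lambda>j. \<rho> ^ j) k \<omega>)"
        unfolding lin_geometric_Suc \<epsilon> by (simp add: right_diff_distrib)
      then show ?case unfolding Suc by simp
    qed
    have "\<forall>k. X (Suc k) \<omega> - lin d (Suc k) \<omega> = \<theta> * (X k \<omega> - lin d k \<omega>) + \<rho> * \<epsilon> 0 \<omega> * \<rho> ^ k"
    proof
      fix k
      show "X (Suc k) \<omega> - lin d (Suc k) \<omega> = \<theta> * (X k \<omega> - lin d k \<omega>) + \<rho> * \<epsilon> 0 \<omega> * \<rho> ^ k"
        using X[of k] lin_d_pred[of "Suc k" \<omega>] start[of "Suc k"] by (simp add: algebra_simps)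
    qed
    with elim(1)[rule_format, of "\<lambda>j. X j \<omega>" "\<rho> * \<epsilon> 0 \<omega>"] rec show ?case by blast
  qed
  have \<sigma>: "0 \<le> sigma_rho \<theta> \<rho>" "(sigma_rho \<theta> \<rho>)\<^sup>2 = sigma_rho_sq \<theta> \<rho>"
    using sigma_rho_sq_nonneg[OF assms(2,3)] by (auto simp: sigma_rho_def)
  have all: "AE \<omega> in M.
      (\<lambda>n. 1 / ln (real n) * (\<Sum>k=1..n. (rho_hat (\<lambda>j. X j \<omega>) k - rho_star \<theta> \<rho>)\<^sup>2)) \<longlonglongrightarrow> sigma_rho_sq \<theta> \<rho> \<and>
      limsup (\<lambda>n. ereal (sqrt (real n / (2 * ln (ln (real n)))) * (rho_hat (\<lambda>j. X j \<omega>) n - rho_star \<theta> \<rho>))) = ereal (sigma_rho \<theta> \<rho>) \<and>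
      liminf (\<lambda>n. ereal (sqrt (real n / (2 * ln (ln (real n)))) * (rho_hat (\<lambda>j. X j \<omega>) n - rho_star \<theta> \<rho>))) = - ereal (sigma_rho \<theta> \<rho>) \<and>
      limsup (\<lambda>n. ereal (real n / (2 * ln (ln (real n))) * (rho_hat (\<lambda>j. X j \<omega>) n - rho_star \<theta> \<rho>)\<^sup>2)) = ereal (sigma_rho_sq \<theta> \<rho>)"
    using laws
  proof eventually_elim
    case (elim \<omega>)
    then have up: "lil (\<lambda>n. real n * (rho_hat (\<lambda>j. X j \<omega>) n - rho_star \<theta> \<rho>)) (sqrt 2 * sigma_rho \<theta> \<rho>)"
      and dn: "lil (\<lambda>n. - (real n * (rho_hat (\<lambda>j. X j \<omega>) n - rho_star \<theta> \<rho>))) (sqrt 2 * sigma_rho \<theta> \<rho>)"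
      and qsl: "(\<lambda>n. (\<Sum>k=1..n. (rho_hat (\<lambda>j. X j \<omega>) k - rho_star \<theta> \<rho>)\<^sup>2) / ln (real n)) \<longlonglongrightarrow> sigma_rho_sq \<theta> \<rho>"
      by blast+
    show ?case
      using qsl lil_estimator[OF up dn \<sigma>(1)] unfolding \<sigma>(2) by simp
  qed
  show ?thesis
    using all by (intro conjI; eventually_elim) auto
qed

end
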